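(* Let $K$ be a (small) differential subfield of $\mathcal{U}$, and let $V\subset\mathbb{P}^n=\mathbb{P}^n(\mathcal{U})$ be a complete differential variety defined and irreducible over $K$. Let $$ld(V):=\{x\in\mathbb{P}^n \mid x \text{ is linearly dependent over } V\}.$$ Then $ld(V)$ is a differential subvariety (i.e. a $\Delta$-closed subset) of $\mathbb{P}^n$, defined over $K$ and irreducible over $K$.
   Context: $(\mathcal{U},\Delta)$, with $\Delta=\{\delta_1,\dots,\delta_m\}$ commuting derivations, is a universal domain for differential algebraic geometry: a sufficiently large saturated model of $DCF_{0,m}$ (characteristic $0$). A $\Delta$-polynomial $f\in K\{y_0,\dots,y_n\}$ is $\Delta$-homogeneous of degree $d$ if $f(ty_0,\dots,ty_n)=t^d f(y_0,\dots,y_n)$ for $t$ another $\Delta$-indeterminate. $\Delta$-closed subsets of $\mathbb{P}^n$ defined over $K$ are the zero sets of collections of $\Delta$-homogeneous $\Delta$-polynomials over $K$; these are also called projective differential varieties. $\Delta$-closed subsets of products of projective spaces are defined by $\Delta$-polynomials that are $\Delta$-homogeneous separately in each group of variables. A $\Delta$-closed set defined over $K$ is irreducible over $K$ if it is nonempty and not the union of two proper $\Delta$-closed subsets defined over $K$. A quasiprojective differential variety is a $\Delta$-open subset of a projective differential variety. Complete: a $\Delta$-closed $V\subseteq\mathbb{P}^n$ is complete if the projection $\pi_2\colon V\times Y\to Y$ is a $\Delta$-closed map for every quasiprojective differential variety $Y$. Linear dependence: $\bar a=(a_0,\dots,a_n)\in\mathbb{A}^{n+1}$ is linearly dependent over $V$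 if there is $v=[v_0:\cdots:v_n]\in V$ with $\sum_{i=0}^n v_ia_i=0$. A point of $\mathbb{P}^n$ is linearly dependent over $V$ if some (equivalently any) representative of it is. The inclusion $V\subset\mathbb{P}^n$ is proper, so $n\ge 1$. *)

theory Defs
  imports "HOL-Algebra.Algebraic_Closure_Type" "HOL-Library.Poly_Mapping"
begin

section \<open>Differential fields\<close>

text \<open>
  A family of derivations is a function \<open>D :: 'm \<Rightarrow> 'b \<Rightarrow> 'b\<close>; its index type plays the role of
  \<open>{1, \<dots>, m}\<close> and is finite wherever this matters. The universal domain lives on a type
  \<open>'a :: field_char_0\<close>. Other differential fields (the extensions that occur in the definition
  of existential closedness) are \<open>HOL-Algebra\<close> records.
\<close>

definition differential_field :: "('b, 'c) ring_scheme \<Rightarrow> ('m \<Rightarrow> 'b \<Rightarrow> 'b) \<Rightarrow> bool" where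
  "differential_field R D \<longleftrightarrow>
     field R \<and>
     (\<forall>i. \<forall>a\<in>carrier R. D i a \<in> carrier R) \<and>
     (\<forall>i. \<forall>a\<in>carrier R. \<forall>b\<in>carrier R.
        D i (a \<oplus>\<^bsub>R\<^esub> b) = D i a \<oplus>\<^bsub>R\<^esub> D i b \<and>
        D i (a \<otimes>\<^bsub>R\<^esub> b) = D i a \<otimes>\<^bsub>R\<^esub> b \<oplus>\<^bsub>R\<^esub> a \<otimes>\<^bsub>R\<^esub> D i b) \<and>
     (\<forall>i j. \<forall>a\<in>carrier R. D i (D j a) = D j (D i a))"

definition differential_subfield :: "('m \<Rightarrow> 'a::field \<Rightarrow> 'a) \<Rightarrow> 'a set \<Rightarrow> bool" where
  "differential_subfield \<delta> K \<longleftrightarrow>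
     subfield K ring_of_type_algebra \<and> (\<forall>i. \<forall>a\<in>K. \<delta> i a \<in> K)"

definition differential_embedding ::
  "('m \<Rightarrow> 'a::field \<Rightarrow> 'a) \<Rightarrow> ('b, 'c) ring_scheme \<Rightarrow> ('m \<Rightarrow> 'b \<Rightarrow> 'b) \<Rightarrow> ('a \<Rightarrow> 'b) \<Rightarrow> bool" where
  "differential_embedding \<delta> L D e \<longleftrightarrow>
     e \<in> ring_hom ring_of_type_algebra L \<and> inj e \<and> (\<forall>i a. e (\<delta> i a) = D i (e a))"


section \<open>First-order formulas in the language of differential rings, and saturation\<close>

datatype ('m, 'a) dterm =
    TVar nat
  | TPar 'a
  | TZero
  | TOne
  | TAdd "('m, 'a) dterm" "('m, 'a) dterm"
  | TNeg "('m, 'a) dterm"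
  | TMul "('m, 'a) dterm" "('m, 'a) dterm"
  | TDer 'm "('m, 'a) dterm"

datatype ('m, 'a) dform =
    FEq "('m, 'a) dterm" "('m, 'a) dterm"
  | FNot "('m, 'a) dform"
  | FAnd "('m, 'a) dform" "('m, 'a) dform"
  | FEx nat "('m, 'a) dform"

primrec tvars :: "('m, 'a) dterm \<Rightarrow> nat set" where
  "tvars (TVar x) = {x}"
| "tvars (TPar a) = {}"
| "tvars TZero = {}"
| "tvars TOne = {}"
| "tvars (TAdd s t) = tvars s \<union> tvars t"
| "tvars (TNeg t) = tvars t"
| "tvars (TMul s t) = tvars s \<union> tvars t"
| "tvars (TDer i t) = tvars t"

primrec free_vars :: "('m, 'a) dform \<Rightarrow> nat set" where
  "free_vars (FEq s t) = tvars s \<union> tvars t"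
| "free_vars (FNot \<phi>) = free_vars \<phi>"
| "free_vars (FAnd \<phi> \<psi>) = free_vars \<phi> \<union> free_vars \<psi>"
| "free_vars (FEx x \<phi>) = free_vars \<phi> - {x}"

abbreviation parameters :: "('m, 'a) dform \<Rightarrow> 'a set" where
  "parameters \<equiv> set2_dform"

primrec quantifier_free :: "('m, 'a) dform \<Rightarrow> bool" where
  "quantifier_free (FEq s t) = True"
| "quantifier_free (FNot \<phi>) = quantifier_free \<phi>"
| "quantifier_free (FAnd \<phi> \<psi>) = (quantifier_free \<phi> \<and> quantifier_free \<psi>)"
| "quantifier_free (FEx x \<phi>) = False"

text \<open>The map \<open>e\<close> interprets the parameters in the structure \<open>(R, D)\<close>.\<close>

primrec teval ::
  "('b, 'c) ring_scheme \<Rightarrow> ('m \<Rightarrow> 'b \<Rightarrow> 'b) \<Rightarrow> ('a \<Rightarrow> 'b) \<Rightarrow> (nat \<Rightarrow> 'b) \<Rightarrow> ('m, 'a) dterm \<Rightarrow> 'b" where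
  "teval R D e \<rho> (TVar x) = \<rho> x"
| "teval R D e \<rho> (TPar a) = e a"
| "teval R D e \<rho> TZero = \<zero>\<^bsub>R\<^esub>"
| "teval R D e \<rho> TOne = \<one>\<^bsub>R\<^esub>"
| "teval R D e \<rho> (TAdd s t) = teval R D e \<rho> s \<oplus>\<^bsub>R\<^esub> teval R D e \<rho> t"
| "teval R D e \<rho> (TNeg t) = \<ominus>\<^bsub>R\<^esub> teval R D e \<rho> t"
| "teval R D e \<rho> (TMul s t) = teval R D e \<rho> s \<otimes>\<^bsub>R\<^esub> teval R D e \<rho> t"
| "teval R D e \<rho> (TDer i t) = D i (teval R D e \<rho> t)"

primrec sat ::
  "('b, 'c) ring_scheme \<Rightarrow> ('m \<Rightarrow> 'b \<Rightarrow> 'b) \<Rightarrow> ('a \<Rightarrow> 'b) \<Rightarrow> (nat \<Rightarrow> 'b) \<Rightarrow> ('m, 'a) dform \<Rightarrow> bool" where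
  "sat R D e \<rho> (FEq s t) \<longleftrightarrow> teval R D e \<rho> s = teval R D e \<rho> t"
| "sat R D e \<rho> (FNot \<phi>) \<longleftrightarrow> \<not> sat R D e \<rho> \<phi>"
| "sat R D e \<rho> (FAnd \<phi> \<psi>) \<longleftrightarrow> sat R D e \<rho> \<phi> \<and> sat R D e \<rho> \<psi>"
| "sat R D e \<rho> (FEx x \<phi>) \<longleftrightarrow> (\<exists>a\<in>carrier R. sat R D e (\<rho>(x := a)) \<phi>)"

text \<open>
  \<open>DCF\<^sub>0\<^sub>,\<^sub>m\<close> is the model companion of the theory of fields of characteristic \<open>0\<close> with \<open>m\<close> commuting
  derivations; its models are the existentially closed such differential fields. It suffices to
  consider extensions \<open>L\<close> whose carrier is a subset of \<open>'a\<close>: the field is infinite and the language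
  is finite, so by the downward Loewenheim-Skolem theorem a formula with a solution in some
  extension has one in an extension of the same cardinality.
\<close>

definition existentially_closed :: "('m \<Rightarrow> 'a::field_char_0 \<Rightarrow> 'a) \<Rightarrow> bool" where
  "existentially_closed \<delta> \<longleftrightarrow>
     (\<forall>(L :: 'a ring) D e \<phi> \<rho>.
        differential_field L D \<and> differential_embedding \<delta> L D e \<and>
        quantifier_free \<phi> \<and> range \<rho> \<subseteq> carrier L \<and> sat L D e \<rho> \<phi> \<longrightarrow>
        (\<exists>\<rho>'. sat ring_of_type_algebra \<delta> id \<rho>' \<phi>))"

definition model_DCF0 :: "('m \<Rightarrow> 'a::field_char_0 \<Rightarrow> 'a) \<Rightarrow> bool" where
  "model_DCF0 \<delta> \<longleftrightarrow>
     differential_field (ring_of_type_algebra :: 'a ring) \<delta> \<and> existentially_closed \<delta>"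

text \<open>A set is small if its cardinality is smaller than that of the universal domain.\<close>

definition small :: "'a set \<Rightarrow> bool" where
  "small A \<longleftrightarrow> (card_of A, card_of (UNIV :: 'a set)) \<in> ordLess"

text \<open>Every finitely satisfiable \<open>1\<close>-type (in the variable \<open>0\<close>) over a small set is realised.\<close>

definition saturated :: "('m \<Rightarrow> 'a::field_char_0 \<Rightarrow> 'a) \<Rightarrow> bool" where
  "saturated \<delta> \<longleftrightarrow>
     (\<forall>A \<Phi>. small A \<and> (\<forall>\<phi>\<in>\<Phi>. free_vars \<phi> \<subseteq> {0} \<and> parameters \<phi> \<subseteq> A) \<and>
        (\<forall>\<Phi>0. finite \<Phi>0 \<and> \<Phi>0 \<subseteq> \<Phi> \<longrightarrow>
           (\<exists>x. \<forall>\<phi>\<in>\<Phi>0. sat ring_of_type_algebra \<delta> id (\<lambda>_. x) \<phi>)) \<longrightarrow>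
        (\<exists>x. \<forall>\<phi>\<in>\<Phi>. sat ring_of_type_algebra \<delta> id (\<lambda>_. x) \<phi>))"

definition universal_domain :: "('m \<Rightarrow> 'a::field_char_0 \<Rightarrow> 'a) \<Rightarrow> bool" where
  "universal_domain \<delta> \<longleftrightarrow> model_DCF0 \<delta> \<and> saturated \<delta>"


section \<open>Differential polynomials\<close>

text \<open>
  The pair \<open>(v, \<alpha>)\<close> stands for the derivative \<open>\<delta>\<^sup>\<alpha> y\<^sub>v\<close> of the differential indeterminate \<open>y\<^sub>v\<close>, and
  a differential polynomial is a polynomial in these algebraic indeterminates: a finitely
  supported map from monomials to coefficients.
\<close>

type_synonym ('v, 'm, 'a) dpoly = "(('v \<times> ('m \<Rightarrow> nat)) \<Rightarrow>\<^sub>0 nat) \<Rightarrow>\<^sub>0 'a"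

definition dconst :: "'a::comm_ring_1 \<Rightarrow> ('v, 'm, 'a) dpoly" where
  "dconst c = Poly_Mapping.single 0 c"

definition dvar :: "'v \<Rightarrow> ('v, 'm, 'a::comm_ring_1) dpoly" where
  "dvar v = Poly_Mapping.single (Poly_Mapping.single (v, \<lambda>_. 0) 1) 1"

text \<open>
  The \<open>i\<close>-th derivation of the ring of differential polynomials: it extends \<open>\<delta> i\<close> on coefficients
  and sends \<open>\<delta>\<^sup>\<alpha> y\<^sub>v\<close> to \<open>\<delta>\<^sup>\<beta> y\<^sub>v\<close>, where \<open>\<beta>\<close> is \<open>\<alpha>\<close> with its \<open>i\<close>-th entry increased by \<open>1\<close>.
\<close>

definition pder :: "('m \<Rightarrow> 'a::comm_ring_1 \<Rightarrow> 'a) \<Rightarrow> 'm \<Rightarrow> ('v, 'm, 'a) dpoly \<Rightarrow> ('v, 'm, 'a) dpoly" where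
  "pder \<delta> i f =
     (\<Sum>M\<in>Poly_Mapping.keys f.
        Poly_Mapping.single M (\<delta> i (Poly_Mapping.lookup f M)) +
        (\<Sum>(v, \<alpha>)\<in>Poly_Mapping.keys M.
           Poly_Mapping.single
             (M - Poly_Mapping.single (v, \<alpha>) 1 + Poly_Mapping.single (v, \<alpha>(i := Suc (\<alpha> i))) 1)
             (of_nat (Poly_Mapping.lookup M (v, \<alpha>)) * Poly_Mapping.lookup f M)))"

text \<open>\<open>D\<^sup>\<alpha> x\<close>; the order of application is irrelevant since it is used with commuting \<open>D i\<close>.\<close>

definition dpow :: "('m::finite \<Rightarrow> 'b \<Rightarrow> 'b) \<Rightarrow> ('m \<Rightarrow> nat) \<Rightarrow> 'b \<Rightarrow> 'b" where
  "dpow D \<alpha> x = Finite_Set.fold (\<lambda>i. D i ^^ \<alpha> i) x UNIV"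

text \<open>Image of \<open>f\<close> under the differential ring homomorphism into \<open>('b, D)\<close> that is \<open>h\<close> on the
  coefficients and sends \<open>y\<^sub>v\<close> to \<open>\<sigma> v\<close>.\<close>

definition dinsert :: "('a \<Rightarrow> 'b) \<Rightarrow> ('m::finite \<Rightarrow> 'b \<Rightarrow> 'b) \<Rightarrow> ('v \<Rightarrow> 'b) \<Rightarrow>
    ('v, 'm, 'a::comm_ring_1) dpoly \<Rightarrow> 'b::comm_ring_1" where
  "dinsert h D \<sigma> f =
     (\<Sum>M\<in>Poly_Mapping.keys f.
        h (Poly_Mapping.lookup f M) *
        (\<Prod>(v, \<alpha>)\<in>Poly_Mapping.keys M. dpow D \<alpha> (\<sigma> v) ^ Poly_Mapping.lookup M (v, \<alpha>)))"

definition deval :: "('m::finite \<Rightarrow> 'a::comm_ring_1 \<Rightarrow> 'a) \<Rightarrow> ('v \<Rightarrow> 'a) \<Rightarrow> ('v, 'm, 'a) dpoly \<Rightarrow> 'a" where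
  "deval \<delta> = dinsert id \<delta>"

definition dsubst :: "('m::finite \<Rightarrow> 'a::comm_ring_1 \<Rightarrow> 'a) \<Rightarrow> ('v \<Rightarrow> ('w, 'm, 'a) dpoly) \<Rightarrow>
    ('v, 'm, 'a) dpoly \<Rightarrow> ('w, 'm, 'a) dpoly" where
  "dsubst \<delta> = dinsert dconst (pder \<delta>)"

text \<open>\<open>K{y\<^sub>v | v \<in> S}\<close>\<close>

definition dpolys :: "'a set \<Rightarrow> 'v set \<Rightarrow> ('v, 'm, 'a::comm_ring_1) dpoly set" where
  "dpolys K S =
     {f. \<forall>M\<in>Poly_Mapping.keys f.
           Poly_Mapping.lookup f M \<in> K \<and> Poly_Mapping.keys M \<subseteq> S \<times> UNIV}"

text \<open>
  \<open>\<Delta>\<close>-homogeneity of degree \<open>d\<close> in the group of variables \<open>y\<^sub>v\<close>, \<open>v \<in> S\<close>. The additional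
  \<open>\<Delta>\<close>-indeterminate \<open>t\<close> is \<open>dvar None\<close>.
\<close>

definition dhomogeneous_in ::
  "('m::finite \<Rightarrow> 'a::comm_ring_1 \<Rightarrow> 'a) \<Rightarrow> 'v set \<Rightarrow> nat \<Rightarrow> ('v, 'm, 'a) dpoly \<Rightarrow> bool" where
  "dhomogeneous_in \<delta> S d f \<longleftrightarrow>
     dsubst \<delta> (\<lambda>v. if v \<in> S then dvar None * dvar (Some v) else dvar (Some v)) f =
     dvar None ^ d * dsubst \<delta> (\<lambda>v. dvar (Some v)) f"

abbreviation dhomogeneous ::
  "('m::finite \<Rightarrow> 'a::comm_ring_1 \<Rightarrow> 'a) \<Rightarrow> nat \<Rightarrow> ('v, 'm, 'a) dpoly \<Rightarrow> bool" where
  "dhomogeneous \<delta> \<equiv> dhomogeneous_in \<delta> UNIV"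


section \<open>Projective differential varieties\<close>

text \<open>
  Vectors \<open>(a\<^sub>0, \<dots>, a\<^sub>n)\<close> are functions on \<open>nat\<close> that vanish beyond \<open>n\<close>. A point of \<open>\<P>\<^sup>n\<close> is the set
  of all its representatives.
\<close>

definition affine_space :: "nat \<Rightarrow> (nat \<Rightarrow> 'a::field) set" where
  "affine_space n = {a. \<forall>i>n. a i = 0}"

definition proj_rel :: "nat \<Rightarrow> ((nat \<Rightarrow> 'a::field) \<times> (nat \<Rightarrow> 'a)) set" where
  "proj_rel n = {(a, b). a \<in> affine_space n - {\<lambda>_. 0} \<and> b \<in> affine_space n - {\<lambda>_. 0} \<and>
     (\<exists>c. c \<noteq> 0 \<and> b = (\<lambda>i. c * a i))}"

definition proj_space :: "nat \<Rightarrow> (nat \<Rightarrow> 'a::field) set set" where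
  "proj_space n = (affine_space n - {\<lambda>_. 0}) // proj_rel n"

definition proj_zeros ::
  "('m::finite \<Rightarrow> 'a::field \<Rightarrow> 'a) \<Rightarrow> nat \<Rightarrow> (nat, 'm, 'a) dpoly set \<Rightarrow> (nat \<Rightarrow> 'a) set set" where
  "proj_zeros \<delta> n F = {p \<in> proj_space n. \<forall>f\<in>F. \<forall>a\<in>p. deval \<delta> a f = 0}"

text \<open>\<open>\<Delta>\<close>-closed subsets of \<open>\<P>\<^sup>n\<close> defined over \<open>K\<close>; \<open>K = UNIV\<close> gives all \<open>\<Delta>\<close>-closed subsets.\<close>

definition dclosed_over :: "('m::finite \<Rightarrow> 'a::field \<Rightarrow> 'a) \<Rightarrow> 'a set \<Rightarrow> nat \<Rightarrow> (nat \<Rightarrow> 'a) set set \<Rightarrow> bool" where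
  "dclosed_over \<delta> K n C \<longleftrightarrow>
     (\<exists>F. F \<subseteq> {f \<in> dpolys K {..n}. \<exists>d. dhomogeneous \<delta> d f} \<and> C = proj_zeros \<delta> n F)"

abbreviation dclosed :: "('m::finite \<Rightarrow> 'a::field \<Rightarrow> 'a) \<Rightarrow> nat \<Rightarrow> (nat \<Rightarrow> 'a) set set \<Rightarrow> bool" where
  "dclosed \<delta> \<equiv> dclosed_over \<delta> UNIV"

definition irreducible_over :: "('m::finite \<Rightarrow> 'a::field \<Rightarrow> 'a) \<Rightarrow> 'a set \<Rightarrow> nat \<Rightarrow> (nat \<Rightarrow> 'a) set set \<Rightarrow> bool" where
  "irreducible_over \<delta> K n C \<longleftrightarrow>
     C \<noteq> {} \<and>
     \<not> (\<exists>A B. dclosed_over \<delta> K n A \<and> dclosed_over \<delta> K n B \<and> A \<subset> C \<and> B \<subset> C \<and> C = A \<union> B)"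

definition quasiprojective :: "('m::finite \<Rightarrow> 'a::field \<Rightarrow> 'a) \<Rightarrow> nat \<Rightarrow> (nat \<Rightarrow> 'a) set set \<Rightarrow> bool" where
  "quasiprojective \<delta> k Y \<longleftrightarrow> (\<exists>W C. dclosed \<delta> k W \<and> dclosed \<delta> k C \<and> Y = W - C)"

text \<open>\<open>\<Delta>\<close>-closed subsets of \<open>\<P>\<^sup>n \<times> \<P>\<^sup>k\<close>: the variables \<open>Inl 0, \<dots>, Inl n\<close> are the coordinates on the
  first factor, \<open>Inr 0, \<dots>, Inr k\<close> those on the second.\<close>

definition dclosed_prod :: "('m::finite \<Rightarrow> 'a::field \<Rightarrow> 'a) \<Rightarrow> nat \<Rightarrow> nat \<Rightarrow>
    ((nat \<Rightarrow> 'a) set \<times> (nat \<Rightarrow> 'a) set) set \<Rightarrow> bool" where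
  "dclosed_prod \<delta> n k C \<longleftrightarrow>
     (\<exists>F. F \<subseteq> {f \<in> dpolys UNIV ({..n} <+> {..k}).
              (\<exists>d. dhomogeneous_in \<delta> (range Inl) d f) \<and> (\<exists>d. dhomogeneous_in \<delta> (range Inr) d f)} \<and>
          C = {(p, q). p \<in> proj_space n \<and> q \<in> proj_space k \<and>
                 (\<forall>f\<in>F. \<forall>a\<in>p. \<forall>b\<in>q. deval \<delta> (case_sum a b) f = 0)})"

text \<open>
  \<open>V\<close> is complete if for every quasiprojective \<open>Y \<subseteq> \<P>\<^sup>k\<close> the projection \<open>V \<times> Y \<rightarrow> Y\<close> maps relatively
  closed sets to relatively closed sets.
\<close>

definition complete_variety :: "('m::finite \<Rightarrow> 'a::field \<Rightarrow> 'a) \<Rightarrow> nat \<Rightarrow> (nat \<Rightarrow> 'a) set set \<Rightarrow> bool" where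
  "complete_variety \<delta> n V \<longleftrightarrow>
     dclosed \<delta> n V \<and>
     (\<forall>k Y. quasiprojective \<delta> k Y \<longrightarrow>
        (\<forall>Z. dclosed_prod \<delta> n k Z \<longrightarrow>
           (\<exists>C. dclosed \<delta> k C \<and> snd ` (Z \<inter> V \<times> Y) = C \<inter> Y)))"


section \<open>Linear dependence over a projective variety\<close>

definition lin_dependent :: "nat \<Rightarrow> (nat \<Rightarrow> 'a::field) set set \<Rightarrow> (nat \<Rightarrow> 'a) \<Rightarrow> bool" where
  "lin_dependent n V a \<longleftrightarrow> (\<exists>p\<in>V. \<exists>v\<in>p. (\<Sum>i=0..n. v i * a i) = 0)"

definition ld :: "nat \<Rightarrow> (nat \<Rightarrow> 'a::field) set set \<Rightarrow> (nat \<Rightarrow> 'a) set set" where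
  "ld n V = {x \<in> proj_space n. \<exists>a\<in>x. lin_dependent n V a}"

end

theory Submission
  imports Defs "HOL-Library.Countable"
begin

text \<open>
  By completeness \<open>ld n V\<close>, a projection of the incidence variety, is closed over the universal domain
  \<open>U\<close>. To descend to \<open>K\<close>, apply \<open>K\<close>-linear functionals \<open>U \<rightarrow> K\<close> to the coefficients of its defining
  polynomials: a linear relation over \<open>U\<close> that holds between functions over \<open>K\<close> on a set defined over
  \<open>K\<close> is a combination of relations over \<open>K\<close>. Indeed its reduced echelon form is determined by the
  set, and an element \<open>a\<close> of \<open>U\<close> outside \<open>K\<close> can be moved: \<open>a \<otimes> 1 - 1 \<otimes> a\<close> is not nilpotent over \<open>K\<close>, so a prime
  differential ideal avoids it, and existential closedness together with saturation realises its
  residue field in \<open>U\<close>.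

  For irreducibility, each hyperplane orthogonal to a point \<open>v\<close> of \<open>V\<close> is irreducible, since differential polynomials
  restrict to ordinary ones on the integer points of a line. If \<open>ld n V\<close> is covered by two closed subsets, the points
  \<open>v\<close> whose hyperplane lies in a given one of them form a subset of \<open>V\<close> closed over \<open>K\<close>, and these two subsets cover \<open>V\<close>.
\<close>

section \<open>Commuting derivations\<close>

text \<open>What is known of the universal domain is existential closedness and saturation for
  1-types; homogeneity and quantifier elimination are not among the assumptions. The role of
  automorphisms over \<open>K\<close> is therefore played by specializations: a tuple is replaced by
  one that satisfies every equation over \<open>K\<close> true of it. The new tuple may satisfy more
  equations than the old one, and this one-sidedness shapes the proof. A set to which descent is
  applied has to be stable under it, so a nonzero entry is recorded by an extra coordinate inverse
  to it, and the point \<open>v\<close> that witnesses linear dependence stays in the tuple instead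
  of being quantified away.

  A functional \<open>U \<rightarrow> K\<close> need not respect products or the derivations. It is
  applied to coefficients only, while the jets are evaluated as they stand. Its commutator with a
  derivation is again \<open>K\<close>-linear, which makes the ideal tested by all functionals
  differential.

  Irreducibility is wanted over \<open>K\<close>, so the polynomials that detect whether the
  hyperplane of \<open>v\<close> lies in a closed set must have coefficients in \<open>K\<close>;
  the functionals supply these too.\<close>

definition derivations :: "('m \<Rightarrow> 'b::comm_ring_1 \<Rightarrow> 'b) \<Rightarrow> bool" where
  "derivations D \<longleftrightarrow>
     (\<forall>i x y. D i (x + y) = D i x + D i y) \<and>
     (\<forall>i x y. D i (x * y) = D i x * y + x * D i y) \<and>
     (\<forall>i j x. D i (D j x) = D j (D i x))"

definition ring_morphism :: "('b::comm_ring_1 \<Rightarrow> 'c::comm_ring_1) \<Rightarrow> bool" where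
  "ring_morphism h \<longleftrightarrow> h 1 = 1 \<and> (\<forall>x y. h (x + y) = h x + h y) \<and> (\<forall>x y. h (x * y) = h x * h y)"

lemma derivations_add: "derivations D \<Longrightarrow> D i (x + y) = D i x + D i y"
  and derivations_mult: "derivations D \<Longrightarrow> D i (x * y) = D i x * y + x * D i y"
  and derivations_commute: "derivations D \<Longrightarrow> D i (D j x) = D j (D i x)"
  by (auto simp: derivations_def)

lemma ring_morphism_one: "ring_morphism h \<Longrightarrow> h 1 = 1"
  and ring_morphism_add: "ring_morphism h \<Longrightarrow> h (x + y) = h x + h y"
  and ring_morphism_mult: "ring_morphism h \<Longrightarrow> h (x * y) = h x * h y"
  by (auto simp: ring_morphism_def)

lemma additive_zero:
  fixes h :: "'b::ab_group_add \<Rightarrow> 'c::ab_group_add"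
  assumes "\<And>x y. h (x + y) = h x + h y"
  shows "h 0 = 0"
  using assms[of 0 0] by simp

lemma additive_minus:
  fixes h :: "'b::ab_group_add \<Rightarrow> 'c::ab_group_add"
  assumes "\<And>x y. h (x + y) = h x + h y"
  shows "h (- x) = - h x"
  using assms[of x "- x"] additive_zero[of h, OF assms] by (simp add: eq_neg_iff_add_eq_0 add.commute)

lemma additive_diff:
  fixes h :: "'b::ab_group_add \<Rightarrow> 'c::ab_group_add"
  assumes "\<And>x y. h (x + y) = h x + h y"
  shows "h (x - y) = h x - h y"
  using assms[of x "- y"] additive_minus[of h, OF assms] by simp

lemma additive_sum:
  fixes h :: "'b::ab_group_add \<Rightarrow> 'c::ab_group_add"
  assumes "\<And>x y. h (x + y) = h x + h y"
  shows "h (sum f A) = (\<Sum>a\<in>A. h (f a))"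
  by (induction A rule: infinite_finite_induct) (auto simp: assms additive_zero[of h, OF assms])

lemma derivations_zero: "derivations D \<Longrightarrow> D i 0 = 0"
  by (rule additive_zero, rule derivations_add)

lemma derivations_one: "derivations D \<Longrightarrow> D i 1 = 0"
  using derivations_mult[of D i 1 1] by simp

lemma derivations_of_nat: "derivations D \<Longrightarrow> D i (of_nat n) = 0"
  by (induction n) (auto simp: derivations_zero derivations_one derivations_add)

lemma derivations_power:
  assumes "derivations D"
  shows "D i (x ^ Suc n) = of_nat (Suc n) * x ^ n * D i x"
proof (induction n)
  case (Suc n)
  then show ?case
    using derivations_mult[OF assms, of i x "x ^ Suc n"] by (simp add: algebra_simps)
qed simp

lemma derivations_ring_of_type:
  assumes "differential_field (ring_of_type_algebra :: 'a::field ring) \<delta>"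
  shows "derivations \<delta>"
  using assms by (auto simp: differential_field_def derivations_def ring_of_type_algebra_def)

lemma ring_morphism_zero: "ring_morphism h \<Longrightarrow> h 0 = 0"
  by (rule additive_zero, rule ring_morphism_add)

lemma ring_morphism_minus: "ring_morphism h \<Longrightarrow> h (- x) = - h x"
  by (rule additive_minus, rule ring_morphism_add)

lemma ring_morphism_sum: "ring_morphism h \<Longrightarrow> h (sum f A) = (\<Sum>a\<in>A. h (f a))"
  by (rule additive_sum, rule ring_morphism_add)

lemma ring_morphism_prod: "ring_morphism h \<Longrightarrow> h (prod f A) = (\<Prod>a\<in>A. h (f a))"
  by (induction A rule: infinite_finite_induct) (auto simp: ring_morphism_one ring_morphism_mult)

lemma ring_morphism_power: "ring_morphism h \<Longrightarrow> h (x ^ n) = h x ^ n"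
  by (induction n) (auto simp: ring_morphism_one ring_morphism_mult)

text \<open>\<open>dpow\<close> is a fold over the index set; its recursion equations become
  available only once the iterated derivations are known to commute.\<close>

lemma comp_fun_commute_dpow:
  assumes "\<And>i j x. D i (D j x) = D j (D i x)"
  shows "comp_fun_commute_on UNIV (\<lambda>i. (D i :: 'b \<Rightarrow> 'b) ^^ \<alpha> i)"
proof
  fix i j
  have *: "(D i ^^ m) (D j x) = D j ((D i ^^ m) x)" for m x
    by (induction m) (auto simp: assms)
  have "(D i ^^ m) ((D j ^^ n) x) = (D j ^^ n) ((D i ^^ m) x)" for m n x
    by (induction n) (auto simp: *)
  then show "D j ^^ \<alpha> j \<circ> D i ^^ \<alpha> i = D i ^^ \<alpha> i \<circ> D j ^^ \<alpha> j"
    by auto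
qed

lemma dpow_zero:
  fixes D :: "'m::finite \<Rightarrow> 'b \<Rightarrow> 'b"
  shows "dpow D (\<lambda>_. 0) x = x"
proof -
  interpret comp_fun_commute_on UNIV "\<lambda>i::'m. \<lambda>a::'b. a"
    by standard auto
  have "Finite_Set.fold (\<lambda>i::'m. \<lambda>a::'b. a) x A = x" if "finite A" for A
    using that by induction (auto simp: fold_insert)
  then show ?thesis
    by (simp add: dpow_def id_def)
qed

text \<open>\<open>h\<close> is any map intertwining the operators: besides ring morphisms,
  multiplication by a natural number is used later, when polynomials are restricted to a
  line.\<close>

lemma dpow_hom:
  fixes D :: "'m::finite \<Rightarrow> 'b \<Rightarrow> 'b" and D' :: "'m \<Rightarrow> 'c \<Rightarrow> 'c"
  assumes "\<And>i j x. D i (D j x) = D j (D i x)" "\<And>i j x. D' i (D' j x) = D' j (D' i x)"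
    and "\<And>i x. h (D i x) = D' i (h x)"
  shows "h (dpow D \<alpha> x) = dpow D' \<alpha> (h x)"
proof -
  interpret A: comp_fun_commute_on UNIV "\<lambda>i. D i ^^ \<alpha> i"
    using assms(1) by (rule comp_fun_commute_dpow)
  interpret B: comp_fun_commute_on UNIV "\<lambda>i. D' i ^^ \<alpha> i"
    using assms(2) by (rule comp_fun_commute_dpow)
  have *: "h ((D i ^^ n) y) = (D' i ^^ n) (h y)" for i n y
    by (induction n) (auto simp: assms)
  have "h (Finite_Set.fold (\<lambda>i. D i ^^ \<alpha> i) x A) = Finite_Set.fold (\<lambda>i. D' i ^^ \<alpha> i) (h x) A"
    if "finite A" for A
    using that by induction (auto simp: *)
  then show ?thesis
    by (simp add: dpow_def)
qed

lemma dpow_closed: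
  fixes D :: "'m::finite \<Rightarrow> 'b \<Rightarrow> 'b"
  assumes "\<And>i j x. D i (D j x) = D j (D i x)" "\<And>i y. y \<in> C \<Longrightarrow> D i y \<in> C" "x \<in> C"
  shows "dpow D \<alpha> x \<in> C"
proof -
  interpret A: comp_fun_commute_on UNIV "\<lambda>i. D i ^^ \<alpha> i"
    using assms(1) by (rule comp_fun_commute_dpow)
  have *: "(D i ^^ n) y \<in> C" if "y \<in> C" for i n y
    using that by (induction n) (auto simp: assms)
  have "Finite_Set.fold (\<lambda>i. D i ^^ \<alpha> i) x A \<in> C" if "finite A" for A
    using that by induction (auto simp: * assms)
  then show ?thesis
    by (simp add: dpow_def)
qed

lemma dpow_add:
  fixes D :: "'m::finite \<Rightarrow> 'b::ab_group_add \<Rightarrow> 'b"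
  assumes "\<And>i j x. D i (D j x) = D j (D i x)" "\<And>i x y. D i (x + y) = D i x + D i y"
  shows "dpow D \<alpha> (x + y) = dpow D \<alpha> x + dpow D \<alpha> y"
proof -
  interpret A: comp_fun_commute_on UNIV "\<lambda>i. D i ^^ \<alpha> i"
    using assms(1) by (rule comp_fun_commute_dpow)
  have *: "(D i ^^ n) (x + y) = (D i ^^ n) x + (D i ^^ n) y" for i n x y
    by (induction n) (auto simp: assms)
  have "Finite_Set.fold (\<lambda>i. D i ^^ \<alpha> i) (x + y) A =
      Finite_Set.fold (\<lambda>i. D i ^^ \<alpha> i) x A + Finite_Set.fold (\<lambda>i. D i ^^ \<alpha> i) y A" if "finite A" for A
    using that by induction (auto simp: *)
  then show ?thesis
    by (simp add: dpow_def)
qed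

lemma dpow_Suc:
  fixes D :: "'m::finite \<Rightarrow> 'b \<Rightarrow> 'b"
  assumes "\<And>i j x. D i (D j x) = D j (D i x)"
  shows "dpow D (\<alpha>(i := Suc (\<alpha> i))) x = D i (dpow D \<alpha> x)"
proof -
  let ?\<beta> = "\<alpha>(i := Suc (\<alpha> i))"
  interpret A: comp_fun_commute_on UNIV "\<lambda>i. D i ^^ \<alpha> i"
    using assms by (rule comp_fun_commute_dpow)
  interpret B: comp_fun_commute_on UNIV "\<lambda>i. D i ^^ ?\<beta> i"
    using assms by (rule comp_fun_commute_dpow)
  \<comment> \<open>Away from \<open>i\<close> both families of exponents agree, so the two folds
    over the complement of \<open>i\<close> coincide and differ only by the final application of
    \<open>D i\<close>.\<close>
  have eq: "Finite_Set.fold (\<lambda>j. D j ^^ ?\<beta> j) x A = Finite_Set.fold (\<lambda>j. D j ^^ \<alpha> j) x A"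
    if "finite A" "i \<notin> A" for A
    using that
  proof induction
    case (insert j A)
    then have "?\<beta> j = \<alpha> j"
      by auto
    then show ?case
      using insert by (simp add: A.fold_insert B.fold_insert del: fun_upd_apply)
  qed simp
  have U: "UNIV = insert i (UNIV - {i})"
    by auto
  have "dpow D ?\<beta> x = (D i ^^ ?\<beta> i) (Finite_Set.fold (\<lambda>j. D j ^^ ?\<beta> j) x (UNIV - {i}))"
    unfolding dpow_def by (subst U, subst B.fold_insert) auto
  also have "\<dots> = (D i ^^ ?\<beta> i) (Finite_Set.fold (\<lambda>j. D j ^^ \<alpha> j) x (UNIV - {i}))"
    using eq[of "UNIV - {i}"] by simp
  also have "\<dots> = D i ((D i ^^ \<alpha> i) (Finite_Set.fold (\<lambda>j. D j ^^ \<alpha> j) x (UNIV - {i})))"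
    by simp
  also have "(D i ^^ \<alpha> i) (Finite_Set.fold (\<lambda>j. D j ^^ \<alpha> j) x (UNIV - {i})) = dpow D \<alpha> x"
    using A.fold_insert[of i "UNIV - {i}"] by (simp add: dpow_def insert_absorb)
  finally show ?thesis .
qed


section \<open>The ring of differential polynomials\<close>

abbreviation (input) keys :: "('k \<Rightarrow>\<^sub>0 'b::zero) \<Rightarrow> 'k set" where "keys \<equiv> Poly_Mapping.keys"
abbreviation (input) lookup :: "('k \<Rightarrow>\<^sub>0 'b::zero) \<Rightarrow> 'k \<Rightarrow> 'b" where "lookup \<equiv> Poly_Mapping.lookup"
abbreviation (input) single :: "'k \<Rightarrow> 'b \<Rightarrow> 'k \<Rightarrow>\<^sub>0 'b::zero" where "single \<equiv> Poly_Mapping.single"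

definition jet :: "'v \<Rightarrow> ('m \<Rightarrow> nat) \<Rightarrow> ('v, 'm, 'a::comm_ring_1) dpoly" where
  "jet v \<alpha> = single (single (v, \<alpha>) 1) 1"

definition mono_eval :: "('m::finite \<Rightarrow> 'b::comm_ring_1 \<Rightarrow> 'b) \<Rightarrow> ('v \<Rightarrow> 'b) \<Rightarrow> (('v \<times> ('m \<Rightarrow> nat)) \<Rightarrow>\<^sub>0 nat) \<Rightarrow> 'b" where
  "mono_eval D \<sigma> M = (\<Prod>(v, \<alpha>)\<in>keys M. dpow D \<alpha> (\<sigma> v) ^ lookup M (v, \<alpha>))"

lemma dvar_eq_jet: "dvar v = jet v (\<lambda>_. 0)"
  by (simp add: dvar_def jet_def)

lemma dconst_add: "dconst (a + b) = dconst a + dconst b"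
  by (simp add: dconst_def single_add)

lemma dconst_mult: "dconst (a * b) = dconst a * dconst b"
  by (simp add: dconst_def mult_single)

lemma dconst_1 [simp]: "dconst 1 = 1"
  by (simp add: dconst_def)

lemma dconst_0 [simp]: "dconst 0 = 0"
  by (simp add: dconst_def)

lemma ring_morphism_dconst: "ring_morphism dconst"
  by (simp add: ring_morphism_def dconst_add dconst_mult)

lemma poly_mapping_sum_single:
  fixes f :: "'k \<Rightarrow>\<^sub>0 'a::comm_monoid_add"
  shows "f = (\<Sum>M\<in>keys f. single M (lookup f M))"
proof (rule poly_mapping_eqI)
  fix M
  have "(\<Sum>N\<in>keys f. lookup (single N (lookup f N)) M) =
      (\<Sum>N\<in>keys f. if M = N then lookup f N else 0)"
    by (intro sum.cong) (auto simp: lookup_single when_def)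
  also have "\<dots> = lookup f M"
    by (simp add: sum.delta' in_keys_iff)
  finally show "lookup f M =
      lookup (\<Sum>M\<in>keys f. single M (lookup f M)) M"
    by (simp add: lookup_sum)
qed

lemma single_eq_dconst_mult: "single M c = dconst c * single M 1"
  by (simp add: dconst_def mult_single)

text \<open>Induction on the total degree, splitting off one variable at a time.\<close>

lemma mono_induct [consumes 1, case_names zero add]:
  fixes M :: "'k \<Rightarrow>\<^sub>0 nat"
  assumes "keys M \<subseteq> S"
    and "P 0" "\<And>k M. P M \<Longrightarrow> k \<in> S \<Longrightarrow> P (single k 1 + M)"
  shows "P M"
proof -
  have "\<forall>M. (\<Sum>k\<in>keys M. lookup M k) = n \<and> keys M \<subseteq> S \<longrightarrow> P M" for n
  proof (induction n)
    case 0
    show ?case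
    proof (intro allI impI, elim conjE)
      fix M :: "'k \<Rightarrow>\<^sub>0 nat"
      assume "(\<Sum>k\<in>keys M. lookup M k) = 0"
      then have "M = 0"
        by (intro poly_mapping_eqI) (auto simp: in_keys_iff)
      then show "P M"
        using assms(2) by simp
    qed
  next
    case (Suc n)
    show ?case
    proof (intro allI impI, elim conjE)
      fix M :: "'k \<Rightarrow>\<^sub>0 nat"
      assume *: "(\<Sum>k\<in>keys M. lookup M k) = Suc n" "keys M \<subseteq> S"
      then have "keys M \<noteq> {}"
        by auto
      then obtain k where k: "k \<in> keys M"
        by blast
      define N where "N = M - single k 1"
      have M: "M = single k 1 + N"
        using k by (intro poly_mapping_eqI)
          (auto simp: N_def lookup_add lookup_minus lookup_single when_def in_keys_iff)
      have kN: "keys N \<subseteq> keys M"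
        by (auto simp: M in_keys_iff lookup_add)
      have "(\<Sum>k\<in>keys N. lookup N k) = (\<Sum>k\<in>keys M. lookup N k)"
        using kN by (intro sum.mono_neutral_left) (auto simp: in_keys_iff)
      moreover have "(\<Sum>j\<in>keys M. lookup M j) =
          (\<Sum>j\<in>keys M. (if k = j then 1 else 0) + lookup N j)"
        by (intro sum.cong refl, subst M) (auto simp: lookup_add lookup_single when_def)
      ultimately have "(\<Sum>k\<in>keys N. lookup N k) = n"
        using * k by (simp add: sum.distrib)
      then have "P N"
        using Suc kN * by blast
      then show "P M"
        using k * by (subst M, intro assms(3)) auto
    qed
  qed
  then show ?thesis
    using assms(1) by blast
qed

text \<open>Constants and jets generate the polynomials as a ring. \<open>Q 0\<close> and
  \<open>Q 1\<close> are separate cases because \<open>K\<close> is an arbitrary set here and may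
  contain neither element.\<close>

lemma dpoly_induct_jets:
  fixes f :: "('v, 'm, 'a::comm_ring_1) dpoly"
  assumes "f \<in> dpolys K S"
    and const: "\<And>c. c \<in> K \<Longrightarrow> Q (dconst c)" and zero: "Q 0" and one: "Q 1"
    and jet: "\<And>v \<alpha>. v \<in> S \<Longrightarrow> Q (jet v \<alpha>)"
    and add: "\<And>f g. Q f \<Longrightarrow> Q g \<Longrightarrow> Q (f + g)" and mult: "\<And>f g. Q f \<Longrightarrow> Q g \<Longrightarrow> Q (f * g)"
  shows "Q f"
proof -
  have mono: "Q (single M 1)" if "keys M \<subseteq> S \<times> UNIV" for M
    using that
  proof (induction rule: mono_induct)
    case zero
    show ?case
      using one by simp
  next
    case (add k M)
    then have "fst k \<in> S" "Q (single M 1)"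
      by auto
    then have "Q (jet (fst k) (snd k) * single M 1)"
      by (intro mult jet)
    then show ?case
      by (simp add: jet_def mult_single)
  qed
  have "Q (\<Sum>M\<in>A. single M (lookup f M))" if "A \<subseteq> keys f" for A
  proof -
    have "finite A"
      using that by (rule finite_subset) simp
    then show ?thesis
      using that
    proof induction
      case (insert M A)
      then have "lookup f M \<in> K" "keys M \<subseteq> S \<times> UNIV"
        using assms(1) by (auto simp: dpolys_def)
      then have "Q (dconst (lookup f M))" "Q (single M 1)"
        by (simp_all add: const mono)
      then have "Q (single M (lookup f M))"
        by (subst single_eq_dconst_mult) (rule mult)
      then show ?case
        using insert by (simp add: add)
    qed (simp add: zero)
  qed
  from this[of "keys f"] show ?thesis
    by (subst poly_mapping_sum_single) blast
qed

lemma dpolys_UNIV [simp]: "f \<in> dpolys UNIV UNIV"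
  by (simp add: dpolys_def)

section \<open>Evaluation homomorphisms\<close>

lemma dinsert_eq: "dinsert h D \<sigma> f = (\<Sum>M\<in>keys f. h (lookup f M) * mono_eval D \<sigma> M)"
  by (simp add: dinsert_def mono_eval_def)

lemma dinsert_superset:
  assumes "h 0 = 0" "finite A" "keys f \<subseteq> A"
  shows "dinsert h D \<sigma> f = (\<Sum>M\<in>A. h (lookup f M) * mono_eval D \<sigma> M)"
  unfolding dinsert_eq using assms by (intro sum.mono_neutral_left) (auto simp: in_keys_iff)

text \<open>Additivity of \<open>h\<close> is all that is asked for: later \<open>h\<close> is also
  a \<open>K\<close>-linear functional, which need not be multiplicative.\<close>

lemma dinsert_add:
  assumes "\<And>x y. h (x + y) = h x + h y"
  shows "dinsert h D \<sigma> (f + g) = dinsert h D \<sigma> f + dinsert h D \<sigma> g"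
proof -
  have h0: "h 0 = 0"
    by (rule additive_zero[of h]) (rule assms)
  let ?A = "keys f \<union> keys g"
  have "dinsert h D \<sigma> (f + g) = (\<Sum>M\<in>?A. h (lookup (f + g) M) * mono_eval D \<sigma> M)"
    using keys_add[of f g] by (intro dinsert_superset h0) auto
  moreover have "dinsert h D \<sigma> f = (\<Sum>M\<in>?A. h (lookup f M) * mono_eval D \<sigma> M)"
    by (intro dinsert_superset h0) auto
  moreover have "dinsert h D \<sigma> g = (\<Sum>M\<in>?A. h (lookup g M) * mono_eval D \<sigma> M)"
    by (intro dinsert_superset h0) auto
  ultimately show ?thesis
    by (simp add: lookup_add assms algebra_simps sum.distrib)
qed

lemma dinsert_single:
  assumes "h 0 = 0"
  shows "dinsert h D \<sigma> (single M c) = h c * mono_eval D \<sigma> M"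
  by (subst dinsert_superset[where A = "{M}"]) (auto simp: assms)

lemma mono_eval_superset:
  assumes "finite A" "keys M \<subseteq> A"
  shows "mono_eval D \<sigma> M = (\<Prod>(v, \<alpha>)\<in>A. dpow D \<alpha> (\<sigma> v) ^ lookup M (v, \<alpha>))"
  unfolding mono_eval_def using assms by (intro prod.mono_neutral_left) (auto simp: in_keys_iff)

lemma mono_eval_add: "mono_eval D \<sigma> (M + N) = mono_eval D \<sigma> M * mono_eval D \<sigma> N"
proof -
  let ?A = "keys M \<union> keys N"
  have "mono_eval D \<sigma> (M + N) = (\<Prod>(v, \<alpha>)\<in>?A. dpow D \<alpha> (\<sigma> v) ^ lookup (M + N) (v, \<alpha>))"
    using keys_add[of M N] by (intro mono_eval_superset) auto
  moreover have "mono_eval D \<sigma> M = (\<Prod>(v, \<alpha>)\<in>?A. dpow D \<alpha> (\<sigma> v) ^ lookup M (v, \<alpha>))"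
    by (intro mono_eval_superset) auto
  moreover have "mono_eval D \<sigma> N = (\<Prod>(v, \<alpha>)\<in>?A. dpow D \<alpha> (\<sigma> v) ^ lookup N (v, \<alpha>))"
    by (intro mono_eval_superset) auto
  ultimately show ?thesis
    by (simp add: lookup_add power_add prod.distrib case_prod_beta)
qed

lemma mono_eval_zero [simp]: "mono_eval D \<sigma> 0 = 1"
  by (simp add: mono_eval_def)

lemma mono_eval_single: "mono_eval D \<sigma> (single (v, \<alpha>) 1) = dpow D \<alpha> (\<sigma> v)"
  by (simp add: mono_eval_def)

lemma dinsert_zero [simp]: "dinsert h D \<sigma> 0 = 0"
  by (simp add: dinsert_eq)

lemma dinsert_sum:
  assumes "\<And>x y. h (x + y) = h x + h y"
  shows "dinsert h D \<sigma> (sum f A) = (\<Sum>a\<in>A. dinsert h D \<sigma> (f a))"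
  by (rule additive_sum) (rule dinsert_add, rule assms)

lemma dinsert_mult:
  assumes "ring_morphism h"
  shows "dinsert h D \<sigma> (f * g) = dinsert h D \<sigma> f * dinsert h D \<sigma> g"
proof -
  note h = ring_morphism_add[OF assms]
  note h0 = ring_morphism_zero[OF assms]
  let ?f = "\<lambda>M. single M (lookup f M)"
  let ?g = "\<lambda>M. single M (lookup g M)"
  have "f * g = (\<Sum>M\<in>keys f. \<Sum>N\<in>keys g. ?f M * ?g N)"
    unfolding sum_product[symmetric] poly_mapping_sum_single[symmetric] by (rule refl)
  then have "dinsert h D \<sigma> (f * g) =
      (\<Sum>M\<in>keys f. \<Sum>N\<in>keys g. dinsert h D \<sigma> (?f M * ?g N))"
    by (simp add: dinsert_sum h)
  also have "\<dots> = (\<Sum>M\<in>keys f. \<Sum>N\<in>keys g.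
      (h (lookup f M) * mono_eval D \<sigma> M) * (h (lookup g N) * mono_eval D \<sigma> N))"
    by (intro sum.cong refl)
      (simp add: mult_single dinsert_single h0 mono_eval_add ring_morphism_mult[OF assms] algebra_simps)
  also have "\<dots> = dinsert h D \<sigma> f * dinsert h D \<sigma> g"
    by (simp add: dinsert_eq sum_product)
  finally show ?thesis .
qed

lemma dinsert_dconst: "h 0 = 0 \<Longrightarrow> dinsert h D \<sigma> (dconst c) = h c"
  by (simp add: dconst_def dinsert_single)

lemma dinsert_jet: "ring_morphism h \<Longrightarrow> dinsert h D \<sigma> (jet v \<alpha>) = dpow D \<alpha> (\<sigma> v)"
  using mono_eval_single[of D \<sigma> v \<alpha>]
  by (simp add: jet_def dinsert_single ring_morphism_zero ring_morphism_one)

lemma dinsert_dvar: "ring_morphism h \<Longrightarrow> dinsert h D \<sigma> (dvar v) = \<sigma> v"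
  by (simp add: dvar_eq_jet dinsert_jet dpow_zero)

lemma ring_morphism_dinsert:
  assumes "ring_morphism h"
  shows "ring_morphism (dinsert h D \<sigma>)"
  using dinsert_dconst[of h D \<sigma> 1] assms
  by (auto simp: ring_morphism_def dinsert_mult dinsert_add ring_morphism_zero)

section \<open>The derivations of the ring of differential polynomials\<close>

definition jet_shift :: "'m \<Rightarrow> 'v \<times> ('m \<Rightarrow> nat) \<Rightarrow> 'v \<times> ('m \<Rightarrow> nat)" where
  "jet_shift i = (\<lambda>(v, \<alpha>). (v, \<alpha>(i := Suc (\<alpha> i))))"

text \<open>The derivative of the monomial \<open>M\<close> with coefficient 1, by the Leibniz rule.
  Since \<open>k\<close> ranges over the support of \<open>M\<close>, the truncated subtraction of
  exponents is a true one.\<close>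

definition mono_pder :: "'m \<Rightarrow> (('v \<times> ('m \<Rightarrow> nat)) \<Rightarrow>\<^sub>0 nat) \<Rightarrow> ('v, 'm, 'a::comm_ring_1) dpoly" where
  "mono_pder i M = (\<Sum>k\<in>keys M.
     single (M - single k 1 + single (jet_shift i k) 1)
       (of_nat (lookup M k)))"

lemma pder_eq:
  "pder \<delta> i f = (\<Sum>M\<in>keys f.
     single M (\<delta> i (lookup f M)) + dconst (lookup f M) * mono_pder i M)"
  unfolding pder_def mono_pder_def jet_shift_def
  by (simp add: sum_distrib_left dconst_def mult_single case_prod_beta mult.commute)

lemma pder_superset:
  assumes "\<delta> i 0 = 0" "finite A" "keys f \<subseteq> A"
  shows "pder \<delta> i f = (\<Sum>M\<in>A.
     single M (\<delta> i (lookup f M)) + dconst (lookup f M) * mono_pder i M)"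
  unfolding pder_eq using assms by (intro sum.mono_neutral_left) (auto simp: in_keys_iff)

lemma pder_zero [simp]: "pder \<delta> i 0 = 0"
  by (simp add: pder_eq)

lemma pder_add:
  assumes "derivations \<delta>"
  shows "pder \<delta> i (f + g) = pder \<delta> i f + pder \<delta> i g"
proof -
  note z = derivations_zero[OF assms, of i]
  let ?A = "keys f \<union> keys g"
  let ?t = "\<lambda>f M. single M (\<delta> i (lookup f M)) + dconst (lookup f M) * mono_pder i M"
  have "pder \<delta> i (f + g) = (\<Sum>M\<in>?A. ?t (f + g) M)"
    using keys_add[of f g] by (intro pder_superset z) auto
  moreover have "pder \<delta> i f = (\<Sum>M\<in>?A. ?t f M)"
    by (intro pder_superset z) auto
  moreover have "pder \<delta> i g = (\<Sum>M\<in>?A. ?t g M)"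
    by (intro pder_superset z) auto
  ultimately show ?thesis
    by (simp add: lookup_add derivations_add[OF assms] single_add dconst_add algebra_simps sum.distrib)
qed

lemma pder_sum:
  assumes "derivations \<delta>"
  shows "pder \<delta> i (sum f A) = (\<Sum>a\<in>A. pder \<delta> i (f a))"
  by (rule additive_sum) (rule pder_add[OF assms])

lemma pder_single:
  assumes "derivations \<delta>"
  shows "pder \<delta> i (single M c) = single M (\<delta> i c) + dconst c * mono_pder i M"
  by (subst pder_superset[where A = "{M}"]) (auto simp: derivations_zero[OF assms])

lemma mono_pder_superset:
  assumes "finite A" "keys M \<subseteq> A"
  shows "mono_pder i M = (\<Sum>k\<in>A.
     single (M - single k 1 + single (jet_shift i k) 1)
       (of_nat (lookup M k)))"
  unfolding mono_pder_def using assms by (intro sum.mono_neutral_left) (auto simp: in_keys_iff)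

lemma mono_pder_add:
  "mono_pder i (M + N) = mono_pder i M * single N 1 + single M 1 * mono_pder i N"
proof -
  let ?A = "keys M \<union> keys N"
  let ?t = "\<lambda>M k. single (M - single k 1 + single (jet_shift i k) 1)
       (of_nat (lookup M k))"
  have E: "?t (M + N) k = ?t M k * single N 1 + single M 1 * ?t N k" for k
  proof -
    \<comment> \<open>Subtraction of exponents is truncated, so it can be moved to one factor only
      if \<open>k\<close> occurs there. Otherwise the coefficient \<open>of_nat (lookup M k)\<close>
      is zero and the whole term vanishes.\<close>
    have 1: "M + N - single k 1 = (M - single k 1) + N"
      if "lookup M k \<noteq> 0"
      using that by (intro poly_mapping_eqI) (auto simp: lookup_add lookup_minus lookup_single when_def)
    have 2: "M + N - single k 1 = M + (N - single k 1)"
      if "lookup N k \<noteq> 0"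
      using that by (intro poly_mapping_eqI) (auto simp: lookup_add lookup_minus lookup_single when_def)
    have A: "single (M + N - single k 1 + single (jet_shift i k) 1) (of_nat (lookup M k))
        = ?t M k * single N 1"
    proof (cases "lookup M k = 0")
      case False
      have "M + N - single k 1 + single (jet_shift i k) 1 =
          (M - single k 1 + single (jet_shift i k) 1) + N"
        unfolding 1[OF False] by (simp only: ac_simps)
      then show ?thesis
        by (simp only: mult_single mult_1_right)
    qed simp
    have B: "single (M + N - single k 1 + single (jet_shift i k) 1) (of_nat (lookup N k))
        = single M 1 * ?t N k"
    proof (cases "lookup N k = 0")
      case False
      have "M + N - single k 1 + single (jet_shift i k) 1 =
          M + (N - single k 1 + single (jet_shift i k) 1)"
        unfolding 2[OF False] by (simp only: ac_simps)
      then show ?thesis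
        by (simp only: mult_single mult_1_left)
    qed simp
    show ?thesis
      unfolding A[symmetric] B[symmetric] by (simp add: lookup_add single_add)
  qed
  have "mono_pder i (M + N) = (\<Sum>k\<in>?A. ?t (M + N) k)"
    using keys_add[of M N] by (intro mono_pder_superset) auto
  also have "\<dots> = (\<Sum>k\<in>?A. ?t M k * single N 1 + single M 1 * ?t N k)"
    by (intro sum.cong refl E)
  also have "\<dots> = (\<Sum>k\<in>?A. ?t M k) * single N 1 + single M 1 * (\<Sum>k\<in>?A. ?t N k)"
    by (simp only: sum.distrib sum_distrib_left sum_distrib_right)
  also have "(\<Sum>k\<in>?A. ?t M k) = mono_pder i M"
    by (intro mono_pder_superset[symmetric]) auto
  also have "(\<Sum>k\<in>?A. ?t N k) = mono_pder i N"
    by (intro mono_pder_superset[symmetric]) auto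
  finally show ?thesis .
qed

lemma pder_mult:
  assumes "derivations \<delta>"
  shows "pder \<delta> i (f * g) = pder \<delta> i f * g + f * pder \<delta> i g"
proof -
  have single: "pder \<delta> i (single M c * single N d) =
      pder \<delta> i (single M c) * single N d +
      single M c * pder \<delta> i (single N d)" for M N c d
  proof -
    have "pder \<delta> i (single M c * single N d) =
      single (M + N) (\<delta> i (c * d)) + dconst (c * d) *
        (mono_pder i M * single N 1 + single M 1 * mono_pder i N)"
      by (simp add: mult_single pder_single[OF assms] mono_pder_add)
    also have "single (M + N) (\<delta> i (c * d)) =
        single M (\<delta> i c) * single N d + single M c * single N (\<delta> i d)"
      by (simp add: mult_single derivations_mult[OF assms] single_add)
    finally have F: "pder \<delta> i (single M c * single N d) =
        single M (\<delta> i c) * single N d + single M c * single N (\<delta> i d) +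
        dconst (c * d) * (mono_pder i M * single N 1 + single M 1 * mono_pder i N)" .
    show ?thesis
      unfolding F pder_single[OF assms]
      unfolding dconst_mult
        single_eq_dconst_mult[of M c] single_eq_dconst_mult[of N d]
        single_eq_dconst_mult[of M "\<delta> i c"] single_eq_dconst_mult[of N "\<delta> i d"]
      by (simp add: algebra_simps)
  qed
  let ?f = "\<lambda>M. single M (lookup f M)"
  let ?g = "\<lambda>M. single M (lookup g M)"
  have f: "f = (\<Sum>M\<in>keys f. ?f M)" and g: "g = (\<Sum>M\<in>keys g. ?g M)"
    by (rule poly_mapping_sum_single)+
  have "f * g = (\<Sum>M\<in>keys f. \<Sum>N\<in>keys g. ?f M * ?g N)"
    unfolding sum_product[symmetric] poly_mapping_sum_single[symmetric] by (rule refl)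
  then have "pder \<delta> i (f * g) = (\<Sum>M\<in>keys f. \<Sum>N\<in>keys g.
      pder \<delta> i (?f M) * ?g N + ?f M * pder \<delta> i (?g N))"
    by (simp add: pder_sum[OF assms] single)
  also have "\<dots> = (\<Sum>M\<in>keys f. pder \<delta> i (?f M)) * (\<Sum>M\<in>keys g. ?g M) +
      (\<Sum>M\<in>keys f. ?f M) * (\<Sum>M\<in>keys g. pder \<delta> i (?g M))"
    by (simp add: sum_product sum.distrib)
  also have "\<dots> = pder \<delta> i f * g + f * pder \<delta> i g"
    unfolding pder_sum[OF assms, symmetric] poly_mapping_sum_single[symmetric] by (rule refl)
  finally show ?thesis .
qed

lemma pder_dconst:
  assumes "derivations \<delta>"
  shows "pder \<delta> i (dconst c) = dconst (\<delta> i c)"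
  unfolding dconst_def pder_single[OF assms] by (simp add: mono_pder_def)

lemma pder_one:
  assumes "derivations \<delta>"
  shows "pder \<delta> i 1 = 0"
  using pder_dconst[OF assms, of i 1] by (simp add: derivations_one[OF assms])

lemma pder_jet:
  assumes "derivations \<delta>"
  shows "pder \<delta> i (jet v \<alpha>) = jet v (\<alpha>(i := Suc (\<alpha> i)))"
  unfolding jet_def pder_single[OF assms] by (simp add: derivations_one[OF assms] mono_pder_def jet_shift_def)

lemma pder_commute:
  assumes "derivations \<delta>"
  shows "pder \<delta> i (pder \<delta> j f) = pder \<delta> j (pder \<delta> i f)"
proof (rule dpoly_induct_jets[OF dpolys_UNIV, where f = f])
  show "pder \<delta> i (pder \<delta> j (dconst c)) = pder \<delta> j (pder \<delta> i (dconst c))" for c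
    by (simp add: pder_dconst assms derivations_commute[OF assms, of i])
  show "pder \<delta> i (pder \<delta> j (jet v \<alpha>)) = pder \<delta> j (pder \<delta> i (jet v \<alpha>))" for v \<alpha>
    by (cases "i = j") (auto simp: pder_jet assms fun_upd_twist)
  show "pder \<delta> i (pder \<delta> j 1) = pder \<delta> j (pder \<delta> i 1)"
    by (simp add: pder_one[OF assms])
qed (auto simp: pder_add pder_mult assms algebra_simps)

lemma derivations_pder: "derivations \<delta> \<Longrightarrow> derivations (pder \<delta>)"
  by (auto simp: derivations_def[of "pder \<delta>"] pder_add pder_mult intro: pder_commute)

text \<open>Identifies the algebraic indeterminates with the iterated derivatives of the
  differential ones. In the induction the partial fold carries \<open>\<alpha>\<close> cut off
  outside the indices already processed.\<close>

lemma dpow_pder_dvar: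
  fixes \<delta> :: "'m::finite \<Rightarrow> 'a::comm_ring_1 \<Rightarrow> 'a"
  assumes "derivations \<delta>"
  shows "dpow (pder \<delta>) \<alpha> (dvar v) = jet v \<alpha>"
proof -
  interpret comp_fun_commute_on UNIV "\<lambda>i. pder \<delta> i ^^ \<alpha> i"
    by (rule comp_fun_commute_dpow) (rule pder_commute[OF assms])
  have pow: "(pder \<delta> i ^^ n) (jet v \<beta>) = jet v (\<beta>(i := \<beta> i + n))" for i n \<beta>
    by (induction n) (simp_all add: pder_jet assms fun_upd_same del: fun_upd_apply)
  have "Finite_Set.fold (\<lambda>i. pder \<delta> i ^^ \<alpha> i) (dvar v) A = jet v (\<lambda>i. if i \<in> A then \<alpha> i else 0)"
    if "finite A" for A
    using that
  proof induction
    case (insert j A)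
    have "(\<lambda>i. if i \<in> A then \<alpha> i else 0)(j := \<alpha> j) = (\<lambda>i. if i \<in> insert j A then \<alpha> i else 0)"
      by auto
    then show ?case
      using insert by (simp add: pow)
  qed (simp add: dvar_eq_jet)
  from this[of UNIV] show ?thesis
    by (simp add: dpow_def)
qed

lemma dpolysI: "(\<And>M. lookup f M \<noteq> 0 \<Longrightarrow> lookup f M \<in> K \<and> keys M \<subseteq> S \<times> UNIV) \<Longrightarrow> f \<in> dpolys K S"
  by (auto simp: dpolys_def in_keys_iff)

text \<open>For properties stable under derivation: every jet arises from a variable by applying
  derivations, so the variables themselves suffice as generators.\<close>

lemma dpoly_induct:
  fixes f :: "('v, 'm::finite, 'a::comm_ring_1) dpoly"
  assumes "f \<in> dpolys K S" "derivations \<delta>" "0 \<in> K" "1 \<in> K"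
    and const: "\<And>c. c \<in> K \<Longrightarrow> Q (dconst c)"
    and var: "\<And>v. v \<in> S \<Longrightarrow> Q (dvar v)"
    and der: "\<And>i f. Q f \<Longrightarrow> Q (pder \<delta> i f)"
    and add: "\<And>f g. Q f \<Longrightarrow> Q g \<Longrightarrow> Q (f + g)" and mult: "\<And>f g. Q f \<Longrightarrow> Q g \<Longrightarrow> Q (f * g)"
  shows "Q f"
proof (rule dpoly_induct_jets[OF assms(1)])
  show "Q 0" "Q 1"
    using const[of 0] const[of 1] assms by auto
  show "Q (jet v \<alpha>)" if "v \<in> S" for v \<alpha>
  proof -
    have "dpow (pder \<delta>) \<alpha> (dvar v) \<in> Collect Q"
      by (rule dpow_closed) (rule pder_commute[OF assms(2)], simp_all only: mem_Collect_eq der var that)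
    then show ?thesis
      by (simp add: dpow_pder_dvar assms)
  qed
qed (fact const, fact add, fact mult)

lemma dinsert_pder:
  fixes \<delta> :: "'m::finite \<Rightarrow> 'a::comm_ring_1 \<Rightarrow> 'a"
  assumes \<delta>: "derivations \<delta>" and D: "derivations D" and h: "ring_morphism h"
    and comm: "\<And>i c. h (\<delta> i c) = D i (h c)"
  shows "dinsert h D \<sigma> (pder \<delta> i f) = D i (dinsert h D \<sigma> f)"
proof -
  note m = ring_morphism_dinsert[OF h, of D \<sigma>]
  show ?thesis
  proof (rule dpoly_induct_jets[OF dpolys_UNIV, where f = f])
    show "dinsert h D \<sigma> (pder \<delta> i (dconst c)) = D i (dinsert h D \<sigma> (dconst c))" for c
      by (simp add: pder_dconst \<delta> dinsert_dconst ring_morphism_zero[OF h] comm)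
    show "dinsert h D \<sigma> (pder \<delta> i (jet v \<alpha>)) = D i (dinsert h D \<sigma> (jet v \<alpha>))" for v \<alpha>
      by (simp add: pder_jet \<delta> dinsert_jet h dpow_Suc derivations_commute[OF D])
    show "dinsert h D \<sigma> (pder \<delta> i 1) = D i (dinsert h D \<sigma> 1)"
      by (simp add: derivations_one[OF D] pder_one[OF \<delta>] ring_morphism_one[OF m])
  qed (auto simp: pder_add pder_mult \<delta> ring_morphism_add[OF m] ring_morphism_mult[OF m]
      derivations_add[OF D] derivations_mult[OF D] derivations_zero[OF D])
qed

lemma hom_mono_eval:
  assumes "derivations D" "derivations D'" "ring_morphism \<Psi>" "\<And>i x. \<Psi> (D i x) = D' i (\<Psi> x)"
  shows "\<Psi> (mono_eval D \<sigma> M) = mono_eval D' (\<Psi> \<circ> \<sigma>) M"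
proof -
  have "\<Psi> (dpow D \<alpha> x) = dpow D' \<alpha> (\<Psi> x)" for \<alpha> x
    by (rule dpow_hom) (rule derivations_commute[OF assms(1)] derivations_commute[OF assms(2)] assms(4))+
  then show ?thesis
    by (simp add: mono_eval_def ring_morphism_prod[OF assms(3)] case_prod_beta ring_morphism_power[OF assms(3)])
qed

lemma hom_dinsert:
  assumes "derivations D" "derivations D'" "ring_morphism \<Psi>" "\<And>i x. \<Psi> (D i x) = D' i (\<Psi> x)"
  shows "\<Psi> (dinsert h D \<sigma> f) = dinsert (\<Psi> \<circ> h) D' (\<Psi> \<circ> \<sigma>) f"
  by (simp only: dinsert_eq ring_morphism_sum[OF assms(3)] ring_morphism_mult[OF assms(3)]
      hom_mono_eval[OF assms(1-3), OF assms(4)] comp_apply)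

section \<open>Evaluation in the field, substitution, and their composition\<close>

lemma ring_morphism_id: "ring_morphism id"
  by (simp add: ring_morphism_def)

lemma ring_morphism_deval: "ring_morphism (deval \<delta> \<sigma>)"
  by (simp add: deval_def ring_morphism_dinsert ring_morphism_id)

lemma ring_morphism_dsubst: "ring_morphism (dsubst \<delta> \<sigma>)"
  by (simp add: dsubst_def ring_morphism_dinsert ring_morphism_dconst)

lemma deval_dconst [simp]: "deval \<delta> \<sigma> (dconst c) = c"
  by (simp add: deval_def dinsert_dconst)

lemma deval_dvar [simp]: "deval \<delta> \<sigma> (dvar v) = \<sigma> v"
  by (simp add: deval_def dinsert_dvar ring_morphism_id)

lemma dsubst_dconst [simp]: "dsubst \<delta> \<sigma> (dconst c) = dconst c"
  by (simp add: dsubst_def dinsert_dconst)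

lemma dsubst_dvar [simp]: "dsubst \<delta> \<sigma> (dvar v) = \<sigma> v"
  by (simp add: dsubst_def dinsert_dvar ring_morphism_dconst)

lemma deval_pder: "derivations \<delta> \<Longrightarrow> deval \<delta> \<sigma> (pder \<delta> i f) = \<delta> i (deval \<delta> \<sigma> f)"
  unfolding deval_def by (rule dinsert_pder) (auto simp: ring_morphism_id)

lemma dsubst_pder: "derivations \<delta> \<Longrightarrow> dsubst \<delta> \<sigma> (pder \<delta> i f) = pder \<delta> i (dsubst \<delta> \<sigma> f)"
  unfolding dsubst_def by (rule dinsert_pder) (auto simp: ring_morphism_dconst derivations_pder pder_dconst)

lemma deval_dsubst:
  assumes "derivations \<delta>"
  shows "deval \<delta> \<sigma> (dsubst \<delta> \<tau> f) = deval \<delta> (\<lambda>v. deval \<delta> \<sigma> (\<tau> v)) f"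
proof -
  have "deval \<delta> \<sigma> (dinsert dconst (pder \<delta>) \<tau> f) =
      dinsert (deval \<delta> \<sigma> \<circ> dconst) \<delta> (deval \<delta> \<sigma> \<circ> \<tau>) f"
    by (rule hom_dinsert[where \<Psi> = "deval \<delta> \<sigma>"])
      (simp_all add: assms derivations_pder ring_morphism_deval deval_pder)
  moreover have "deval \<delta> \<sigma> \<circ> dconst = id"
    by auto
  ultimately show ?thesis
    by (simp only: dsubst_def deval_def comp_def)
qed

lemma dsubst_dsubst:
  assumes "derivations \<delta>"
  shows "dsubst \<delta> \<sigma> (dsubst \<delta> \<tau> f) = dsubst \<delta> (\<lambda>v. dsubst \<delta> \<sigma> (\<tau> v)) f"
proof -
  have "dsubst \<delta> \<sigma> (dinsert dconst (pder \<delta>) \<tau> f) =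
      dinsert (dsubst \<delta> \<sigma> \<circ> dconst) (pder \<delta>) (dsubst \<delta> \<sigma> \<circ> \<tau>) f"
    by (rule hom_dinsert[where \<Psi> = "dsubst \<delta> \<sigma>"])
      (simp_all add: assms derivations_pder ring_morphism_dsubst dsubst_pder)
  then show ?thesis
    by (simp add: dsubst_def comp_def dinsert_dconst)
qed

lemma dinsert_cong:
  assumes "f \<in> dpolys K S" "\<And>v. v \<in> S \<Longrightarrow> \<sigma> v = \<tau> v"
  shows "dinsert h D \<sigma> f = dinsert h D \<tau> f"
proof -
  have "mono_eval D \<sigma> M = mono_eval D \<tau> M" if "M \<in> keys f" for M
  proof -
    have "keys M \<subseteq> S \<times> UNIV"
      using that assms(1) by (simp add: dpolys_def)
    then have "fst k \<in> S" if "k \<in> keys M" for k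
      using that subsetD[of _ "S \<times> UNIV" k] by (simp only: mem_Times_iff)
    then show ?thesis
      unfolding mono_eval_def case_prod_beta by (intro prod.cong refl) (simp add: assms(2))
  qed
  then show ?thesis
    by (simp add: dinsert_eq)
qed

section \<open>Prime differential ideals\<close>

definition diff_ideal :: "('m \<Rightarrow> 'r::comm_ring_1 \<Rightarrow> 'r) \<Rightarrow> 'r set \<Rightarrow> bool" where
  "diff_ideal D P \<longleftrightarrow> 0 \<in> P \<and> (\<forall>x\<in>P. \<forall>y\<in>P. x + y \<in> P) \<and> (\<forall>x\<in>P. \<forall>r. r * x \<in> P) \<and> (\<forall>i. \<forall>x\<in>P. D i x \<in> P)"

lemma diff_ideal_zero: "diff_ideal D P \<Longrightarrow> 0 \<in> P"
  and diff_ideal_add: "diff_ideal D P \<Longrightarrow> x \<in> P \<Longrightarrow> y \<in> P \<Longrightarrow> x + y \<in> P"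
  and diff_ideal_mult: "diff_ideal D P \<Longrightarrow> x \<in> P \<Longrightarrow> r * x \<in> P"
  and diff_ideal_mult_right: "diff_ideal D P \<Longrightarrow> x \<in> P \<Longrightarrow> x * r \<in> P"
  and diff_ideal_der: "diff_ideal D P \<Longrightarrow> x \<in> P \<Longrightarrow> D i x \<in> P"
  by (auto simp: diff_ideal_def mult.commute[of x r])

lemma diff_ideal_minus: "diff_ideal D P \<Longrightarrow> x \<in> P \<Longrightarrow> - x \<in> P"
  using diff_ideal_mult[of D P x "-1"] by simp

lemma diff_ideal_diff: "diff_ideal D P \<Longrightarrow> x \<in> P \<Longrightarrow> y \<in> P \<Longrightarrow> x - y \<in> P"
  using diff_ideal_add[of D P x "- y"] diff_ideal_minus[of D P y] by simp

lemma diff_ideal_sum: "diff_ideal D P \<Longrightarrow> (\<And>a. a \<in> A \<Longrightarrow> f a \<in> P) \<Longrightarrow> sum f A \<in> P"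
  by (induction A rule: infinite_finite_induct) (auto simp: diff_ideal_zero diff_ideal_add)

text \<open>The extra factor \<open>z\<close> replaces the exponent \<open>n - 1\<close> by
  \<open>n\<close>, so that \<open>n = 0\<close> fits the same formula.\<close>

lemma derivation_power_mult:
  assumes "derivations D"
  shows "z * D i (z ^ n) = of_nat n * z ^ n * D i z"
proof (cases n)
  case (Suc k)
  then show ?thesis
    using derivations_power[OF assms, of i z k] by (simp add: algebra_simps)
qed (simp add: derivations_one[OF assms])

text \<open>With \<open>n - k\<close> and \<open>2 k\<close> as exponents of \<open>x\<close> and \<open>D i x\<close>, differentiating and multiplying by
  \<open>D i x\<close> trades one factor \<open>x\<close> for two factors \<open>D i x\<close>.\<close>

lemma radical_der:
  assumes D: "derivations D" and P: "diff_ideal D P"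
    and rat: "\<And>n::nat. n > 0 \<Longrightarrow> \<exists>y. of_nat n * y = (1::'r::comm_ring_1)"
    and "x ^ n \<in> P"
  shows "D i x ^ (2 * n) \<in> (P :: 'r set)"
proof -
  have "x ^ (n - k) * D i x ^ (2 * k) \<in> P" if "k \<le> n" for k
    using that
  proof (induction k)
    case 0
    then show ?case
      using assms by simp
  next
    case (Suc k)
    obtain r where r: "n - k = Suc r" "n - Suc k = r"
      using Suc.prems by (metis Suc_diff_Suc Suc_le_lessD)
    let ?y = "D i x ^ (2 * k)"
    have xy: "x ^ Suc r * ?y \<in> P"
      using Suc r by simp
    have "D i (x ^ Suc r * ?y) * D i x =
        of_nat (Suc r) * (x ^ r * D i x ^ (2 * Suc k)) + x ^ Suc r * (D i x * D i ?y)"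
      unfolding derivations_mult[OF D] derivations_power[OF D] by (simp add: algebra_simps power2_eq_square)
    also have "D i x * D i ?y = ?y * (of_nat (2 * k) * D i (D i x))"
      by (simp add: derivation_power_mult[OF D] algebra_simps)
    finally have "of_nat (Suc r) * (x ^ r * D i x ^ (2 * Suc k)) =
        D i (x ^ Suc r * ?y) * D i x - (x ^ Suc r * ?y) * (of_nat (2 * k) * D i (D i x))"
      by (simp add: algebra_simps)
    also have "\<dots> \<in> P"
      by (intro diff_ideal_diff[OF P] diff_ideal_mult_right[OF P] diff_ideal_der[OF P] xy)
    finally have *: "of_nat (Suc r) * (x ^ r * D i x ^ (2 * Suc k)) \<in> P" .
    obtain y :: 'r where "of_nat (Suc r) * y = 1"
      using rat[of "Suc r"] by auto
    then have "x ^ r * D i x ^ (2 * Suc k) = y * (of_nat (Suc r) * (x ^ r * D i x ^ (2 * Suc k)))"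
      by (metis mult.assoc mult.commute mult_1)
    then show ?case
      using diff_ideal_mult[OF P *, of y] r by simp
  qed
  from this[of n] show ?thesis
    by simp
qed

lemma diff_ideal_radical:
  assumes D: "derivations D" and P: "diff_ideal D P"
    and rat: "\<And>n::nat. n > 0 \<Longrightarrow> \<exists>y. of_nat n * y = (1::'r::comm_ring_1)"
  shows "diff_ideal D {x :: 'r. \<exists>n. x ^ n \<in> P}"
  unfolding diff_ideal_def
proof (intro conjI ballI allI)
  show "0 \<in> {x. \<exists>n. x ^ n \<in> P}"
    using diff_ideal_zero[OF P] by (auto intro: exI[of _ 1])
next
  fix x y assume "x \<in> {x. \<exists>n. x ^ n \<in> P}" "y \<in> {x. \<exists>n. x ^ n \<in> P}"
  then obtain a b where ab: "x ^ a \<in> P" "y ^ b \<in> P"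
    by auto
  have "of_nat (a + b choose k) * x ^ k * y ^ (a + b - k) \<in> P" if "k \<le> a + b" for k
  proof (cases "a \<le> k")
    case True
    then have e: "x ^ k = x ^ (k - a) * x ^ a"
      by (simp flip: power_add)
    have "of_nat (a + b choose k) * x ^ k * y ^ (a + b - k) =
        (of_nat (a + b choose k) * x ^ (k - a) * y ^ (a + b - k)) * x ^ a"
      unfolding e by (simp only: ac_simps)
    then show ?thesis
      using diff_ideal_mult[OF P ab(1)] by simp
  next
    case False
    then have e: "a + b - k = (a - k) + b"
      by simp
    have "of_nat (a + b choose k) * x ^ k * y ^ (a + b - k) =
        (of_nat (a + b choose k) * x ^ k * y ^ (a - k)) * y ^ b"
      unfolding e by (simp add: algebra_simps power_add)
    then show ?thesis
      using diff_ideal_mult[OF P ab(2)] by simp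
  qed
  then have "(x + y) ^ (a + b) \<in> P"
    unfolding binomial_ring by (intro diff_ideal_sum[OF P]) auto
  then show "x + y \<in> {x. \<exists>n. x ^ n \<in> P}"
    by blast
next
  fix x r assume "x \<in> {x. \<exists>n. x ^ n \<in> P}"
  then obtain n where "x ^ n \<in> P"
    by auto
  then have "(r * x) ^ n \<in> P"
    using diff_ideal_mult[OF P] by (simp add: power_mult_distrib)
  then show "r * x \<in> {x. \<exists>n. x ^ n \<in> P}"
    by blast
next
  fix i x assume "x \<in> {x. \<exists>n. x ^ n \<in> P}"
  then obtain n where "x ^ n \<in> P"
    by auto
  then have "D i x ^ (2 * n) \<in> P"
    using radical_der[OF D P rat] by blast
  then show "D i x \<in> {x. \<exists>n. x ^ n \<in> P}"
    by blast
qed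

text \<open>A maximal element \<open>P\<close> among the differential ideals that contain
  \<open>I\<close> and avoid all powers of \<open>g\<close> is radical, because radicals of
  differential ideals are differential in the presence of the rationals. For a radical
  \<open>P\<close> each quotient ideal \<open>(P : a)\<close> is again differential, so maximality
  can be applied to it, and primality follows as for ordinary ideals.\<close>

lemma prime_diff_ideal_avoiding:
  assumes D: "derivations D" and I: "diff_ideal D I"
    and rat: "\<And>n::nat. n > 0 \<Longrightarrow> \<exists>y. of_nat n * y = (1::'r::comm_ring_1)"
    and g: "\<And>n. g ^ n \<notin> (I :: 'r set)"
  obtains P where "diff_ideal D P" "I \<subseteq> P" "g \<notin> P" "1 \<notin> P" "\<And>a b. a * b \<in> P \<Longrightarrow> a \<in> P \<or> b \<in> P"
proof -
  define A where "A = {P. diff_ideal D P \<and> I \<subseteq> P \<and> (\<forall>n. g ^ n \<notin> P)}"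
  have "\<exists>M\<in>A. \<forall>U\<in>A. M \<subseteq> U \<longrightarrow> U = M"
  proof (rule subset_Zorn_nonempty)
    show "A \<noteq> {}"
      using I g by (auto simp: A_def)
    fix C assume "C \<noteq> {}" and C: "subset.chain A C"
    then have chain: "U \<subseteq> W \<or> W \<subseteq> U" if "U \<in> C" "W \<in> C" for U W
      using that by (auto simp: subset_chain_def)
    have CA: "U \<in> A" if "U \<in> C" for U
      using that C by (auto simp: subset_chain_def)
    have ideal: "diff_ideal D U" if "U \<in> C" for U
      using CA[OF that] by (simp add: A_def)
    have "diff_ideal D (\<Union>C)"
      unfolding diff_ideal_def
    proof (intro conjI ballI allI)
      obtain U where "U \<in> C"
        using \<open>C \<noteq> {}\<close> by blast
      then show "0 \<in> \<Union>C"
        using diff_ideal_zero[OF ideal] by blast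
      show "x + y \<in> \<Union>C" if xy: "x \<in> \<Union>C" "y \<in> \<Union>C" for x y
      proof -
        obtain U W where UW: "U \<in> C" "W \<in> C" "x \<in> U" "y \<in> W"
          using xy by blast
        then obtain Z where "Z \<in> C" "x \<in> Z" "y \<in> Z"
          using chain[of U W] by blast
        then show ?thesis
          using diff_ideal_add[OF ideal] by blast
      qed
      show "r * x \<in> \<Union>C" if "x \<in> \<Union>C" for x r
        using that diff_ideal_mult[OF ideal] by blast
      show "D i x \<in> \<Union>C" if "x \<in> \<Union>C" for x i
        using that diff_ideal_der[OF ideal] by blast
    qed
    moreover have "I \<subseteq> U" "g ^ n \<notin> U" if "U \<in> C" for U n
      using CA[OF that] by (simp_all add: A_def)
    ultimately show "\<Union>C \<in> A"
      using \<open>C \<noteq> {}\<close> unfolding A_def by blast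
  qed
  then obtain P where PA: "P \<in> A" and max: "\<And>U. U \<in> A \<Longrightarrow> P \<subseteq> U \<Longrightarrow> U = P"
    by blast
  then have P: "diff_ideal D P" "I \<subseteq> P" "\<And>n. g ^ n \<notin> P"
    by (simp_all add: A_def)
  have rad: "x \<in> P" if "x ^ n \<in> P" for x n
  proof -
    let ?R = "{x. \<exists>n. x ^ n \<in> P}"
    have "P \<subseteq> ?R"
      by (auto intro: exI[of _ 1])
    moreover have "g ^ k \<notin> ?R" for k
      using P(3) by (auto simp flip: power_mult)
    ultimately have "?R = P"
      using P diff_ideal_radical[OF D P(1) rat] by (intro max) (auto simp: A_def)
    then show ?thesis
      using that by blast
  qed
  have colon: "diff_ideal D {x. a * x \<in> P}" for a
    unfolding diff_ideal_def
  proof (intro conjI ballI allI)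
    show "0 \<in> {x. a * x \<in> P}"
      by (simp add: diff_ideal_zero[OF P(1)])
    show "x + y \<in> {x. a * x \<in> P}" if "x \<in> {x. a * x \<in> P}" "y \<in> {x. a * x \<in> P}" for x y
      using that by (simp add: distrib_left diff_ideal_add[OF P(1)])
    show "r * x \<in> {x. a * x \<in> P}" if "x \<in> {x. a * x \<in> P}" for x r
      using that diff_ideal_mult[OF P(1), of "a * x" r] by (simp add: algebra_simps)
    show "D i x \<in> {x. a * x \<in> P}" if "x \<in> {x. a * x \<in> P}" for x i
    proof -
      have ax: "a * x \<in> P"
        using that by simp
      \<comment> \<open>Only the square of \<open>a * D i x\<close> is visibly in \<open>P\<close>:
        differentiate \<open>a * x\<close> and multiply by \<open>a * D i x\<close>. Radicality
        removes the square.\<close>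
      have "(a * D i x) ^ 2 = D i (a * x) * (a * D i x) - (a * x) * (D i a * D i x)"
        by (simp add: derivations_mult[OF D] algebra_simps power2_eq_square)
      also have "\<dots> \<in> P"
        by (intro diff_ideal_diff[OF P(1)] diff_ideal_mult_right[OF P(1)] diff_ideal_der[OF P(1)] ax)
      finally show ?thesis
        using rad[of "a * D i x" 2] by simp
    qed
  qed
  \<comment> \<open>The quotient ideal \<open>(P : a)\<close> contains \<open>b\<close> and hence
    exceeds \<open>P\<close>, so by maximality it meets the powers of \<open>g\<close>.\<close>
  have step: "\<exists>n. a * g ^ n \<in> P" if "a * b \<in> P" "b \<notin> P" for a b
  proof (rule ccontr)
    assume "\<not> (\<exists>n. a * g ^ n \<in> P)"
    then have "{x. a * x \<in> P} = P"
      using P colon[of a] diff_ideal_mult[OF P(1)] by (intro max) (auto simp: A_def)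
    then show False
      using that by blast
  qed
  have prime: "a \<in> P \<or> b \<in> P" if ab: "a * b \<in> P" for a b
  proof (rule ccontr)
    assume *: "\<not> (a \<in> P \<or> b \<in> P)"
    \<comment> \<open>First \<open>b\<close> is traded for a power of \<open>g\<close>, then
      \<open>a\<close>; a power of \<open>g\<close> would end up in \<open>P\<close>.\<close>
    then obtain n where "g ^ n * a \<in> P"
      using step[OF ab] by (auto simp: mult.commute)
    then obtain k where "g ^ n * g ^ k \<in> P"
      using step[of "g ^ n" a] * by auto
    then show False
      using P(3)[of "n + k"] by (simp add: power_add)
  qed
  show thesis
    using that[OF P(1,2)] P(3)[of 1] P(3)[of 0] prime by simp
qed

text \<open>The fraction field of the quotient by \<open>P\<close> is coded on the type \<open>'a\<close> through \<open>\<iota>\<close>, because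
  \<^const>\<open>existentially_closed\<close> only speaks of extensions with such carriers.\<close>

lemma prime_diff_ideal_residue_field:
  fixes P :: "'r::comm_ring_1 set" and D :: "'m \<Rightarrow> 'r \<Rightarrow> 'r" and \<iota> :: "'r \<times> 'r \<Rightarrow> 'a"
  assumes D: "derivations D" and P: "diff_ideal D P" and one: "1 \<notin> P"
    and prime: "\<And>a b. a * b \<in> P \<Longrightarrow> a \<in> P \<or> b \<in> P" and \<iota>: "inj \<iota>"
  obtains L :: "'a ring" and D' j where "differential_field L D'" "j \<in> ring_hom ring_of_type_algebra L"
    "\<And>i x. j (D i x) = D' i (j x)" "\<And>x. j x = \<zero>\<^bsub>L\<^esub> \<longleftrightarrow> x \<in> P"
proof -
  define S where "S = {x :: 'r \<times> 'r. snd x \<notin> P}"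
  define rel where "rel = (\<lambda>x y :: 'r \<times> 'r. fst x * snd y - fst y * snd x \<in> P)"
  have rel_refl: "rel x x" for x
    by (simp add: rel_def diff_ideal_zero[OF P])
  have rel_sym: "rel y x" if "rel x y" for x y
    using diff_ideal_minus[OF P that[unfolded rel_def]] by (simp add: rel_def)
  have rel_trans: "rel x z" if "rel x y" "rel y z" "y \<in> S" for x y z
  proof -
    have "(fst x * snd z - fst z * snd x) * snd y =
        (fst x * snd y - fst y * snd x) * snd z + (fst y * snd z - fst z * snd y) * snd x"
      by (simp add: algebra_simps)
    also have "\<dots> \<in> P"
      using that by (intro diff_ideal_add[OF P] diff_ideal_mult_right[OF P]) (auto simp: rel_def)
    finally show ?thesis
      using prime that(3) by (auto simp: rel_def S_def)
  qed
  \<comment> \<open>A fraction is named by the code of a chosen representative of its class. The map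
    \<open>r\<close> below reads a representative back from a code, so every operation on codes must
    be shown independent of this choice.\<close>
  define c where "c = (\<lambda>x. \<iota> (SOME y. y \<in> S \<and> rel x y))"
  have rep: "(SOME y. y \<in> S \<and> rel x y) \<in> S \<and> rel x (SOME y. y \<in> S \<and> rel x y)" if "x \<in> S" for x
    by (rule someI[of _ x]) (simp add: that rel_refl)
  have c_eq: "c x = c y \<longleftrightarrow> rel x y" if "x \<in> S" "y \<in> S" for x y
  proof
    assume "c x = c y"
    then have "(SOME z. z \<in> S \<and> rel x z) = (SOME z. z \<in> S \<and> rel y z)"
      using \<iota> by (simp add: c_def inj_eq)
    then show "rel x y"
      using rep[OF that(1)] rep[OF that(2)] rel_trans[of x _ y] rel_sym[of y] by simp
  next
    assume xy: "rel x y"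
    have "(z \<in> S \<and> rel x z) = (z \<in> S \<and> rel y z)" for z
      using rel_trans[OF rel_sym[OF xy], of z] rel_trans[OF xy, of z] that by blast
    then show "c x = c y"
      by (simp add: c_def)
  qed
  define r where "r = (\<lambda>z. SOME x. x \<in> S \<and> c x = z)"
  have r: "r (c x) \<in> S \<and> rel (r (c x)) x" if "x \<in> S" for x
  proof -
    have "r (c x) \<in> S \<and> c (r (c x)) = c x"
      unfolding r_def by (rule someI[of _ x]) (simp add: that)
    then show ?thesis
      using c_eq that by blast
  qed
  have SI: "(f, h * k) \<in> S" if "h \<notin> P" "k \<notin> P" for f h k
    using that prime by (auto simp: S_def)
  define pm where "pm = (\<lambda>x y :: 'r \<times> 'r. (fst x * fst y, snd x * snd y))"
  define pa where "pa = (\<lambda>x y :: 'r \<times> 'r. (fst x * snd y + fst y * snd x, snd x * snd y))"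
  define pd where "pd = (\<lambda>i (x :: 'r \<times> 'r). (D i (fst x) * snd x - fst x * D i (snd x), snd x * snd x))"
  have pmS: "pm x y \<in> S" and paS: "pa x y \<in> S" and pdS: "pd i x \<in> S" if "x \<in> S" "y \<in> S" for x y i
    using that SI by (auto simp: pm_def pa_def pd_def S_def)
  define L :: "'a ring" where "L = \<lparr>carrier = c ` S, monoid.mult = (\<lambda>z w. c (pm (r z) (r w))), one = c (1, 1),
      zero = c (0, 1), add = (\<lambda>z w. c (pa (r z) (r w)))\<rparr>"
  define D' where "D' = (\<lambda>i z. c (pd i (r z)))"
  have relI: "rel x y" if "fst x * snd y - fst y * snd x = a * e + b * e'" "e \<in> P" "e' \<in> P" for x y a b e e'
    unfolding rel_def that(1) using that(2,3) by (intro diff_ideal_add[OF P] diff_ideal_mult[OF P])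
  have mult: "c x \<otimes>\<^bsub>L\<^esub> c y = c (pm x y)" if "x \<in> S" "y \<in> S" for x y
  proof -
    let ?x = "r (c x)" and ?y = "r (c y)"
    have "rel (pm ?x ?y) (pm x y)"
      by (rule relI[of _ _ "fst ?y * snd y" "fst ?x * snd x - fst x * snd ?x"
            "fst x * snd ?x" "fst ?y * snd y - fst y * snd ?y"])
        (use r[OF that(1)] r[OF that(2)] in \<open>auto simp: pm_def rel_def algebra_simps\<close>)
    then show ?thesis
      using c_eq[of "pm ?x ?y" "pm x y"] that r pmS by (simp add: L_def)
  qed
  have add: "c x \<oplus>\<^bsub>L\<^esub> c y = c (pa x y)" if "x \<in> S" "y \<in> S" for x y
  proof -
    let ?x = "r (c x)" and ?y = "r (c y)"
    have "rel (pa ?x ?y) (pa x y)"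
      by (rule relI[of _ _ "snd ?y * snd y" "fst ?x * snd x - fst x * snd ?x"
            "snd x * snd ?x" "fst ?y * snd y - fst y * snd ?y"])
        (use r[OF that(1)] r[OF that(2)] in \<open>auto simp: pa_def rel_def algebra_simps\<close>)
    then show ?thesis
      using c_eq[of "pa ?x ?y" "pa x y"] that r paS by (simp add: L_def)
  qed
  have der: "D' i (c x) = c (pd i x)" if "x \<in> S" for x i
  proof -
    let ?x = "r (c x)"
    let ?e = "fst ?x * snd x - fst x * snd ?x"
    have e: "?e \<in> P"
      using r[OF that] by (simp add: rel_def)
    have "rel (pd i ?x) (pd i x)"
      by (rule relI[of _ _ "snd ?x * snd x" "D i ?e" "- (snd x * D i (snd ?x) + snd ?x * D i (snd x))" ?e])
        (simp_all only: e diff_ideal_der[OF P e],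
         simp add: pd_def derivations_mult[OF D] additive_diff[of "D i", OF derivations_add[OF D]] algebra_simps)
    then show ?thesis
      using c_eq[of "pd i ?x" "pd i x"] that r pdS by (simp add: D'_def)
  qed
  have carr: "carrier L = c ` S" and Lone: "\<one>\<^bsub>L\<^esub> = c (1, 1)" and Lzero: "\<zero>\<^bsub>L\<^esub> = c (0, 1)"
    by (simp_all add: L_def)
  have S1: "(f, 1) \<in> S" for f
    using one by (simp add: S_def)
  have ceqI: "c x = c y" if "x \<in> S" "y \<in> S" "fst x * snd y = fst y * snd x" for x y
    using c_eq[OF that(1,2)] that(3) by (simp add: rel_def diff_ideal_zero[OF P])
  have zero_iff: "c x = \<zero>\<^bsub>L\<^esub> \<longleftrightarrow> fst x \<in> P" if "x \<in> S" for x
    using c_eq[OF that S1[of 0]] by (simp add: Lzero rel_def)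
  have elem: "\<exists>x\<in>S. z = c x" if "z \<in> carrier L" for z
    using that carr by auto
  have paS': "pa x y \<in> S" and pmS': "pm x y \<in> S" if "x \<in> S" "y \<in> S" for x y
    using that paS pmS by blast+
  have carrI: "c x \<in> carrier L" if "x \<in> S" for x
    using that carr by auto
  have group: "abelian_group L"
  proof (rule abelian_groupI)
    show "\<zero>\<^bsub>L\<^esub> \<in> carrier L"
      using Lzero carr S1 by auto
    show "x \<oplus>\<^bsub>L\<^esub> y \<in> carrier L" if "x \<in> carrier L" "y \<in> carrier L" for x y
      using elem[OF that(1)] elem[OF that(2)] by (auto simp: add intro!: carrI paS')
    show "x \<oplus>\<^bsub>L\<^esub> y \<oplus>\<^bsub>L\<^esub> z = x \<oplus>\<^bsub>L\<^esub> (y \<oplus>\<^bsub>L\<^esub> z)"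
      if "x \<in> carrier L" "y \<in> carrier L" "z \<in> carrier L" for x y z
      using elem[OF that(1)] elem[OF that(2)] elem[OF that(3)]
      by (auto simp: add paS' intro!: ceqI) (auto simp: pa_def algebra_simps)
    show "x \<oplus>\<^bsub>L\<^esub> y = y \<oplus>\<^bsub>L\<^esub> x" if "x \<in> carrier L" "y \<in> carrier L" for x y
      using elem[OF that(1)] elem[OF that(2)]
      by (auto simp: add paS' intro!: ceqI) (auto simp: pa_def algebra_simps)
    show "\<zero>\<^bsub>L\<^esub> \<oplus>\<^bsub>L\<^esub> x = x" if "x \<in> carrier L" for x
      using elem[OF that] S1
      by (auto simp: add paS' Lzero intro!: ceqI) (auto simp: pa_def algebra_simps)
    show "\<exists>y\<in>carrier L. y \<oplus>\<^bsub>L\<^esub> x = \<zero>\<^bsub>L\<^esub>" if xL: "x \<in> carrier L" for x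
    proof -
      obtain a where a: "a \<in> S" "x = c a"
        using elem[OF xL] by blast
      let ?b = "(- fst a, snd a)"
      have b: "?b \<in> S"
        using a by (simp add: S_def)
      have "c ?b \<oplus>\<^bsub>L\<^esub> x = \<zero>\<^bsub>L\<^esub>"
        using a b by (simp add: add zero_iff paS') (simp add: pa_def diff_ideal_zero[OF P])
      then show ?thesis
        using carrI[OF b] by blast
    qed
  qed
  have monoid: "comm_monoid L"
  proof (rule comm_monoidI)
    show "\<one>\<^bsub>L\<^esub> \<in> carrier L"
      using Lone carr S1 by auto
    show "x \<otimes>\<^bsub>L\<^esub> y \<in> carrier L" if "x \<in> carrier L" "y \<in> carrier L" for x y
      using elem[OF that(1)] elem[OF that(2)] by (auto simp: mult intro!: carrI pmS')
    show "x \<otimes>\<^bsub>L\<^esub> y \<otimes>\<^bsub>L\<^esub> z = x \<otimes>\<^bsub>L\<^esub> (y \<otimes>\<^bsub>L\<^esub> z)"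
      if "x \<in> carrier L" "y \<in> carrier L" "z \<in> carrier L" for x y z
      using elem[OF that(1)] elem[OF that(2)] elem[OF that(3)]
      by (auto simp: mult pmS' intro!: ceqI) (auto simp: pm_def algebra_simps)
    show "x \<otimes>\<^bsub>L\<^esub> y = y \<otimes>\<^bsub>L\<^esub> x" if "x \<in> carrier L" "y \<in> carrier L" for x y
      using elem[OF that(1)] elem[OF that(2)]
      by (auto simp: mult pmS' intro!: ceqI) (auto simp: pm_def algebra_simps)
    show "\<one>\<^bsub>L\<^esub> \<otimes>\<^bsub>L\<^esub> x = x" if "x \<in> carrier L" for x
      using elem[OF that] S1
      by (auto simp: mult pmS' Lone intro!: ceqI) (auto simp: pm_def algebra_simps)
  qed
  have cring: "cring L"
  proof (rule cringI[OF group monoid])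
    show "(x \<oplus>\<^bsub>L\<^esub> y) \<otimes>\<^bsub>L\<^esub> z = x \<otimes>\<^bsub>L\<^esub> z \<oplus>\<^bsub>L\<^esub> y \<otimes>\<^bsub>L\<^esub> z"
      if "x \<in> carrier L" "y \<in> carrier L" "z \<in> carrier L" for x y z
      using elem[OF that(1)] elem[OF that(2)] elem[OF that(3)]
      by (auto simp: add mult paS' pmS' intro!: ceqI) (auto simp: pa_def pm_def algebra_simps)
  qed
  have field: "field L"
  proof (rule cring.cring_fieldI[OF cring], intro equalityI subsetI)
    fix x assume x: "x \<in> Units L"
    have "\<zero>\<^bsub>L\<^esub> \<noteq> \<one>\<^bsub>L\<^esub>"
      using zero_iff[OF S1[of 1]] one Lone by auto
    then have "\<zero>\<^bsub>L\<^esub> \<notin> Units L"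
      using cring by (auto simp: Units_def cring.cring_simprules ring.ring_simprules)
    then show "x \<in> carrier L - {\<zero>\<^bsub>L\<^esub>}"
      using x by (auto simp: Units_def)
  next
    fix x assume x: "x \<in> carrier L - {\<zero>\<^bsub>L\<^esub>}"
    then obtain a where a: "a \<in> S" "x = c a"
      using elem by blast
    then have aP: "fst a \<notin> P"
      using x zero_iff by blast
    let ?b = "(snd a, fst a)"
    have b: "?b \<in> S"
      using aP by (simp add: S_def)
    have ab: "c ?b \<otimes>\<^bsub>L\<^esub> x = \<one>\<^bsub>L\<^esub>"
      unfolding a(2) mult[OF b a(1)] Lone
      by (rule ceqI) (simp_all add: pmS'[OF b a(1)] S1, simp add: pm_def mult.commute)
    moreover have "x \<otimes>\<^bsub>L\<^esub> c ?b = \<one>\<^bsub>L\<^esub>"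
      using ab comm_monoid.m_comm[OF monoid carrI[OF b] carrI[OF a(1)]] a by simp
    ultimately show "x \<in> Units L"
      using x carrI[OF b] by (auto simp: Units_def)
  qed
  have pdS': "pd i x \<in> S" if "x \<in> S" for i x
    using pdS[OF that that] .
  define j where "j = (\<lambda>x. c (x, 1))"
  show thesis
  proof (rule that[of L D' j])
    show "differential_field L D'"
      unfolding differential_field_def
    proof (intro conjI allI ballI field)
      show "D' i x \<in> carrier L" if "x \<in> carrier L" for i x
        using elem[OF that] by (auto simp: der intro!: carrI pdS')
      show "D' i (x \<oplus>\<^bsub>L\<^esub> y) = D' i x \<oplus>\<^bsub>L\<^esub> D' i y" if "x \<in> carrier L" "y \<in> carrier L" for i x y
        using elem[OF that(1)] elem[OF that(2)]
        by (auto simp: add der paS' pdS' intro!: ceqI)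
          (auto simp: pa_def pd_def derivations_add[OF D] derivations_mult[OF D] algebra_simps)
      show "D' i (x \<otimes>\<^bsub>L\<^esub> y) = D' i x \<otimes>\<^bsub>L\<^esub> y \<oplus>\<^bsub>L\<^esub> x \<otimes>\<^bsub>L\<^esub> D' i y" if "x \<in> carrier L" "y \<in> carrier L" for i x y
        using elem[OF that(1)] elem[OF that(2)]
        by (auto simp: add mult der paS' pmS' pdS' intro!: ceqI)
          (auto simp: pa_def pm_def pd_def derivations_add[OF D] derivations_mult[OF D] algebra_simps)
      show "D' i (D' k x) = D' k (D' i x)" if "x \<in> carrier L" for i k x
        using elem[OF that]
        by (auto simp: der pdS' intro!: ceqI)
          (auto simp: pd_def derivations_mult[OF D] additive_diff[of "D _", OF derivations_add[OF D]]
            derivations_commute[OF D, of i k] algebra_simps)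
    qed
    show "j \<in> ring_hom ring_of_type_algebra L"
    proof (rule ring_hom_memI)
      show "j x \<in> carrier L" for x
        by (simp add: j_def carrI S1)
      show "j (x \<otimes>\<^bsub>ring_of_type_algebra\<^esub> y) = j x \<otimes>\<^bsub>L\<^esub> j y" for x y
        by (auto simp: j_def mult S1 ring_of_type_algebra_def pmS' intro!: ceqI) (auto simp: pm_def)
      show "j (x \<oplus>\<^bsub>ring_of_type_algebra\<^esub> y) = j x \<oplus>\<^bsub>L\<^esub> j y" for x y
        by (auto simp: j_def add S1 ring_of_type_algebra_def paS' intro!: ceqI) (auto simp: pa_def)
      show "j \<one>\<^bsub>ring_of_type_algebra\<^esub> = \<one>\<^bsub>L\<^esub>"
        by (simp add: j_def ring_of_type_algebra_def Lone)
    qed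
    show "j (D i x) = D' i (j x)" for i x
      by (auto simp: j_def der S1 pdS' intro!: ceqI) (auto simp: pd_def derivations_one[OF D])
    show "j x = \<zero>\<^bsub>L\<^esub> \<longleftrightarrow> x \<in> P" for x
      by (simp add: j_def zero_iff S1)
  qed
qed

section \<open>The size of the ring of differential polynomials\<close>

lemma inj_pair_field:
  obtains f :: "'a::field_char_0 \<times> 'a \<Rightarrow> 'a" where "inj f"
proof -
  have "infinite (UNIV :: 'a set)"
    by (rule infinite_UNIV_char_0)
  then have "(card_of ((UNIV :: 'a set) \<times> (UNIV :: 'a set)), card_of (UNIV :: 'a set)) \<in> ordIso"
    by (rule card_of_Times_same_infinite)
  then obtain f :: "'a \<times> 'a \<Rightarrow> 'a" where "bij_betw f (UNIV \<times> UNIV) UNIV"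
    unfolding card_of_ordIso[symmetric] by blast
  then have "inj f"
    by (simp add: bij_betw_def)
  then show thesis
    by (rule that)
qed

text \<open>Iterated pairing \<open>enc\<close> is used injectively only between lists of equal
  length, since it starts from an arbitrary value at the empty list. The length is stored as a
  natural number of the field, where characteristic 0 keeps it recoverable.\<close>

lemma inj_list_field:
  obtains g :: "'a::field_char_0 list \<Rightarrow> 'a" where "inj g"
proof -
  obtain f :: "'a \<times> 'a \<Rightarrow> 'a" where f: "inj f"
    by (rule inj_pair_field)
  define enc where "enc = (\<lambda>xs. foldr (\<lambda>x y. f (x, y)) xs 0)"
  have enc: "xs = ys" if "length xs = length ys" "enc xs = enc ys" for xs ys
    using that by (induction xs ys rule: list_induct2) (auto simp: enc_def inj_eq[OF f])
  have "inj (\<lambda>xs. f (of_nat (length xs), enc xs))"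
    by (rule injI) (auto simp: inj_eq[OF f] intro: enc)
  then show thesis
    by (rule that)
qed

lemma poly_mapping_eq_graph:
  assumes "(\<lambda>M. (M, lookup p M)) ` keys p = (\<lambda>M. (M, lookup q M)) ` keys q"
  shows "p = q"
proof -
  have k: "keys p = keys q"
    using arg_cong[OF assms, of "image fst"] by (simp add: image_image)
  show ?thesis
  proof (rule poly_mapping_eqI)
    fix M
    show "lookup p M = lookup q M"
    proof (cases "M \<in> keys p")
      case True
      then have "(M, lookup p M) \<in> (\<lambda>M. (M, lookup q M)) ` keys q"
        unfolding assms[symmetric] by blast
      then show ?thesis
        by auto
    next
      case False
      then show ?thesis
        using k by (metis not_in_keys_iff_lookup_eq_zero)
    qed
  qed
qed

text \<open>A finitely supported map is determined by its finite graph; a listing of that graph is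
  its code.\<close>

lemma inj_poly_mapping_list:
  obtains g :: "('k \<Rightarrow>\<^sub>0 'b::zero) \<Rightarrow> ('k \<times> 'b) list" where "inj g"
proof -
  define G where "G = (\<lambda>p :: 'k \<Rightarrow>\<^sub>0 'b. (\<lambda>M. (M, lookup p M)) ` keys p)"
  have "\<exists>xs. set xs = G p" for p
    by (rule finite_list) (simp add: G_def)
  then obtain g where g: "\<And>p. set (g p) = G p"
    by metis
  have "inj g"
    by (rule injI) (metis g G_def poly_mapping_eq_graph)
  then show thesis
    by (rule that)
qed

text \<open>Provides the code that places residue fields on the type \<open>'a\<close>. As
  \<open>'m\<close> is finite, there are countably many monomials, so a differential polynomial
  amounts to a finite list of field elements.\<close>

lemma inj_dpoly_pair:
  obtains \<iota> :: "(nat, 'm::finite, 'a::field_char_0) dpoly \<times> (nat, 'm, 'a) dpoly \<Rightarrow> 'a" where "inj \<iota>"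
proof -
  obtain f :: "'a \<times> 'a \<Rightarrow> 'a" where f: "inj f"
    by (rule inj_pair_field)
  obtain l :: "'a list \<Rightarrow> 'a" where l: "inj l"
    by (rule inj_list_field)
  obtain g :: "((nat \<times> ('m \<Rightarrow> nat)) \<Rightarrow>\<^sub>0 nat) \<Rightarrow> ((nat \<times> ('m \<Rightarrow> nat)) \<times> nat) list" where g: "inj g"
    by (rule inj_poly_mapping_list)
  obtain h :: "(nat, 'm, 'a) dpoly \<Rightarrow> (((nat \<times> ('m \<Rightarrow> nat)) \<Rightarrow>\<^sub>0 nat) \<times> 'a) list" where h: "inj h"
    by (rule inj_poly_mapping_list)
  have 1: "inj (\<lambda>(M, c). f (of_nat (to_nat (g M)), c))"
    by (rule injI) (auto simp: inj_eq[OF f] inj_eq[OF g])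
  define e where "e = (\<lambda>p. l (map (\<lambda>(M, c). f (of_nat (to_nat (g M)), c)) (h p)))"
  have e: "inj e"
    unfolding e_def by (rule injI) (simp add: inj_eq[OF l] inj_map_eq_map[OF 1] inj_eq[OF h])
  have "inj (\<lambda>(p, q). f (e p, e q))"
    by (rule injI) (auto simp: inj_eq[OF f] inj_eq[OF e])
  then show thesis
    by (rule that)
qed


section \<open>Linear functionals over a subfield\<close>

definition ksubfield :: "'a::field_char_0 set \<Rightarrow> bool" where
  "ksubfield K \<longleftrightarrow> 0 \<in> K \<and> 1 \<in> K \<and> (\<forall>x\<in>K. \<forall>y\<in>K. x + y \<in> K) \<and> (\<forall>x\<in>K. \<forall>y\<in>K. x * y \<in> K) \<and>
     (\<forall>x\<in>K. - x \<in> K) \<and> (\<forall>x\<in>K. inverse x \<in> K)"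

text \<open>Values may lie anywhere in the universal domain. This larger class, unlike the
  functionals with values in \<open>K\<close>, is stable under \<open>ad a\<close> and under
  commutators with derivations; where values in \<open>K\<close> matter,
  \<open>range \<mu> \<subseteq> K\<close> is added.\<close>

definition klinear :: "'a::field_char_0 set \<Rightarrow> ('a \<Rightarrow> 'a) \<Rightarrow> bool" where
  "klinear K \<mu> \<longleftrightarrow> (\<forall>x y. \<mu> (x + y) = \<mu> x + \<mu> y) \<and> (\<forall>k\<in>K. \<forall>x. \<mu> (k * x) = k * \<mu> x)"

definition ksubspace :: "'a::field_char_0 set \<Rightarrow> 'a set \<Rightarrow> bool" where
  "ksubspace K W \<longleftrightarrow> 0 \<in> W \<and> (\<forall>x\<in>W. \<forall>y\<in>W. x + y \<in> W) \<and> (\<forall>k\<in>K. \<forall>x\<in>W. k * x \<in> W)"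

lemma ksubfield_zero: "ksubfield K \<Longrightarrow> 0 \<in> K"
  and ksubfield_one: "ksubfield K \<Longrightarrow> 1 \<in> K"
  and ksubfield_add: "ksubfield K \<Longrightarrow> x \<in> K \<Longrightarrow> y \<in> K \<Longrightarrow> x + y \<in> K"
  and ksubfield_mult: "ksubfield K \<Longrightarrow> x \<in> K \<Longrightarrow> y \<in> K \<Longrightarrow> x * y \<in> K"
  and ksubfield_minus: "ksubfield K \<Longrightarrow> x \<in> K \<Longrightarrow> - x \<in> K"
  and ksubfield_inverse: "ksubfield K \<Longrightarrow> x \<in> K \<Longrightarrow> inverse x \<in> K"
  by (simp_all add: ksubfield_def)

lemma ksubfield_diff: "ksubfield K \<Longrightarrow> x \<in> K \<Longrightarrow> y \<in> K \<Longrightarrow> x - y \<in> K"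
  using ksubfield_add[of K x "- y"] ksubfield_minus[of K y] by simp

lemma ksubfield_of_nat: "ksubfield K \<Longrightarrow> of_nat n \<in> K"
  by (induction n) (simp_all add: ksubfield_zero ksubfield_one ksubfield_add)

lemma klinear_add: "klinear K \<mu> \<Longrightarrow> \<mu> (x + y) = \<mu> x + \<mu> y"
  and klinear_scale: "klinear K \<mu> \<Longrightarrow> k \<in> K \<Longrightarrow> \<mu> (k * x) = k * \<mu> x"
  by (simp_all add: klinear_def)

lemma klinear_zero: "klinear K \<mu> \<Longrightarrow> \<mu> 0 = 0"
  by (rule additive_zero) (rule klinear_add)

lemma klinear_sum: "klinear K \<mu> \<Longrightarrow> \<mu> (sum f A) = (\<Sum>a\<in>A. \<mu> (f a))"
  by (rule additive_sum) (rule klinear_add)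

lemma klinear_diff: "klinear K \<mu> \<Longrightarrow> \<mu> (x - y) = \<mu> x - \<mu> y"
  by (rule additive_diff) (rule klinear_add)

lemma ksubspace_zero: "ksubspace K W \<Longrightarrow> 0 \<in> W"
  and ksubspace_add: "ksubspace K W \<Longrightarrow> x \<in> W \<Longrightarrow> y \<in> W \<Longrightarrow> x + y \<in> W"
  and ksubspace_scale: "ksubspace K W \<Longrightarrow> k \<in> K \<Longrightarrow> x \<in> W \<Longrightarrow> k * x \<in> W"
  by (simp_all add: ksubspace_def)

lemma ksubspace_diff: "ksubfield K \<Longrightarrow> ksubspace K W \<Longrightarrow> x \<in> W \<Longrightarrow> y \<in> W \<Longrightarrow> x - y \<in> W"
  using ksubspace_add[of K W x "- y"] ksubspace_scale[of K W "-1" y]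
    ksubfield_minus[of K 1] ksubfield_one[of K] by simp

text \<open>A subspace \<open>W\<close> maximal among those that contain \<open>W0\<close> and avoid
  \<open>x\<close> is a complement of the line \<open>K x\<close>; \<open>\<mu>\<close> is the
  coordinate along \<open>x\<close>.\<close>

lemma functional_exists:
  assumes K: "ksubfield K" and W0: "ksubspace K W0" and x: "x \<notin> W0"
  obtains \<mu> where "klinear K \<mu>" "range \<mu> \<subseteq> K" "\<And>w. w \<in> W0 \<Longrightarrow> \<mu> w = 0" "\<mu> x = 1"
proof -
  define A where "A = {W. ksubspace K W \<and> W0 \<subseteq> W \<and> x \<notin> W}"
  have "\<exists>M\<in>A. \<forall>U\<in>A. M \<subseteq> U \<longrightarrow> U = M"
  proof (rule subset_Zorn_nonempty)
    show "A \<noteq> {}"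
      using W0 x by (auto simp: A_def)
    fix C assume "C \<noteq> {}" and C: "subset.chain A C"
    then have chain: "U \<subseteq> W \<or> W \<subseteq> U" if "U \<in> C" "W \<in> C" for U W
      using that by (auto simp: subset_chain_def)
    have CA: "U \<in> A" if "U \<in> C" for U
      using that C by (auto simp: subset_chain_def)
    have sub: "ksubspace K U" if "U \<in> C" for U
      using CA[OF that] by (simp add: A_def)
    have "ksubspace K (\<Union>C)"
      unfolding ksubspace_def
    proof (intro conjI ballI)
      obtain U where "U \<in> C"
        using \<open>C \<noteq> {}\<close> by blast
      then show "0 \<in> \<Union>C"
        using ksubspace_zero[OF sub] by blast
      show "y + z \<in> \<Union>C" if yz: "y \<in> \<Union>C" "z \<in> \<Union>C" for y z
      proof -
        obtain U W where UW: "U \<in> C" "W \<in> C" "y \<in> U" "z \<in> W"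
          using yz by blast
        then obtain Z where "Z \<in> C" "y \<in> Z" "z \<in> Z"
          using chain[of U W] by blast
        then show ?thesis
          using ksubspace_add[OF sub] by blast
      qed
      show "k * y \<in> \<Union>C" if "k \<in> K" "y \<in> \<Union>C" for k y
        using that ksubspace_scale[OF sub] by blast
    qed
    moreover have "W0 \<subseteq> U" "x \<notin> U" if "U \<in> C" for U
      using CA[OF that] by (simp_all add: A_def)
    ultimately show "\<Union>C \<in> A"
      using \<open>C \<noteq> {}\<close> unfolding A_def by blast
  qed
  then obtain W where "W \<in> A" and max: "\<And>U. U \<in> A \<Longrightarrow> W \<subseteq> U \<Longrightarrow> U = W"
    by blast
  then have W: "ksubspace K W" "W0 \<subseteq> W" "x \<notin> W"
    by (simp_all add: A_def)
  have ex: "\<exists>k\<in>K. y - k * x \<in> W" for y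
  proof (cases "y \<in> W")
    case True
    then show ?thesis
      using ksubfield_zero[OF K] by (auto intro!: bexI[of _ 0])
  next
    case False
    define U where "U = {w + k * y |w k. w \<in> W \<and> k \<in> K}"
    have U: "ksubspace K U"
      unfolding ksubspace_def
    proof (intro conjI ballI)
      have "0 + 0 * y \<in> U"
        unfolding U_def using ksubspace_zero[OF W(1)] ksubfield_zero[OF K] by blast
      then show "0 \<in> U"
        by simp
      show "u + v \<in> U" if uv: "u \<in> U" "v \<in> U" for u v
      proof -
        obtain w1 k1 w2 k2 where "u = w1 + k1 * y" "v = w2 + k2 * y" "w1 \<in> W" "w2 \<in> W" "k1 \<in> K" "k2 \<in> K"
          using uv unfolding U_def by blast
        moreover from this have "u + v = (w1 + w2) + (k1 + k2) * y"
          by (simp add: algebra_simps)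
        ultimately show ?thesis
          unfolding U_def using ksubspace_add[OF W(1)] ksubfield_add[OF K] by blast
      qed
      show "k * u \<in> U" if uk: "k \<in> K" "u \<in> U" for u k
      proof -
        obtain w1 k1 where "u = w1 + k1 * y" "w1 \<in> W" "k1 \<in> K"
          using uk unfolding U_def by blast
        moreover from this have "k * u = k * w1 + (k * k1) * y"
          by (simp add: algebra_simps)
        ultimately show ?thesis
          unfolding U_def using ksubspace_scale[OF W(1)] ksubfield_mult[OF K] uk by blast
      qed
    qed
    have WU: "W \<subseteq> U"
    proof
      fix w assume "w \<in> W"
      then have "w + 0 * y \<in> U"
        unfolding U_def using ksubfield_zero[OF K] by blast
      then show "w \<in> U"
        by simp
    qed
    have "0 + 1 * y \<in> U"
      unfolding U_def using ksubspace_zero[OF W(1)] ksubfield_one[OF K] by blast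
    then have "U \<noteq> W"
      using False by auto
    \<comment> \<open>Maximality of \<open>W\<close> forces \<open>x\<close> into the larger space.
      Its coefficient at \<open>y\<close> is nonzero because \<open>x \<notin> W\<close>, so the
      relation can be solved for \<open>y\<close> modulo \<open>W\<close>.\<close>
    then have "x \<in> U"
      using max[of U] U WU W(2) by (auto simp: A_def)
    then obtain w k where wk: "x = w + k * y" "w \<in> W" "k \<in> K"
      unfolding U_def by blast
    then have "k \<noteq> 0"
      using W(3) by auto
    then have "y - inverse k * x = (- inverse k) * w"
      using wk by (simp add: field_simps)
    also have "\<dots> \<in> W"
      using wk by (intro ksubspace_scale[OF W(1)] ksubfield_minus[OF K] ksubfield_inverse[OF K])
    finally show ?thesis
      using ksubfield_inverse[OF K wk(3)] by blast
  qed
  have uniq: "k = k'" if k: "k \<in> K" "k' \<in> K" "y - k * x \<in> W" "y - k' * x \<in> W" for k k' y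
  proof (rule ccontr)
    assume "k \<noteq> k'"
    then have "x = inverse (k' - k) * ((y - k * x) - (y - k' * x))"
      by (simp add: field_simps)
    also have "\<dots> \<in> W"
      by (rule ksubspace_scale[OF W(1) ksubfield_inverse[OF K ksubfield_diff[OF K k(2) k(1)]]
            ksubspace_diff[OF K W(1) k(3) k(4)]])
    finally show False
      using W(3) by simp
  qed
  obtain \<mu> where \<mu>: "\<And>y. \<mu> y \<in> K" "\<And>y. y - \<mu> y * x \<in> W"
    using ex by metis
  have \<mu>I: "\<mu> y = k" if "k \<in> K" "y - k * x \<in> W" for y k
    using uniq[OF \<mu>(1) that(1) \<mu>(2) that(2)] .
  show thesis
  proof (rule that[of \<mu>])
    show "klinear K \<mu>"
      unfolding klinear_def
    proof (intro conjI allI ballI)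
      fix y z
      show "\<mu> (y + z) = \<mu> y + \<mu> z"
        using ksubspace_add[OF W(1) \<mu>(2)[of y] \<mu>(2)[of z]]
        by (intro \<mu>I ksubfield_add[OF K] \<mu>) (simp add: algebra_simps)
      fix k assume "k \<in> K"
      then show "\<mu> (k * y) = k * \<mu> y"
        using ksubspace_scale[OF W(1) _ \<mu>(2)[of y], of k]
        by (intro \<mu>I ksubfield_mult[OF K] \<mu>) (simp_all add: algebra_simps)
    qed
    show "range \<mu> \<subseteq> K"
      using \<mu>(1) by blast
    show "\<mu> w = 0" if "w \<in> W0" for w
      using W(2) that by (intro \<mu>I ksubfield_zero[OF K]) auto
    show "\<mu> x = 1"
      using ksubspace_zero[OF W(1)] by (intro \<mu>I ksubfield_one[OF K]) simp
  qed
qed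

text \<open>If \<open>\<mu>\<close> is linear over \<open>K\<close>, then \<open>(ad a ^^ n) \<mu> 1\<close> is the value at \<open>(a \<otimes> 1 - 1 \<otimes> a)\<^sup>n\<close> of the functional
  \<open>c \<otimes> d \<mapsto> c * \<mu> d\<close> on the tensor square over \<open>K\<close>. So \<open>ad_pow_nonzero\<close> says that this element is not
  nilpotent unless \<open>a \<in> K\<close>; for algebraic \<open>a\<close> this is separability.\<close>

definition ad :: "'a::field_char_0 \<Rightarrow> ('a \<Rightarrow> 'a) \<Rightarrow> 'a \<Rightarrow> 'a" where
  "ad a \<mu> = (\<lambda>x. a * \<mu> x - \<mu> (a * x))"

lemma klinear_ad: "klinear K \<mu> \<Longrightarrow> klinear K (ad a \<mu>)"
  by (auto simp: klinear_def ad_def algebra_simps mult.left_commute[of a])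

lemma klinear_ad_pow: "klinear K \<mu> \<Longrightarrow> klinear K ((ad a ^^ n) \<mu>)"
  by (induction n) (auto intro: klinear_ad)

lemma klinear_mult_right: "klinear K \<mu> \<Longrightarrow> klinear K (\<lambda>x. \<mu> (c * x))"
  by (auto simp: klinear_def algebra_simps mult.left_commute[of c])

text \<open>Multiplications by \<open>a\<close> and by \<open>c\<close> commute. This allows a
  nonzero value found at some point \<open>x\<close> to be moved to the point 1.\<close>

lemma ad_pow_mult_right: "(ad a ^^ n) (\<lambda>x. \<mu> (c * x)) = (\<lambda>x. (ad a ^^ n) \<mu> (c * x))"
  by (induction n) (auto simp: ad_def algebra_simps mult.left_commute[of c])

text \<open>For transcendental \<open>a\<close> the element 1 lies outside \<open>a K[a]\<close>. A
  functional that kills this space and is 1 at 1 loses the second term of \<open>ad\<close> at every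
  stage, so that \<open>(ad a ^^ n) \<mu> 1 = a ^ n\<close>.\<close>

lemma ad_pow_transcendental:
  assumes K: "ksubfield K" and "a \<noteq> 0"
    and tr: "\<And>p. (\<forall>i. Polynomial.coeff p i \<in> K) \<Longrightarrow> p \<noteq> 0 \<Longrightarrow> poly p a \<noteq> 0"
  obtains \<mu> where "klinear K \<mu>" "\<And>n. (ad a ^^ n) \<mu> 1 \<noteq> 0"
proof -
  define W where "W = {a * poly p a |p. \<forall>i. Polynomial.coeff p i \<in> K}"
  have "ksubspace K W"
    unfolding ksubspace_def
  proof (intro conjI ballI)
    have "a * poly 0 a \<in> W"
      unfolding W_def using ksubfield_zero[OF K] by (intro CollectI exI[of _ 0]) simp
    then show "0 \<in> W"
      by simp
    show "x + y \<in> W" if xy: "x \<in> W" "y \<in> W" for x y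
    proof -
      obtain p q where "x = a * poly p a" "y = a * poly q a" "\<forall>i. Polynomial.coeff p i \<in> K" "\<forall>i. Polynomial.coeff q i \<in> K"
        using xy unfolding W_def by blast
      then show ?thesis
        unfolding W_def by (intro CollectI exI[of _ "p + q"]) (simp add: algebra_simps ksubfield_add[OF K])
    qed
    show "k * x \<in> W" if kx: "k \<in> K" "x \<in> W" for k x
    proof -
      obtain p where "x = a * poly p a" "\<forall>i. Polynomial.coeff p i \<in> K"
        using kx unfolding W_def by blast
      then show ?thesis
        unfolding W_def using kx by (intro CollectI exI[of _ "Polynomial.smult k p"]) (simp add: algebra_simps ksubfield_mult[OF K])
    qed
  qed
  moreover have "1 \<notin> W"
  proof
    assume "1 \<in> W"
    then obtain p where p: "1 = a * poly p a" "\<forall>i. Polynomial.coeff p i \<in> K"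
      unfolding W_def by blast
    \<comment> \<open>From \<open>1 = a * poly p a\<close> the polynomial \<open>X p - 1\<close>
      over \<open>K\<close> would be nonzero with root \<open>a\<close>.\<close>
    have "\<forall>i. Polynomial.coeff (pCons (- 1) p) i \<in> K"
      using p(2) ksubfield_minus[OF K ksubfield_one[OF K]] by (simp add: coeff_pCons split: nat.splits)
    then show False
      using tr[of "pCons (- 1) p"] p(1) by simp
  qed
  ultimately obtain \<mu> where \<mu>: "klinear K \<mu>" "\<And>w. w \<in> W \<Longrightarrow> \<mu> w = 0" "\<mu> 1 = 1"
    using functional_exists[OF K] by metis
  have pow: "a ^ Suc i \<in> W" for i
    unfolding W_def
    by (intro CollectI exI[of _ "Polynomial.monom 1 i"])
      (simp add: poly_monom Polynomial.coeff_monom ksubfield_one[OF K] ksubfield_zero[OF K])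
  have z: "(ad a ^^ n) \<mu> (a ^ Suc i) = 0" for n i
  proof (induction n arbitrary: i)
    case (Suc n)
    show ?case
      using Suc[of i] Suc[of "Suc i"] by (simp add: ad_def[of a "(ad a ^^ n) \<mu>"])
  qed (use \<mu>(2)[OF pow] in simp)
  have "(ad a ^^ n) \<mu> 1 = a ^ n" for n
  proof (induction n)
    case (Suc n)
    then show ?case
      using z[of n 0] by (simp add: ad_def[of a "(ad a ^^ n) \<mu>"])
  qed (simp add: \<mu>)
  then show thesis
    using that[OF \<mu>(1)] assms(2) by simp
qed

text \<open>If \<open>ad a\<close> kills \<open>ad a E\<close>, then \<open>ad a E\<close> commutes
  with multiplication by \<open>a\<close>, and pulling \<open>p(a)\<close> out of \<open>E\<close>
  gives a Taylor formula that stops after the first derivative.\<close>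

lemma ad_twice_zero:
  assumes K: "klinear K E" and F: "\<And>x. ad a (ad a E) x = 0" and p: "\<forall>i. Polynomial.coeff p i \<in> K"
  shows "E (poly p a * x) = poly p a * E x - poly (pderiv p) a * ad a E x"
proof -
  let ?F = "ad a E"
  have Fa: "?F (a * y) = a * ?F y" for y
    using F[of y] unfolding ad_def[of a ?F] by simp
  have Ea: "E (a * y) = a * E y - ?F y" for y
    by (simp add: ad_def)
  note Flin = klinear_ad[OF K, of a]
  have "E (poly p a * x) = poly p a * E x - poly (pderiv p) a * ?F x \<and> ?F (poly p a * x) = poly p a * ?F x"
    using p
  proof (induction p)
    case 0
    then show ?case
      by (simp add: klinear_zero[OF K] klinear_zero[OF Flin])
  next
    case (pCons c q)
    have c: "c \<in> K" and q: "\<forall>i. Polynomial.coeff q i \<in> K"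
      using pCons.prems spec[OF pCons.prems, of 0] spec[OF pCons.prems, of "Suc _"] by auto
    have IH: "E (poly q a * x) = poly q a * E x - poly (pderiv q) a * ?F x" "?F (poly q a * x) = poly q a * ?F x"
      using pCons.IH[OF q] by auto
    have e: "poly (pCons c q) a * x = c * x + a * (poly q a * x)"
      by (simp add: algebra_simps)
    have "E (poly (pCons c q) a * x) = c * E x + (a * (poly q a * E x - poly (pderiv q) a * ?F x) - poly q a * ?F x)"
      unfolding e klinear_add[OF K] klinear_scale[OF K c] Ea IH by simp
    moreover have "?F (poly (pCons c q) a * x) = c * ?F x + a * (poly q a * ?F x)"
      unfolding e klinear_add[OF Flin] klinear_scale[OF Flin c] Fa IH by simp
    ultimately show ?case
      by (simp add: pderiv_pCons algebra_simps)
  qed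
  then show ?thesis
    by simp
qed

lemma ad_pow_nonzero:
  assumes K: "ksubfield K" and a: "a \<notin> K"
  shows "\<exists>\<mu>. klinear K \<mu> \<and> (ad a ^^ n) \<mu> 1 \<noteq> 0"
proof (cases "\<exists>p. (\<forall>i. Polynomial.coeff p i \<in> K) \<and> p \<noteq> 0 \<and> poly p a = 0")
  case False
  moreover have "a \<noteq> 0"
    using a ksubfield_zero[OF K] by blast
  ultimately show ?thesis
    using ad_pow_transcendental[OF K, of a] by metis
next
  case True
  define Q where "Q = (\<lambda>p. (\<forall>i. Polynomial.coeff p i \<in> K) \<and> p \<noteq> 0 \<and> poly p a = 0)"
  define p where "p = arg_min Polynomial.degree Q"
  obtain q where "Q q"
    using True Q_def by blast
  then have Qp: "Q p" and min: "\<And>q. Q q \<Longrightarrow> Polynomial.degree p \<le> Polynomial.degree q"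
    unfolding p_def by (auto intro: arg_min_natI arg_min_nat_le)
  have deg: "Polynomial.degree p \<noteq> 0"
  proof
    assume "Polynomial.degree p = 0"
    then obtain c where "p = [:c:]"
      by (metis degree_eq_zeroE)
    then show False
      using Qp by (simp add: Q_def)
  qed
  \<comment> \<open>Separability of the minimal polynomial: in characteristic 0 its derivative is
    nonzero and has smaller degree.\<close>
  have sep: "poly (pderiv p) a \<noteq> 0"
  proof
    assume 0: "poly (pderiv p) a = 0"
    have "pderiv p \<noteq> 0"
      using deg by (simp add: pderiv_eq_0_iff)
    then have "Q (pderiv p)"
      using Qp 0 ksubfield_mult[OF K] ksubfield_of_nat[OF K] unfolding Q_def coeff_pderiv by blast
    then show False
      using min[of "pderiv p"] deg by (simp add: degree_pderiv)
  qed
  \<comment> \<open>The point 1 is relaxed to an arbitrary \<open>x\<close> for the induction and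
    recovered at the end by composing \<open>\<mu>\<close> with multiplication by
    \<open>x\<close>.\<close>
  have "\<exists>\<mu> x. klinear K \<mu> \<and> (ad a ^^ n) \<mu> x \<noteq> 0"
  proof (induction n)
    case 0
    have "klinear K (\<lambda>x. x)"
      by (simp add: klinear_def)
    then show ?case
      by (intro exI[of _ "\<lambda>x. x"] exI[of _ 1]) simp
  next
    case (Suc n)
    show ?case
    proof (cases n)
      case 0
      \<comment> \<open>Here \<open>a \<notin> K\<close> enters: a functional that kills
        \<open>K\<close> and is 1 at \<open>a\<close> satisfies
        \<open>ad a \<mu> 1 = - 1\<close>.\<close>
      have "ksubspace K K"
        by (simp add: ksubspace_def ksubfield_zero[OF K] ksubfield_add[OF K] ksubfield_mult[OF K])
      then obtain \<mu> where \<mu>: "klinear K \<mu>" "\<And>w. w \<in> K \<Longrightarrow> \<mu> w = 0" "\<mu> a = 1"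
        using functional_exists[OF K _ a] by metis
      then have "(ad a ^^ Suc n) \<mu> 1 \<noteq> 0"
        using 0 ksubfield_one[OF K] by (simp add: ad_def)
      then show ?thesis
        using \<mu>(1) by blast
    next
      case (Suc k)
      show ?thesis
      proof (rule ccontr)
        assume neg: "\<not> (\<exists>\<mu> x. klinear K \<mu> \<and> (ad a ^^ Suc n) \<mu> x \<noteq> 0)"
        obtain \<mu> x where \<mu>: "klinear K \<mu>" "(ad a ^^ n) \<mu> x \<noteq> 0"
          using Suc.IH by blast
        let ?E = "(ad a ^^ k) \<mu>"
        have E: "klinear K ?E"
          by (rule klinear_ad_pow[OF \<mu>(1)])
        have "ad a (ad a ?E) y = 0" for y
          using neg \<mu>(1) Suc by auto
        \<comment> \<open>Since \<open>poly p a = 0\<close>, the left side and the first term on the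
          right vanish. Dividing by \<open>poly (pderiv p) a\<close> gives
          \<open>ad a ?E x = 0\<close>, against the choice of \<open>\<mu>\<close> and
          \<open>x\<close>.\<close>
        then have "?E (poly p a * x) = poly p a * ?E x - poly (pderiv p) a * ad a ?E x"
          using Qp by (intro ad_twice_zero[OF E]) (auto simp: Q_def)
        then have "ad a ?E x = 0"
          using Qp sep by (simp add: Q_def klinear_zero[OF E])
        then show False
          using \<mu>(2) Suc by simp
      qed
    qed
  qed
  then obtain \<mu> x where "klinear K \<mu>" "(ad a ^^ n) \<mu> x \<noteq> 0"
    by blast
  then show ?thesis
    using klinear_mult_right[of K \<mu> x] by (intro exI[of _ "\<lambda>y. \<mu> (x * y)"]) (simp add: ad_pow_mult_right)
qed

section \<open>Differential terms\<close>

abbreviation tval :: "('m \<Rightarrow> 'a::field_char_0 \<Rightarrow> 'a) \<Rightarrow> (nat \<Rightarrow> 'a) \<Rightarrow> ('m, 'a) dterm \<Rightarrow> 'a" where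
  "tval \<delta> \<equiv> teval ring_of_type_algebra \<delta> id"

text \<open>The value of the term at the generic point: \<open>teval\<close> in the ring of
  differential polynomials, with parameters read as constants and variables as
  indeterminates.\<close>

abbreviation tpoly :: "('m \<Rightarrow> 'a::field_char_0 \<Rightarrow> 'a) \<Rightarrow> ('m, 'a) dterm \<Rightarrow> (nat, 'm, 'a) dpoly" where
  "tpoly \<delta> \<equiv> teval ring_of_type_algebra (pder \<delta>) dconst dvar"

lemma ring_of_type_simps [simp]:
  "carrier (ring_of_type_algebra :: 'b::comm_ring_1 ring) = UNIV"
  "\<zero>\<^bsub>ring_of_type_algebra :: 'b ring\<^esub> = 0" "\<one>\<^bsub>ring_of_type_algebra :: 'b ring\<^esub> = 1"
  "x \<oplus>\<^bsub>ring_of_type_algebra :: 'b ring\<^esub> y = x + y" "x \<otimes>\<^bsub>ring_of_type_algebra :: 'b ring\<^esub> y = x * y"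
  by (simp_all add: ring_of_type_algebra_def)

lemma ring_of_type_uminus [simp]: "\<ominus>\<^bsub>ring_of_type_algebra\<^esub> (x :: 'b::comm_ring_1) = - x"
proof -
  interpret ring "ring_of_type_algebra :: 'b ring"
    by (rule ring_from_type_algebra)
  show ?thesis
    by (rule minus_equality) simp_all
qed

lemma tval_cong: "(\<And>i. i \<in> tvars t \<Longrightarrow> \<rho> i = \<rho>' i) \<Longrightarrow> tval \<delta> \<rho> t = tval \<delta> \<rho>' t"
  by (induction t) auto

lemma deval_tpoly:
  assumes "derivations \<delta>"
  shows "deval \<delta> \<rho> (tpoly \<delta> t) = tval \<delta> \<rho> t"
  using ring_morphism_deval[of \<delta> \<rho>]
  by (induction t) (simp_all add: ring_morphism_zero ring_morphism_one ring_morphism_add ring_morphism_mult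
      ring_morphism_minus deval_pder[OF assms])

lemma hom_tpoly:
  assumes L: "ring L" and j: "j \<in> ring_hom ring_of_type_algebra L" and der: "\<And>i x. j (pder \<delta> i x) = D i (j x)"
  shows "teval L D (j \<circ> dconst) (j \<circ> dvar) t = j (tpoly \<delta> t)"
proof -
  interpret L: ring L by fact
  have hom: "j x \<in> carrier L" "j (x + y) = j x \<oplus>\<^bsub>L\<^esub> j y" "j (x * y) = j x \<otimes>\<^bsub>L\<^esub> j y" "j 1 = \<one>\<^bsub>L\<^esub>" for x y
    using ring_hom_closed[OF j, of x] ring_hom_add[OF j, of x y] ring_hom_mult[OF j, of x y] ring_hom_one[OF j]
    by simp_all
  have zero: "j 0 = \<zero>\<^bsub>L\<^esub>"
    using hom(2)[of 0 0] hom(1)[of 0] L.add.l_cancel_one by (metis add_0)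
  have minus: "j (- x) = \<ominus>\<^bsub>L\<^esub> j x" for x
    using hom(2)[of "- x" x] hom(1) zero L.minus_equality[of "j (- x)" "j x"] by simp
  show ?thesis
    by (induction t) (simp_all add: hom zero minus der)
qed

section \<open>Differential polynomials with coefficients in a subfield\<close>

lemma dpolys_lookup:
  assumes "ksubfield K" "f \<in> dpolys K S"
  shows "lookup f M \<in> K"
  using assms by (cases "M \<in> keys f") (auto simp: dpolys_def in_keys_iff ksubfield_zero)

lemma dpolys_keys: "f \<in> dpolys K S \<Longrightarrow> M \<in> keys f \<Longrightarrow> keys M \<subseteq> S \<times> UNIV"
  by (simp add: dpolys_def)

lemma dpolys_zero: "0 \<in> dpolys K S"
  by (simp add: dpolys_def)

lemma dpolys_add:
  assumes K: "ksubfield K" and f: "f \<in> dpolys K S" and g: "g \<in> dpolys K S"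
  shows "f + g \<in> dpolys K S"
proof (rule dpolysI)
  fix M assume "lookup (f + g) M \<noteq> 0"
  then have "M \<in> keys f \<union> keys g"
    using keys_add[of f g] by (auto simp: in_keys_iff)
  then show "lookup (f + g) M \<in> K \<and> keys M \<subseteq> S \<times> UNIV"
    using dpolys_keys[OF f] dpolys_keys[OF g]
    by (auto simp: lookup_add intro!: ksubfield_add[OF K] dpolys_lookup[OF K f] dpolys_lookup[OF K g])
qed

lemma dpolys_sum:
  assumes K: "ksubfield K" and "\<And>a. a \<in> A \<Longrightarrow> f a \<in> dpolys K S"
  shows "sum f A \<in> dpolys K S"
  using assms(2) by (induction A rule: infinite_finite_induct) (simp_all add: dpolys_zero dpolys_add[OF K])

lemma dpolys_single: "c \<in> K \<Longrightarrow> keys M \<subseteq> S \<times> UNIV \<Longrightarrow> single M c \<in> dpolys K S"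
  by (auto simp: dpolys_def)

lemma dpolys_mult:
  assumes K: "ksubfield K" and f: "f \<in> dpolys K S" and g: "g \<in> dpolys K S"
  shows "f * g \<in> dpolys K S"
proof -
  let ?f = "\<lambda>M. single M (lookup f M)"
  let ?g = "\<lambda>M. single M (lookup g M)"
  have "f * g = (\<Sum>M\<in>keys f. \<Sum>N\<in>keys g. ?f M * ?g N)"
    unfolding sum_product[symmetric] poly_mapping_sum_single[symmetric] by (rule refl)
  also have "\<dots> \<in> dpolys K S"
  proof (intro dpolys_sum[OF K])
    fix M N assume MN: "M \<in> keys f" "N \<in> keys g"
    have "keys (M + N) \<subseteq> S \<times> UNIV"
      using keys_add[of M N] dpolys_keys[OF f MN(1)] dpolys_keys[OF g MN(2)] by blast
    then show "?f M * ?g N \<in> dpolys K S"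
      unfolding mult_single
      by (intro dpolys_single ksubfield_mult[OF K] dpolys_lookup[OF K f] dpolys_lookup[OF K g])
  qed
  finally show ?thesis .
qed

lemma dpolys_dconst: "c \<in> K \<Longrightarrow> dconst c \<in> dpolys K S"
  by (simp add: dconst_def dpolys_single)

lemma dpolys_dvar: "ksubfield K \<Longrightarrow> v \<in> S \<Longrightarrow> dvar v \<in> dpolys K S"
  unfolding dvar_def by (rule dpolys_single) (auto simp: ksubfield_one)

lemma dpolys_uminus:
  assumes K: "ksubfield K" and f: "f \<in> dpolys K S"
  shows "- f \<in> dpolys K S"
  using dpolys_mult[OF K dpolys_dconst[OF ksubfield_minus[OF K ksubfield_one[OF K]]] f]
  by (simp add: dconst_def single_uminus)

lemma mono_pder_dpolys:
  assumes K: "ksubfield K" and M: "keys M \<subseteq> S \<times> UNIV"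
  shows "mono_pder i M \<in> dpolys K S"
  unfolding mono_pder_def
proof (intro dpolys_sum[OF K] dpolys_single ksubfield_of_nat[OF K])
  fix k assume k: "k \<in> keys M"
  let ?N = "M - single k 1"
  have "keys ?N \<subseteq> keys M"
    by (auto simp: in_keys_iff lookup_minus)
  also note M
  finally have N: "keys ?N \<subseteq> S \<times> UNIV" .
  have "fst k \<in> S"
    using subsetD[OF M k] by (simp only: mem_Times_iff)
  then have "keys ?N \<union> keys (single (jet_shift i k) (1::nat)) \<subseteq> S \<times> UNIV"
    using N by (simp add: jet_shift_def case_prod_beta mem_Times_iff)
  then show "keys (?N + single (jet_shift i k) 1) \<subseteq> S \<times> UNIV"
    by (rule order_trans[OF keys_add])
qed

lemma dpolys_pder:
  assumes K: "ksubfield K" and K\<delta>: "\<And>i a. a \<in> K \<Longrightarrow> \<delta> i a \<in> K" and f: "f \<in> dpolys K S"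
  shows "pder \<delta> i f \<in> dpolys K S"
  unfolding pder_eq
  by (intro dpolys_sum[OF K] dpolys_add[OF K] dpolys_mult[OF K] dpolys_single dpolys_dconst mono_pder_dpolys[OF K]
      K\<delta> dpolys_lookup[OF K f] dpolys_keys[OF f])

lemma tpoly_dpolys:
  assumes "ksubfield K" "\<And>i a. a \<in> K \<Longrightarrow> \<delta> i a \<in> K" "set2_dterm t \<subseteq> K"
  shows "tpoly \<delta> t \<in> dpolys K UNIV"
  using assms(3)
proof (induction t)
  case TOne
  show ?case
    using dpolys_dconst[OF ksubfield_one[OF assms(1)], of UNIV] by simp
qed (simp_all add: dpolys_zero dpolys_dconst dpolys_dvar dpolys_add dpolys_mult dpolys_uminus dpolys_pder assms(1,2))

text \<open>In the residue field of a prime differential ideal that contains \<open>I\<close> and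
  avoids \<open>g\<close>, the images of the variables solve \<open>T\<close> with \<open>g\<close>
  nonzero. Existential closedness brings such a solution back. Terms rather than polynomials are
  used so that the system can be written as a formula.\<close>

theorem differential_nullstellensatz:
  fixes \<delta> :: "'m::finite \<Rightarrow> 'a::field_char_0 \<Rightarrow> 'a"
  assumes model: "model_DCF0 \<delta>" and I: "diff_ideal (pder \<delta>) I" and g: "\<And>n. tpoly \<delta> g ^ n \<notin> I"
    and T: "finite T" "\<And>t. t \<in> T \<Longrightarrow> tpoly \<delta> t \<in> I"
  obtains \<rho> where "\<And>t. t \<in> T \<Longrightarrow> tval \<delta> \<rho> t = 0" "tval \<delta> \<rho> g \<noteq> 0"
proof -
  have \<delta>: "derivations \<delta>"
    using model derivations_ring_of_type by (auto simp: model_DCF0_def)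
  have rat: "\<exists>y. of_nat n * y = (1 :: (nat, 'm, 'a) dpoly)" if "n > 0" for n
    using that dconst_mult[of "of_nat n" "inverse (of_nat n :: 'a)"]
    by (intro exI[of _ "dconst (inverse (of_nat n))"]) (simp add: dconst_def single_of_nat)
  obtain P where P: "diff_ideal (pder \<delta>) P" "I \<subseteq> P" "tpoly \<delta> g \<notin> P" "1 \<notin> P"
      "\<And>a b. a * b \<in> P \<Longrightarrow> a \<in> P \<or> b \<in> P"
    using prime_diff_ideal_avoiding[OF derivations_pder[OF \<delta>] I rat g] by blast
  obtain \<iota> :: "(nat, 'm, 'a) dpoly \<times> (nat, 'm, 'a) dpoly \<Rightarrow> 'a" where \<iota>: "inj \<iota>"
    by (rule inj_dpoly_pair)
  obtain L :: "'a ring" and D j where L: "differential_field L D" "j \<in> ring_hom ring_of_type_algebra L"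
    "\<And>i x. j (pder \<delta> i x) = D i (j x)" "\<And>x. j x = \<zero>\<^bsub>L\<^esub> \<longleftrightarrow> x \<in> P"
    using prime_diff_ideal_residue_field[OF derivations_pder[OF \<delta>] P(1,4,5) \<iota>] by blast
  have field: "field L"
    using L(1) by (simp add: differential_field_def)
  interpret L: field L by fact
  have hom: "j x \<in> carrier L" "j (x + y) = j x \<oplus>\<^bsub>L\<^esub> j y" "j (x * y) = j x \<otimes>\<^bsub>L\<^esub> j y" "j 1 = \<one>\<^bsub>L\<^esub>" for x y
    using ring_hom_closed[OF L(2), of x] ring_hom_add[OF L(2), of x y] ring_hom_mult[OF L(2), of x y] ring_hom_one[OF L(2)]
    by simp_all
  \<comment> \<open>A nonzero constant is a unit of the polynomial ring and therefore lies outside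
    the proper ideal \<open>P\<close>.\<close>
  have "inj (j \<circ> dconst)"
  proof (rule injI)
    fix x y assume xy: "(j \<circ> dconst) x = (j \<circ> dconst) y"
    have "j (dconst x) = j (dconst (x - y)) \<oplus>\<^bsub>L\<^esub> j (dconst y)"
      using hom(2)[of "dconst (x - y)" "dconst y"] by (simp flip: dconst_add)
    then have "j (dconst (x - y)) = \<zero>\<^bsub>L\<^esub>"
      using xy hom(1) L.add.r_cancel_one' by simp
    then have "dconst (x - y) \<in> P"
      using L(4) by simp
    then have "dconst (inverse (x - y)) * dconst (x - y) \<in> P"
      by (rule diff_ideal_mult[OF P(1)])
    then show "x = y"
      using P(4) by (cases "x = y") (simp_all flip: dconst_mult)
  qed
  then have emb: "differential_embedding \<delta> L D (j \<circ> dconst)"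
    unfolding differential_embedding_def
    using L(3) hom by (auto intro!: ring_hom_memI simp: dconst_add dconst_mult simp flip: pder_dconst[OF \<delta>])
  obtain ts where ts: "set ts = T"
    using finite_list[OF T(1)] by blast
  define \<phi> where "\<phi> = foldr (\<lambda>t \<phi>. FAnd (FEq t TZero) \<phi>) ts (FNot (FEq g TZero))"
  have sat: "sat R E e \<rho> \<phi> \<longleftrightarrow> (\<forall>t\<in>T. teval R E e \<rho> t = \<zero>\<^bsub>R\<^esub>) \<and> teval R E e \<rho> g \<noteq> \<zero>\<^bsub>R\<^esub>"
    for R :: "'a ring" and E e \<rho>
    unfolding \<phi>_def ts[symmetric] by (induction ts) auto
  have qf: "quantifier_free \<phi>"
    unfolding \<phi>_def by (induction ts) auto
  have "sat L D (j \<circ> dconst) (j \<circ> dvar) \<phi>"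
    unfolding sat hom_tpoly[OF L.ring_axioms L(2,3)] L(4) using P(2,3) T(2) by blast
  moreover have "range (j \<circ> dvar) \<subseteq> carrier L"
    using hom(1) by auto
  ultimately obtain \<rho> where "sat ring_of_type_algebra \<delta> id \<rho> \<phi>"
    using model L(1) emb qf unfolding model_DCF0_def existentially_closed_def by blast
  then show thesis
    unfolding sat using that[of \<rho>] by simp
qed


section \<open>Elements outside a differential subfield can be moved\<close>

lemma poly_mapping_additive_ext:
  fixes F :: "('k \<Rightarrow>\<^sub>0 'b::ab_group_add) \<Rightarrow> 'c::ab_group_add"
  assumes "\<And>p q. F (p + q) = F p + F q" "\<And>p q. G (p + q) = G p + G q"
    and "\<And>M c. F (single M c) = G (single M c)"
  shows "F p = G p"
proof -
  have "F (\<Sum>M\<in>keys p. single M (lookup p M)) =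
      G (\<Sum>M\<in>keys p. single M (lookup p M))"
    unfolding additive_sum[of F, OF assms(1)] additive_sum[of G, OF assms(2)] assms(3) by (rule refl)
  then show ?thesis
    unfolding poly_mapping_sum_single[symmetric] .
qed

text \<open>A substitute for multiplicativity when \<open>\<mu>\<close> is merely additive: the
  monomial is evaluated outside, while its coefficient moves inside the functional.\<close>

lemma dinsert_single_mult:
  assumes "\<And>x y. \<mu> (x + y) = \<mu> x + \<mu> y"
  shows "dinsert \<mu> D u (single M c * h) = mono_eval D u M * dinsert (\<lambda>x. \<mu> (c * x)) D u h"
proof (rule poly_mapping_additive_ext[where p = h])
  have c: "\<mu> (c * (x + y)) = \<mu> (c * x) + \<mu> (c * y)" for x y
    by (simp add: distrib_left assms)
  have z: "\<mu> 0 = 0"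
    by (rule additive_zero[of \<mu>]) (rule assms)
  show "dinsert \<mu> D u (single M c * (p + q)) =
      dinsert \<mu> D u (single M c * p) + dinsert \<mu> D u (single M c * q)" for p q
    unfolding distrib_left by (rule dinsert_add) (rule assms)
  show "mono_eval D u M * dinsert (\<lambda>x. \<mu> (c * x)) D u (p + q) =
      mono_eval D u M * dinsert (\<lambda>x. \<mu> (c * x)) D u p + mono_eval D u M * dinsert (\<lambda>x. \<mu> (c * x)) D u q" for p q
    unfolding distrib_left[symmetric] by (rule arg_cong[OF dinsert_add]) (rule c)
  show "dinsert \<mu> D u (single M c * single N d) =
      mono_eval D u M * dinsert (\<lambda>x. \<mu> (c * x)) D u (single N d)" for N d
    by (simp add: mult_single dinsert_single z mono_eval_add)
qed

lemma dinsert_klinear_dpolys: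
  assumes "klinear K \<mu>" "q \<in> dpolys K S"
  shows "dinsert \<mu> \<delta> u q = \<mu> 1 * deval \<delta> u q"
proof -
  have "\<mu> (lookup q M) = lookup q M * \<mu> 1" if "M \<in> keys q" for M
    using klinear_scale[OF assms(1), of "lookup q M" 1] that assms(2) by (simp add: dpolys_def)
  then show ?thesis
    by (simp add: dinsert_eq deval_def sum_distrib_left mult.assoc mult.left_commute)
qed

text \<open>The failure of \<open>\<mu>\<close> to commute with \<open>\<delta> i\<close> shows up
  as a second functional on the coefficients. When \<open>K\<close> is closed under the derivations
  it is \<open>K\<close>-linear as well, so a polynomial killed by all functionals has derivatives
  killed by all functionals.\<close>

lemma dinsert_klinear_pder:
  assumes \<delta>: "derivations \<delta>" and K: "ksubfield K" and \<mu>: "klinear K \<mu>"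
  shows "dinsert \<mu> \<delta> u (pder \<delta> i h) = \<delta> i (dinsert \<mu> \<delta> u h) + dinsert (\<lambda>x. \<mu> (\<delta> i x) - \<delta> i (\<mu> x)) \<delta> u h"
proof (rule poly_mapping_additive_ext[where p = h])
  note add = klinear_add[OF \<mu>]
  let ?\<nu> = "\<lambda>x. \<mu> (\<delta> i x) - \<delta> i (\<mu> x)"
  have \<nu>: "?\<nu> (x + y) = ?\<nu> x + ?\<nu> y" for x y
    by (simp add: add derivations_add[OF \<delta>])
  show "dinsert \<mu> \<delta> u (pder \<delta> i (p + q)) = dinsert \<mu> \<delta> u (pder \<delta> i p) + dinsert \<mu> \<delta> u (pder \<delta> i q)" for p q
    unfolding pder_add[OF \<delta>] by (rule dinsert_add) (rule add)
  show "\<delta> i (dinsert \<mu> \<delta> u (p + q)) + dinsert ?\<nu> \<delta> u (p + q) =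
      (\<delta> i (dinsert \<mu> \<delta> u p) + dinsert ?\<nu> \<delta> u p) + (\<delta> i (dinsert \<mu> \<delta> u q) + dinsert ?\<nu> \<delta> u q)" for p q
    using dinsert_add[of \<mu> \<delta> u p q, OF add] dinsert_add[of ?\<nu> \<delta> u p q, OF \<nu>]
    by (simp add: derivations_add[OF \<delta>])
  fix M c
  have e: "deval \<delta> u (mono_pder i M) = \<delta> i (mono_eval \<delta> u M)"
    using deval_pder[OF \<delta>, of u i "single M 1"]
    by (simp add: pder_single[OF \<delta>] derivations_one[OF \<delta>]) (simp add: deval_def dinsert_single)
  have "dinsert \<mu> \<delta> u (dconst c * mono_pder i M) = \<mu> c * \<delta> i (mono_eval \<delta> u M)"
    using dinsert_single_mult[of \<mu> \<delta> u 0 c "mono_pder i M", OF add]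
      dinsert_klinear_dpolys[OF klinear_mult_right[OF \<mu>, of c] mono_pder_dpolys[OF K, of M UNIV i], of \<delta> u]
    by (simp add: dconst_def e)
  then have "dinsert \<mu> \<delta> u (pder \<delta> i (single M c)) =
      \<mu> (\<delta> i c) * mono_eval \<delta> u M + \<mu> c * \<delta> i (mono_eval \<delta> u M)"
    unfolding pder_single[OF \<delta>]
    by (subst dinsert_add) (simp_all add: add dinsert_single klinear_zero[OF \<mu>])
  then show "dinsert \<mu> \<delta> u (pder \<delta> i (single M c)) =
      \<delta> i (dinsert \<mu> \<delta> u (single M c)) + dinsert ?\<nu> \<delta> u (single M c)"
    by (simp add: dinsert_single klinear_zero[OF \<mu>] derivations_zero[OF \<delta>] derivations_mult[OF \<delta>] algebra_simps)
qed

text \<open>The ideal \<open>I\<close> in the proof is the kernel of the map from the differential polynomials over the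
  universal domain \<open>U\<close> to the tensor product of \<open>U\<close> and \<open>K{u}\<close> over \<open>K\<close>; testing with all
  \<open>K\<close>-linear \<open>\<mu>\<close> avoids constructing that product.\<close>

lemma finite_specialization_moving:
  fixes \<delta> :: "'m::finite \<Rightarrow> 'a::field_char_0 \<Rightarrow> 'a"
  assumes model: "model_DCF0 \<delta>" and K: "ksubfield K" and K\<delta>: "\<And>i a. a \<in> K \<Longrightarrow> \<delta> i a \<in> K"
    and u: "u 0 \<notin> K"
    and T: "finite T" "\<And>t. t \<in> T \<Longrightarrow> set2_dterm t \<subseteq> K \<and> tval \<delta> u t = 0"
  obtains \<rho> where "\<And>t. t \<in> T \<Longrightarrow> tval \<delta> \<rho> t = 0" "\<rho> 0 \<noteq> u 0"
proof -
  have \<delta>: "derivations \<delta>"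
    using model derivations_ring_of_type by (auto simp: model_DCF0_def)
  define a where "a = u 0"
  define I where "I = {h. \<forall>\<mu>. klinear K \<mu> \<longrightarrow> dinsert \<mu> \<delta> u h = 0}"
  have II: "h \<in> I" if "\<And>\<mu>. klinear K \<mu> \<Longrightarrow> dinsert \<mu> \<delta> u h = 0" for h
    using that by (simp add: I_def)
  have ID: "dinsert \<mu> \<delta> u h = 0" if "h \<in> I" "klinear K \<mu>" for h \<mu>
    using that by (simp add: I_def)
  have I: "diff_ideal (pder \<delta>) I"
    unfolding diff_ideal_def
  proof (intro conjI ballI allI)
    show "0 \<in> I"
      by (rule II) simp
    show "x + y \<in> I" if "x \<in> I" "y \<in> I" for x y
      by (rule II) (simp add: dinsert_add klinear_add ID[OF that(1)] ID[OF that(2)])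
    show "r * x \<in> I" if "x \<in> I" for x r
    proof (rule II)
      fix \<mu> assume \<mu>: "klinear K \<mu>"
      have "dinsert \<mu> \<delta> u (r * x) = (\<lambda>_. 0) r"
      proof (rule poly_mapping_additive_ext[where p = r])
        show "dinsert \<mu> \<delta> u ((p + q) * x) = dinsert \<mu> \<delta> u (p * x) + dinsert \<mu> \<delta> u (q * x)" for p q
          unfolding distrib_right by (rule dinsert_add) (rule klinear_add[OF \<mu>])
        show "dinsert \<mu> \<delta> u (single M c * x) = 0" for M c
          using dinsert_single_mult[of \<mu> \<delta> u M c x, OF klinear_add[OF \<mu>]] ID[OF that klinear_mult_right[OF \<mu>]] by simp
      qed simp
      then show "dinsert \<mu> \<delta> u (r * x) = 0" .
    qed
    show "pder \<delta> i x \<in> I" if "x \<in> I" for x i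
    proof (rule II)
      fix \<mu> assume \<mu>: "klinear K \<mu>"
      \<comment> \<open>Both terms contribute \<open>\<delta> i k * \<mu> x\<close> to the scaling
        rule, and the contributions cancel; this uses \<open>\<delta> i k \<in> K\<close>.\<close>
      have "klinear K (\<lambda>x. \<mu> (\<delta> i x) - \<delta> i (\<mu> x))"
        unfolding klinear_def
      proof (intro conjI allI ballI)
        fix k x assume k: "k \<in> K"
        show "\<mu> (\<delta> i (k * x)) - \<delta> i (\<mu> (k * x)) = k * (\<mu> (\<delta> i x) - \<delta> i (\<mu> x))"
          unfolding derivations_mult[OF \<delta>] klinear_add[OF \<mu>] klinear_scale[OF \<mu> k] klinear_scale[OF \<mu> K\<delta>[OF k]]
          by (simp add: algebra_simps)
      qed (simp add: klinear_add[OF \<mu>] derivations_add[OF \<delta>])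
      then show "dinsert \<mu> \<delta> u (pder \<delta> i x) = 0"
        using ID[OF that \<mu>] ID[OF that, of "\<lambda>x. \<mu> (\<delta> i x) - \<delta> i (\<mu> x)"]
        by (simp add: dinsert_klinear_pder[OF \<delta> K \<mu>] derivations_zero[OF \<delta>])
    qed
  qed
  define g :: "('m, 'a) dterm" where "g = TAdd (TVar 0) (TNeg (TPar a))"
  have g: "tpoly \<delta> g = dvar 0 - dconst a"
    by (simp add: g_def)
  \<comment> \<open>Multiplication by \<open>g\<close> turns into \<open>ad a\<close> on the
    functional: the variable 0 is evaluated to \<open>a\<close> outside \<open>\<mu>\<close>,
    whereas the constant \<open>a\<close> stays inside.\<close>
  have mult: "dinsert \<mu> \<delta> u (tpoly \<delta> g * h) = dinsert (ad a \<mu>) \<delta> u h" if \<mu>: "klinear K \<mu>" for \<mu> h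
  proof -
    have add: "\<mu> (x + y) = \<mu> x + \<mu> y" for x y
      by (rule klinear_add[OF \<mu>])
    have "dinsert \<mu> \<delta> u (dvar 0 * h) = a * dinsert \<mu> \<delta> u h"
      using dinsert_single_mult[of \<mu> \<delta> u "single (0, \<lambda>_. 0) 1" 1 h, OF add]
        mono_eval_single[of \<delta> u 0 "\<lambda>_. 0"]
      by (simp add: dvar_def dpow_zero a_def)
    moreover have "dinsert \<mu> \<delta> u (dconst a * h) = dinsert (\<lambda>x. \<mu> (a * x)) \<delta> u h"
      using dinsert_single_mult[of \<mu> \<delta> u 0 a h, OF add] by (simp add: dconst_def)
    moreover have "dinsert \<mu> \<delta> u (dvar 0 * h - dconst a * h) =
        dinsert \<mu> \<delta> u (dvar 0 * h) - dinsert \<mu> \<delta> u (dconst a * h)"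
      by (rule additive_diff) (rule dinsert_add, rule add)
    ultimately show ?thesis
      by (simp add: g ad_def left_diff_distrib dinsert_eq sum_distrib_left sum_subtractf mult.assoc)
  qed
  have pow: "dinsert \<mu> \<delta> u (tpoly \<delta> g ^ n) = (ad a ^^ n) \<mu> 1" if "klinear K \<mu>" for \<mu> n
    using that
  proof (induction n arbitrary: \<mu>)
    case 0
    then show ?case
      using dinsert_dconst[of \<mu> \<delta> u 1] by (simp add: klinear_zero)
  next
    case (Suc n)
    then show ?case
      by (simp add: mult klinear_ad funpow_swap1)
  qed
  have gI: "tpoly \<delta> g ^ n \<notin> I" for n
    using ad_pow_nonzero[OF K u, of n] pow ID unfolding a_def by metis
  \<comment> \<open>For an equation over \<open>K\<close> the functional factors out as
    \<open>\<mu> 1\<close> times the value at \<open>u\<close>, which is zero.\<close>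
  have TI: "tpoly \<delta> t \<in> I" if "t \<in> T" for t
  proof (rule II)
    fix \<mu> assume \<mu>: "klinear K \<mu>"
    have "tpoly \<delta> t \<in> dpolys K UNIV"
      using T(2)[OF that] by (intro tpoly_dpolys K K\<delta>) auto
    from dinsert_klinear_dpolys[OF \<mu> this, of \<delta> u] show "dinsert \<mu> \<delta> u (tpoly \<delta> t) = 0"
      using T(2)[OF that] by (simp add: deval_tpoly[OF \<delta>])
  qed
  obtain \<rho> where "\<And>t. t \<in> T \<Longrightarrow> tval \<delta> \<rho> t = 0" "tval \<delta> \<rho> g \<noteq> 0"
    using differential_nullstellensatz[OF model I gI T(1) TI] by blast
  then show thesis
    using that[of \<rho>] by (simp add: g_def a_def)
qed

section \<open>Saturation for tuples\<close>

primrec tsub :: "(nat \<Rightarrow> ('m, 'a) dterm) \<Rightarrow> ('m, 'a) dterm \<Rightarrow> ('m, 'a) dterm" where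
  "tsub \<sigma> (TVar x) = \<sigma> x"
| "tsub \<sigma> (TPar a) = TPar a"
| "tsub \<sigma> TZero = TZero"
| "tsub \<sigma> TOne = TOne"
| "tsub \<sigma> (TAdd s t) = TAdd (tsub \<sigma> s) (tsub \<sigma> t)"
| "tsub \<sigma> (TNeg t) = TNeg (tsub \<sigma> t)"
| "tsub \<sigma> (TMul s t) = TMul (tsub \<sigma> s) (tsub \<sigma> t)"
| "tsub \<sigma> (TDer i t) = TDer i (tsub \<sigma> t)"

lemma tval_tsub: "tval \<delta> \<rho> (tsub \<sigma> t) = tval \<delta> (\<lambda>i. tval \<delta> \<rho> (\<sigma> i)) t"
  by (induction t) auto

lemma tvars_tsub: "tvars (tsub \<sigma> t) = (\<Union>i\<in>tvars t. tvars (\<sigma> i))"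
  by (induction t) auto

lemma params_tsub: "set2_dterm (tsub \<sigma> t) \<subseteq> set2_dterm t \<union> (\<Union>i\<in>tvars t. set2_dterm (\<sigma> i))"
  by (induction t) auto

lemma sat_exists:
  fixes \<rho> :: "nat \<Rightarrow> 'a::field_char_0"
  shows "sat ring_of_type_algebra \<delta> id \<rho> (foldr FEx xs \<psi>) \<longleftrightarrow>
     (\<exists>\<rho>'. (\<forall>i. i \<notin> set xs \<longrightarrow> \<rho>' i = \<rho> i) \<and> sat ring_of_type_algebra \<delta> id \<rho>' \<psi>)"
proof (induction xs arbitrary: \<rho>)
  case Nil
  have "\<rho>' = \<rho>" if "\<forall>i. \<rho>' i = \<rho> i" for \<rho>'
    using that by auto
  then show ?case
    by auto
next
  case (Cons x xs)
  have "(\<exists>a. \<exists>\<rho>'. (\<forall>i. i \<notin> set xs \<longrightarrow> \<rho>' i = (\<rho>(x := a)) i) \<and> sat ring_of_type_algebra \<delta> id \<rho>' \<psi>) \<longleftrightarrow>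
      (\<exists>\<rho>'. (\<forall>i. i \<notin> set (x # xs) \<longrightarrow> \<rho>' i = \<rho> i) \<and> sat ring_of_type_algebra \<delta> id \<rho>' \<psi>)"
  proof
    assume "\<exists>\<rho>'. (\<forall>i. i \<notin> set (x # xs) \<longrightarrow> \<rho>' i = \<rho> i) \<and> sat ring_of_type_algebra \<delta> id \<rho>' \<psi>"
    then obtain \<rho>' where "\<forall>i. i \<notin> set (x # xs) \<longrightarrow> \<rho>' i = \<rho> i" "sat ring_of_type_algebra \<delta> id \<rho>' \<psi>"
      by blast
    then show "\<exists>a. \<exists>\<rho>'. (\<forall>i. i \<notin> set xs \<longrightarrow> \<rho>' i = (\<rho>(x := a)) i) \<and> sat ring_of_type_algebra \<delta> id \<rho>' \<psi>"
      by (intro exI[of _ "\<rho>' x"] exI[of _ \<rho>']) auto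
  next
    assume "\<exists>a. \<exists>\<rho>'. (\<forall>i. i \<notin> set xs \<longrightarrow> \<rho>' i = (\<rho>(x := a)) i) \<and> sat ring_of_type_algebra \<delta> id \<rho>' \<psi>"
    then obtain a \<rho>' where "\<forall>i. i \<notin> set xs \<longrightarrow> \<rho>' i = (\<rho>(x := a)) i" "sat ring_of_type_algebra \<delta> id \<rho>' \<psi>"
      by blast
    then show "\<exists>\<rho>'. (\<forall>i. i \<notin> set (x # xs) \<longrightarrow> \<rho>' i = \<rho> i) \<and> sat ring_of_type_algebra \<delta> id \<rho>' \<psi>"
      by (intro exI[of _ \<rho>']) auto
  qed
  then show ?case
    unfolding foldr.simps comp_apply sat.simps Cons.IH ring_of_type_simps by blast
qed

lemma free_vars_exists: "free_vars (foldr FEx xs \<psi>) = free_vars \<psi> - set xs"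
  by (induction xs) auto

lemma params_exists: "parameters (foldr FEx xs \<psi>) = parameters \<psi>"
  by (induction xs) auto

definition zero_form :: "('m, 'a) dterm list \<Rightarrow> ('m, 'a) dform" where
  "zero_form ts = foldr (\<lambda>t. FAnd (FEq t TZero)) ts (FEq TZero TZero)"

lemma sat_zero_form:
  "sat ring_of_type_algebra \<delta> id \<rho> (zero_form ts) \<longleftrightarrow> (\<forall>t\<in>set ts. tval \<delta> \<rho> t = (0::'a::field_char_0))"
  unfolding zero_form_def by (induction ts) auto

lemma free_vars_zero_form: "free_vars (zero_form ts) = (\<Union>t\<in>set ts. tvars t)"
  unfolding zero_form_def by (induction ts) auto

lemma params_zero_form: "parameters (zero_form ts) = (\<Union>t\<in>set ts. set2_dterm t)"
  unfolding zero_form_def by (induction ts) auto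

lemma small_Un:
  assumes "small (A :: 'a::field_char_0 set)" "small B"
  shows "small (A \<union> B)"
  using assms infinite_UNIV_char_0 unfolding small_def by (intro card_of_Un_ordLess_infinite) auto

lemma small_finite:
  assumes "finite (A :: 'a::field_char_0 set)"
  shows "small A"
  unfolding small_def using assms infinite_UNIV_char_0
  by (intro finite_ordLess_infinite[OF card_of_Well_order card_of_Well_order]) (simp_all add: Field_card_of)

text \<open>The variables are realised one after the other. Since \<^const>\<open>saturated\<close> speaks of the variable
  \<open>0\<close>, the substitution \<open>\<sigma>\<close> renames the current variable \<open>k\<close> to \<open>0\<close>, which is free because the
  variables below \<open>k\<close> have already become parameters.\<close>

lemma saturated_tuple:
  fixes \<delta> :: "'m \<Rightarrow> 'a::field_char_0 \<Rightarrow> 'a"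
  assumes sat: "saturated \<delta>" and A: "small A"
    and T: "\<And>t. t \<in> T \<Longrightarrow> set2_dterm t \<subseteq> A \<and> tvars t \<subseteq> {..<N}"
    and fin: "\<And>T0. finite T0 \<Longrightarrow> T0 \<subseteq> T \<Longrightarrow> \<exists>\<rho>. \<forall>t\<in>T0. tval \<delta> \<rho> t = 0"
  shows "\<exists>\<rho>. \<forall>t\<in>T. tval \<delta> \<rho> t = 0"
proof -
  \<comment> \<open>Invariant: the first \<open>k\<close> values extend to a solution of every
    finite subsystem.\<close>
  have "\<exists>\<rho>. \<forall>T0. finite T0 \<and> T0 \<subseteq> T \<longrightarrow> (\<exists>\<rho>'. (\<forall>i<k. \<rho>' i = \<rho> i) \<and> (\<forall>t\<in>T0. tval \<delta> \<rho>' t = 0))"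
    if "k \<le> N" for k
    using that
  proof (induction k)
    case 0
    have "\<exists>\<rho>'. (\<forall>i<0. \<rho>' i = (0::'a)) \<and> (\<forall>t\<in>T0. tval \<delta> \<rho>' t = 0)" if "finite T0 \<and> T0 \<subseteq> T" for T0
      using fin[of T0] that by (simp only: not_less0 simp_thms)
    then show ?case
      by (intro exI[of _ "\<lambda>_. 0"]) blast
  next
    case (Suc k)
    then have "\<exists>\<rho>. \<forall>T0. finite T0 \<and> T0 \<subseteq> T \<longrightarrow> (\<exists>\<rho>'. (\<forall>i<k. \<rho>' i = \<rho> i) \<and> (\<forall>t\<in>T0. tval \<delta> \<rho>' t = 0))"
      by (simp only: Suc_leD)
    then obtain \<rho> where \<rho>: "\<And>T0. finite T0 \<Longrightarrow> T0 \<subseteq> T \<Longrightarrow>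
        \<exists>\<rho>'. (\<forall>i<k. \<rho>' i = \<rho> i) \<and> (\<forall>t\<in>T0. tval \<delta> \<rho>' t = 0)"
      by metis
    define \<sigma> :: "nat \<Rightarrow> ('m, 'a) dterm" where
      "\<sigma> = (\<lambda>i. if i < k then TPar (\<rho> i) else if i = k then TVar 0 else TVar i)"
    define \<phi> where "\<phi> = (\<lambda>ts. foldr FEx [Suc k..<N] (zero_form (map (tsub \<sigma>) ts)))"
    define comb where "comb = (\<lambda>\<rho>' :: nat \<Rightarrow> 'a. \<lambda>i. if i < k then \<rho> i else if i = k then \<rho>' 0 else \<rho>' i)"
    have comb: "(\<lambda>i. tval \<delta> \<rho>' (\<sigma> i)) = comb \<rho>'" for \<rho>'
      by (auto simp: \<sigma>_def comb_def)
    \<comment> \<open>\<open>comb\<close> undoes the renaming: the fixed values sit below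
      \<open>k\<close>, the new value is read from variable 0, and the later variables are bound by
      the existential quantifiers.\<close>
    have sat_\<phi>: "sat ring_of_type_algebra \<delta> id (\<lambda>_. x) (\<phi> ts) \<longleftrightarrow>
        (\<exists>\<rho>'. (\<forall>i. i \<notin> {Suc k..<N} \<longrightarrow> \<rho>' i = x) \<and> (\<forall>t\<in>set ts. tval \<delta> (comb \<rho>') t = 0))" for x ts
      unfolding \<phi>_def sat_exists sat_zero_form by (simp add: tval_tsub comb)
    define \<Phi> where "\<Phi> = \<phi> ` {ts. set ts \<subseteq> T}"
    have "\<exists>x. \<forall>\<psi>\<in>\<Phi>. sat ring_of_type_algebra \<delta> id (\<lambda>_. x) \<psi>"
    proof (rule sat[unfolded saturated_def, rule_format, of "A \<union> \<rho> ` {..<k}" \<Phi>], intro conjI ballI allI impI)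
      show "small (A \<union> \<rho> ` {..<k})"
        by (intro small_Un A small_finite) simp
      fix \<psi> assume "\<psi> \<in> \<Phi>"
      then obtain ts where ts: "\<psi> = \<phi> ts" "set ts \<subseteq> T"
        by (auto simp: \<Phi>_def)
      have "tvars (\<sigma> i) \<subseteq> insert 0 {Suc k..<N}" if "i < N" for i
        using that by (auto simp: \<sigma>_def)
      then have "(\<Union>i\<in>tvars t. tvars (\<sigma> i)) \<subseteq> insert 0 {Suc k..<N}" if "t \<in> set ts" for t
        using T[of t] that ts(2) by blast
      then show "free_vars \<psi> \<subseteq> {0}"
        unfolding ts(1) \<phi>_def free_vars_exists free_vars_zero_form by (auto simp: tvars_tsub)
      have "set2_dterm (\<sigma> i) \<subseteq> \<rho> ` {..<k}" for i
        by (auto simp: \<sigma>_def)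
      then have "set2_dterm (tsub \<sigma> t) \<subseteq> A \<union> \<rho> ` {..<k}" if "t \<in> set ts" for t
        using params_tsub[of \<sigma> t] T[of t] that ts(2) by blast
      then show "parameters \<psi> \<subseteq> A \<union> \<rho> ` {..<k}"
        unfolding ts(1) \<phi>_def params_exists params_zero_form by auto
    next
      fix \<Phi>0 assume \<Phi>0: "finite \<Phi>0 \<and> \<Phi>0 \<subseteq> \<Phi>"
      then obtain C where C: "finite C" "C \<subseteq> {ts. set ts \<subseteq> T}" "\<Phi>0 = \<phi> ` C"
        unfolding \<Phi>_def by (meson finite_subset_image)
      obtain \<rho>' where \<rho>': "\<forall>i<k. \<rho>' i = \<rho> i" "\<forall>t\<in>(\<Union>ts\<in>C. set ts). tval \<delta> \<rho>' t = 0"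
        using \<rho>[of "\<Union>ts\<in>C. set ts"] C by auto
      have "sat ring_of_type_algebra \<delta> id (\<lambda>_. \<rho>' k) (\<phi> ts)" if ts: "ts \<in> C" for ts
        unfolding sat_\<phi>
      proof (intro exI conjI allI impI ballI)
        let ?\<rho> = "\<lambda>i. if i \<in> {Suc k..<N} then \<rho>' i else \<rho>' k"
        show "?\<rho> i = \<rho>' k" if "i \<notin> {Suc k..<N}" for i
          using that by (rule if_not_P)
        fix t assume t: "t \<in> set ts"
        have "tval \<delta> (comb ?\<rho>) t = tval \<delta> \<rho>' t"
        proof (rule tval_cong)
          fix i assume "i \<in> tvars t"
          then have "i < N"
            using T[of t] C(2) ts t by blast
          then show "comb ?\<rho> i = \<rho>' i"
            using \<rho>'(1) by (auto simp: comb_def)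
        qed
        then show "tval \<delta> (comb ?\<rho>) t = 0"
          using \<rho>'(2) ts t by auto
      qed
      then show "\<exists>x. \<forall>\<psi>\<in>\<Phi>0. sat ring_of_type_algebra \<delta> id (\<lambda>_. x) \<psi>"
        unfolding C(3) by auto
    qed
    then obtain x where x: "\<And>\<psi>. \<psi> \<in> \<Phi> \<Longrightarrow> sat ring_of_type_algebra \<delta> id (\<lambda>_. x) \<psi>"
      by blast
    show ?case
    proof (rule exI[of _ "\<rho>(k := x)"], intro allI impI, elim conjE)
      fix T0 assume T0: "finite T0" "T0 \<subseteq> T"
      obtain ts where ts: "set ts = T0"
        using finite_list[OF T0(1)] by blast
      have "sat ring_of_type_algebra \<delta> id (\<lambda>_. x) (\<phi> ts)"
        using x T0 ts by (auto simp: \<Phi>_def)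
      then obtain \<rho>' where "\<forall>i. i \<notin> {Suc k..<N} \<longrightarrow> \<rho>' i = x" "\<forall>t\<in>set ts. tval \<delta> (comb \<rho>') t = 0"
        unfolding sat_\<phi> by blast
      then show "\<exists>\<rho>'. (\<forall>i<Suc k. \<rho>' i = (\<rho>(k := x)) i) \<and> (\<forall>t\<in>T0. tval \<delta> \<rho>' t = 0)"
        using ts by (intro exI[of _ "comb \<rho>'"]) (auto simp: comb_def)
    qed
  qed
  \<comment> \<open>With all \<open>N\<close> values fixed, the extension for a single term agrees
    with \<open>\<rho>\<close> on its variables, so one-element subsystems already give the
    claim.\<close>
  from this[OF order_refl] obtain \<rho> where \<rho>: "\<And>T0. finite T0 \<Longrightarrow> T0 \<subseteq> T \<Longrightarrow>
      \<exists>\<rho>'. (\<forall>i<N. \<rho>' i = \<rho> i) \<and> (\<forall>t\<in>T0. tval \<delta> \<rho>' t = 0)"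
    by metis
  have "tval \<delta> \<rho> t = 0" if t: "t \<in> T" for t
  proof -
    obtain \<rho>' where "\<forall>i<N. \<rho>' i = \<rho> i" "tval \<delta> \<rho>' t = 0"
      using \<rho>[of "{t}"] t by auto
    moreover from this have "tval \<delta> \<rho> t = tval \<delta> \<rho>' t"
      using T[OF t] by (intro tval_cong) auto
    ultimately show ?thesis
      by simp
  qed
  then show ?thesis
    by blast
qed


section \<open>Descent to a small differential subfield\<close>

locale universal_subfield =
  fixes \<delta> :: "'m::finite \<Rightarrow> 'a::field_char_0 \<Rightarrow> 'a" and K :: "'a set"
  assumes universal: "universal_domain \<delta>" and subfield: "differential_subfield \<delta> K" and small: "small K"
begin

lemma model: "model_DCF0 \<delta>" and saturated: "saturated \<delta>"
  using universal by (simp_all add: universal_domain_def)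

lemma derivations: "derivations \<delta>"
  using model derivations_ring_of_type by (auto simp: model_DCF0_def)

lemma K_der: "a \<in> K \<Longrightarrow> \<delta> i a \<in> K"
  using subfield by (simp add: differential_subfield_def)

lemma ksubfield: "ksubfield K"
proof -
  interpret R: ring "ring_of_type_algebra :: 'a ring"
    by (rule ring_from_type_algebra)
  have K: "Subrings.subfield K (ring_of_type_algebra :: 'a ring)"
    using subfield by (simp add: differential_subfield_def)
  note S = subringE[OF subfieldE(1)[OF K], simplified]
  have "inverse x \<in> K" if x: "x \<in> K" for x
  proof (cases "x = 0")
    case False
    then have "x \<in> Units (ring_of_type_algebra \<lparr>carrier := K\<rparr>)"
      using subfield.subfield_Units[OF K] x by simp
    then obtain y where "y \<in> K" "y * x = 1"
      by (auto simp: Units_def ring_of_type_algebra_def)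
    then show ?thesis
      using False by (metis inverse_unique mult.commute)
  qed (use S in simp)
  then show ?thesis
    using S by (auto simp: ksubfield_def)
qed

text \<open>Differential polynomial functions over \<open>K\<close> in the variables
  \<open>W\<close>. Stated for functions, membership follows from closure rules, without exhibiting
  a term each time.\<close>

definition term_fun :: "nat set \<Rightarrow> ((nat \<Rightarrow> 'a) \<Rightarrow> 'a) \<Rightarrow> bool" where
  "term_fun W F \<longleftrightarrow> (\<exists>t. set2_dterm t \<subseteq> K \<and> tvars t \<subseteq> W \<and> F = (\<lambda>\<rho>. tval \<delta> \<rho> t))"

lemma term_fun_var: "i \<in> W \<Longrightarrow> term_fun W (\<lambda>\<rho>. \<rho> i)"
  unfolding term_fun_def by (intro exI[of _ "TVar i"]) simp

lemma term_fun_const: "c \<in> K \<Longrightarrow> term_fun W (\<lambda>\<rho>. c)"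
  unfolding term_fun_def by (intro exI[of _ "TPar c"]) simp

lemma term_fun_add: "term_fun W F \<Longrightarrow> term_fun W G \<Longrightarrow> term_fun W (\<lambda>\<rho>. F \<rho> + G \<rho>)"
  unfolding term_fun_def
proof (elim exE conjE)
  fix s t assume "set2_dterm s \<subseteq> K" "tvars s \<subseteq> W" "F = (\<lambda>\<rho>. tval \<delta> \<rho> s)" "set2_dterm t \<subseteq> K" "tvars t \<subseteq> W" "G = (\<lambda>\<rho>. tval \<delta> \<rho> t)"
  then show "\<exists>t. set2_dterm t \<subseteq> K \<and> tvars t \<subseteq> W \<and> (\<lambda>\<rho>. F \<rho> + G \<rho>) = (\<lambda>\<rho>. tval \<delta> \<rho> t)"
    by (intro exI[of _ "TAdd s t"]) simp
qed

lemma term_fun_mult: "term_fun W F \<Longrightarrow> term_fun W G \<Longrightarrow> term_fun W (\<lambda>\<rho>. F \<rho> * G \<rho>)"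
  unfolding term_fun_def
proof (elim exE conjE)
  fix s t assume "set2_dterm s \<subseteq> K" "tvars s \<subseteq> W" "F = (\<lambda>\<rho>. tval \<delta> \<rho> s)" "set2_dterm t \<subseteq> K" "tvars t \<subseteq> W" "G = (\<lambda>\<rho>. tval \<delta> \<rho> t)"
  then show "\<exists>t. set2_dterm t \<subseteq> K \<and> tvars t \<subseteq> W \<and> (\<lambda>\<rho>. F \<rho> * G \<rho>) = (\<lambda>\<rho>. tval \<delta> \<rho> t)"
    by (intro exI[of _ "TMul s t"]) simp
qed

lemma term_fun_der: "term_fun W F \<Longrightarrow> term_fun W (\<lambda>\<rho>. \<delta> i (F \<rho>))"
  unfolding term_fun_def
proof (elim exE conjE)
  fix t assume "set2_dterm t \<subseteq> K" "tvars t \<subseteq> W" "F = (\<lambda>\<rho>. tval \<delta> \<rho> t)"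
  then show "\<exists>t. set2_dterm t \<subseteq> K \<and> tvars t \<subseteq> W \<and> (\<lambda>\<rho>. \<delta> i (F \<rho>)) = (\<lambda>\<rho>. tval \<delta> \<rho> t)"
    by (intro exI[of _ "TDer i t"]) simp
qed

lemma term_fun_diff:
  assumes "term_fun W F" "term_fun W G"
  shows "term_fun W (\<lambda>\<rho>. F \<rho> - G \<rho>)"
  using term_fun_add[OF assms(1) term_fun_mult[OF term_fun_const[OF ksubfield_minus[OF ksubfield ksubfield_one[OF ksubfield]]] assms(2)]]
  by simp

lemma term_fun_sum: "(\<And>a. a \<in> A \<Longrightarrow> term_fun W (F a)) \<Longrightarrow> term_fun W (\<lambda>\<rho>. \<Sum>a\<in>A. F a \<rho>)"
  by (induction A rule: infinite_finite_induct) (simp_all add: term_fun_add term_fun_const ksubfield_zero[OF ksubfield])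

lemma term_fun_deval:
  assumes f: "f \<in> dpolys K S" and \<sigma>: "\<And>v. v \<in> S \<Longrightarrow> term_fun W (\<lambda>\<rho>. \<sigma> \<rho> v)"
  shows "term_fun W (\<lambda>\<rho>. deval \<delta> (\<sigma> \<rho>) f)" (is "?P f")
proof (rule dpoly_induct[OF f derivations ksubfield_zero[OF ksubfield] ksubfield_one[OF ksubfield]])
  note m = ring_morphism_deval[of \<delta>]
  show "?P (f + g)" if "?P f" "?P g" for f g
    using term_fun_add[OF that] by (simp add: ring_morphism_add[OF m])
  show "?P (f * g)" if "?P f" "?P g" for f g
    using term_fun_mult[OF that] by (simp add: ring_morphism_mult[OF m])
qed (simp_all add: deval_pder[OF derivations] term_fun_der term_fun_const \<sigma>)

lemma term_fun_rename:
  assumes "term_fun W F" "\<And>i. i \<in> W \<Longrightarrow> \<pi> i \<in> W'"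
  shows "term_fun W' (\<lambda>\<rho>. F (\<lambda>i. \<rho> (\<pi> i)))"
proof -
  obtain t where t: "set2_dterm t \<subseteq> K" "tvars t \<subseteq> W" "F = (\<lambda>\<rho>. tval \<delta> \<rho> t)"
    using assms(1) unfolding term_fun_def by blast
  let ?t = "tsub (\<lambda>i. TVar (\<pi> i)) t"
  have "set2_dterm ?t \<subseteq> K"
    using params_tsub[of "\<lambda>i. TVar (\<pi> i)" t] t(1) by simp
  moreover have "tvars ?t \<subseteq> W'"
    using t(2) assms(2) by (auto simp: tvars_tsub)
  ultimately show ?thesis
    unfolding term_fun_def by (intro exI[of _ ?t]) (simp add: t(3) tval_tsub)
qed

text \<open>The condition \<open>u' 0 \<noteq> u 0\<close> becomes an equation by means of the extra variable \<open>N\<close>.\<close>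

lemma specialization_moving:
  assumes u: "u 0 \<notin> K" and N: "0 < N"
  obtains u' where "u' 0 \<noteq> u 0" "\<And>F. term_fun {..<N} F \<Longrightarrow> F u = 0 \<Longrightarrow> F u' = 0"
proof -
  define e :: "('m, 'a) dterm" where
    "e = TAdd (TMul (TVar N) (TAdd (TVar 0) (TNeg (TPar (u 0))))) (TNeg TOne)"
  have e: "tval \<delta> \<rho> e = \<rho> N * (\<rho> 0 - u 0) - 1" for \<rho>
    by (simp add: e_def)
  define T1 where "T1 = {t :: ('m, 'a) dterm. set2_dterm t \<subseteq> K \<and> tvars t \<subseteq> {..<N} \<and> tval \<delta> u t = 0}"
  have "\<exists>\<rho>. \<forall>t\<in>insert e T1. tval \<delta> \<rho> t = 0"
  \<comment> \<open>The inequation brings in the parameter \<open>u 0\<close> and the variable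
    \<open>N\<close>, hence the base set \<open>insert (u 0) K\<close> and the bound
    \<open>Suc N\<close>.\<close>
  proof (rule saturated_tuple[OF saturated, of "insert (u 0) K" _ "Suc N"])
    show "small (insert (u 0) K)"
      using small_Un[OF small_finite small, of "{u 0}"] by simp
    show "set2_dterm t \<subseteq> insert (u 0) K \<and> tvars t \<subseteq> {..<Suc N}" if "t \<in> insert e T1" for t
      using that by (auto simp: T1_def e_def)
    fix T0 assume T0: "finite T0" "T0 \<subseteq> insert e T1"
    have "\<exists>\<rho>. (\<forall>t\<in>T0 - {e}. tval \<delta> \<rho> t = 0) \<and> \<rho> 0 \<noteq> u 0"
    proof (rule finite_specialization_moving[where \<delta> = \<delta> and K = K and u = u and T = "T0 - {e}"])
      show "finite (T0 - {e})"
        using T0 by simp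
      show "set2_dterm t \<subseteq> K \<and> tval \<delta> u t = 0" if "t \<in> T0 - {e}" for t
        using that T0 by (auto simp: T1_def)
      show "\<exists>\<rho>. (\<forall>t\<in>T0 - {e}. tval \<delta> \<rho> t = 0) \<and> \<rho> 0 \<noteq> u 0"
        if "\<And>t. t \<in> T0 - {e} \<Longrightarrow> tval \<delta> \<rho> t = 0" "\<rho> 0 \<noteq> u 0" for \<rho>
        using that by blast
    qed (fact model ksubfield K_der u)+
    then obtain \<rho> where \<rho>: "\<And>t. t \<in> T0 - {e} \<Longrightarrow> tval \<delta> \<rho> t = 0" "\<rho> 0 \<noteq> u 0"
      by blast
    \<comment> \<open>As \<open>0 < N\<close>, filling the extra variable leaves variable 0 and all
      variables of the equations over \<open>K\<close> untouched.\<close>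
    let ?\<rho> = "\<rho>(N := inverse (\<rho> 0 - u 0))"
    have "tval \<delta> ?\<rho> t = 0" if t: "t \<in> T0" for t
    proof (cases "t = e")
      case True
      then show ?thesis
        using \<rho>(2) N by (simp add: e)
    next
      case False
      then have "tvars t \<subseteq> {..<N}"
        using t T0 by (auto simp: T1_def)
      then have "tval \<delta> ?\<rho> t = tval \<delta> \<rho> t"
        by (intro tval_cong) auto
      then show ?thesis
        using \<rho>(1) t False by simp
    qed
    then show "\<exists>\<rho>. \<forall>t\<in>T0. tval \<delta> \<rho> t = 0"
      by blast
  qed
  then obtain \<rho> where \<rho>: "tval \<delta> \<rho> e = 0" "\<And>t. t \<in> T1 \<Longrightarrow> tval \<delta> \<rho> t = 0"
    by auto
  show thesis
  proof (rule that[of \<rho>])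
    show "\<rho> 0 \<noteq> u 0"
      using \<rho>(1) by (auto simp: e)
    show "F \<rho> = 0" if "term_fun {..<N} F" "F u = 0" for F
      using that \<rho>(2) unfolding term_fun_def T1_def by blast
  qed
qed

end

section \<open>Dual systems of point evaluations, and projections of finite rank\<close>

definition eval_combs :: "'b set \<Rightarrow> (('b \<Rightarrow> 'a::field) \<Rightarrow> 'a) set" where
  "eval_combs B = {\<l>. \<exists>xs. snd ` set xs \<subseteq> B \<and> \<l> = (\<lambda>h. \<Sum>(c, b)\<leftarrow>xs. c * h b)}"

lemma eval_combs_point: "b \<in> B \<Longrightarrow> (\<lambda>h. h b) \<in> eval_combs B"
  unfolding eval_combs_def by (intro CollectI exI[of _ "[(1, b)]"]) simp

lemma eval_combs_zero: "(\<lambda>h. 0) \<in> eval_combs B"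
  unfolding eval_combs_def by (intro CollectI exI[of _ "[]"]) simp

lemma eval_combs_add:
  assumes "f \<in> eval_combs B" "g \<in> eval_combs B"
  shows "(\<lambda>h. f h + g h) \<in> eval_combs B"
proof -
  obtain xs ys where "snd ` set xs \<subseteq> B" "f = (\<lambda>h. \<Sum>(c, b)\<leftarrow>xs. c * h b)"
      "snd ` set ys \<subseteq> B" "g = (\<lambda>h. \<Sum>(c, b)\<leftarrow>ys. c * h b)"
    using assms unfolding eval_combs_def by blast
  then show ?thesis
    unfolding eval_combs_def by (intro CollectI exI[of _ "xs @ ys"]) auto
qed

lemma eval_combs_scale:
  assumes "f \<in> eval_combs B"
  shows "(\<lambda>h. a * f h) \<in> eval_combs B"
proof -
  obtain xs where xs: "snd ` set xs \<subseteq> B" "f = (\<lambda>h. \<Sum>(c, b)\<leftarrow>xs. c * h b)"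
    using assms unfolding eval_combs_def by blast
  have "(\<Sum>(c, b)\<leftarrow>map (\<lambda>(c, b). (a * c, b)) xs. c * h b) = a * (\<Sum>(c, b)\<leftarrow>xs. c * h b)" for h
    by (induction xs) (auto simp: algebra_simps)
  then show ?thesis
    unfolding eval_combs_def using xs
    by (intro CollectI exI[of _ "map (\<lambda>(c, b). (a * c, b)) xs"]) (auto simp: image_image case_prod_beta)
qed

lemma eval_combs_sum: "(\<And>i. i \<in> A \<Longrightarrow> f i \<in> eval_combs B) \<Longrightarrow> (\<lambda>h. \<Sum>i\<in>A. f i h) \<in> eval_combs B"
  by (induction A rule: infinite_finite_induct) (simp_all add: eval_combs_zero eval_combs_add)

lemma eval_combs_linear:
  assumes "f \<in> eval_combs B"
  shows "f (\<lambda>b. \<Sum>i\<in>A. c i * e i b) = (\<Sum>i\<in>A. c i * f (e i))"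
proof -
  obtain xs where xs: "f = (\<lambda>h. \<Sum>(c, b)\<leftarrow>xs. c * h b)"
    using assms unfolding eval_combs_def by blast
  show ?thesis
    unfolding xs by (induction xs) (auto simp: algebra_simps sum.distrib sum_distrib_left)
qed

lemma eval_combs_cong:
  assumes "f \<in> eval_combs B" "\<And>b. b \<in> B \<Longrightarrow> g b = h b"
  shows "f g = f h"
proof -
  obtain xs where xs: "snd ` set xs \<subseteq> B" "f = (\<lambda>h. \<Sum>(c, b)\<leftarrow>xs. c * h b)"
    using assms unfolding eval_combs_def by blast
  have "map (\<lambda>(c, b). c * g b) xs = map (\<lambda>(c, b). c * h b) xs"
    using xs(1) assms(2) by (intro map_cong) auto
  then show ?thesis
    unfolding xs(2) by (rule arg_cong)
qed

text \<open>Gaussian elimination: the functions indexed by \<open>I\<close> form a basis of the span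
  of all \<open>e r\<close> restricted to \<open>B\<close>, and the functionals
  \<open>\<l> i\<close> are dual to it. That each \<open>\<l> i\<close> is a finite combination of
  evaluations matters later, when its points and weights are specialized.\<close>

lemma dual_evaluations:
  fixes e :: "'i \<Rightarrow> 'b \<Rightarrow> 'a::field"
  assumes "finite T"
  shows "\<exists>I \<l>. I \<subseteq> T \<and> (\<forall>i\<in>I. \<l> i \<in> eval_combs B) \<and> (\<forall>i\<in>I. \<forall>k\<in>I. \<l> i (e k) = (if i = k then 1 else 0)) \<and>
    (\<forall>r\<in>T. \<forall>b\<in>B. e r b = (\<Sum>i\<in>I. \<l> i (e r) * e i b))"
  using assms
proof induction
  case empty
  then show ?case
    by simp
next
  case (insert r T)
  from insert.IH obtain I and \<l> :: "'i \<Rightarrow> ('b \<Rightarrow> 'a) \<Rightarrow> 'a" where H: "I \<subseteq> T" "\<forall>i\<in>I. \<l> i \<in> eval_combs B"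
    "\<forall>i\<in>I. \<forall>k\<in>I. \<l> i (e k) = (if i = k then 1 else 0)"
    "\<forall>r\<in>T. \<forall>b\<in>B. e r b = (\<Sum>i\<in>I. \<l> i (e r) * e i b)"
    by (elim exE conjE)
  note I = H(1) and comb = H(2)[rule_format] and dual = H(3)[rule_format] and span = H(4)[rule_format]
  have fI: "finite I"
    using I insert by (meson finite_subset)
  show ?case
  proof (cases "\<forall>b\<in>B. e r b = (\<Sum>i\<in>I. \<l> i (e r) * e i b)")
    case True
    then have "\<forall>s\<in>insert r T. \<forall>b\<in>B. e s b = (\<Sum>i\<in>I. \<l> i (e s) * e i b)"
      using H(4) by (simp only: ball_simps simp_thms)
    then show ?thesis
      using subset_insertI2[OF I] H(2,3) by (intro exI[of _ I] exI[of _ \<l>] conjI)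
  next
    case False
    then obtain b0 where b0: "b0 \<in> B" "e r b0 \<noteq> (\<Sum>i\<in>I. \<l> i (e r) * e i b0)"
      by blast
    define d where "d = e r b0 - (\<Sum>i\<in>I. \<l> i (e r) * e i b0)"
    have d: "d \<noteq> 0"
      using b0 by (simp add: d_def)
    have rI: "r \<notin> I"
      using I insert by blast
    \<comment> \<open>Evaluation of the defect at \<open>b0\<close>, where \<open>e r\<close> leaves
      the old span, normalized by \<open>d\<close>: \<open>m\<close> vanishes on the old functions
      and is 1 at \<open>e r\<close>.\<close>
    define m where "m = (\<lambda>h. inverse d * (h b0 + (- 1) * (\<Sum>i\<in>I. e i b0 * \<l> i h)))"
    have m_comb: "m \<in> eval_combs B"
      unfolding m_def
      by (intro eval_combs_scale eval_combs_add eval_combs_sum eval_combs_point b0 comb)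
    have m_r: "m (e r) = 1"
      using d by (simp add: m_def d_def mult.commute)
    have m_T: "m (e s) = 0" if "s \<in> T" for s
      using span[OF that b0(1)] by (simp add: m_def mult.commute)
    \<comment> \<open>The old functionals are corrected by a multiple of \<open>m\<close> so as to
      vanish at \<open>e r\<close>; their values on the old functions do not change.\<close>
    define \<l>' where "\<l>' = (\<lambda>i h. if i = r then m h else \<l> i h + (- \<l> i (e r)) * m h)"
    have comb': "\<l>' i \<in> eval_combs B" if "i \<in> insert r I" for i
    proof (cases "i = r")
      case True
      then show ?thesis
        using m_comb by (simp add: \<l>'_def)
    next
      case False
      then have "(\<lambda>h. \<l> i h + (- \<l> i (e r)) * m h) \<in> eval_combs B"
        using that by (intro eval_combs_add eval_combs_scale comb m_comb) auto
      then show ?thesis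
        using False by (simp add: \<l>'_def)
    qed
    have l_T: "\<l>' i (e s) = \<l> i (e s)" if "i \<in> I" "s \<in> T" for i s
      using that rI m_T by (auto simp: \<l>'_def)
    have l_r: "\<l>' i (e r) = 0" if "i \<in> I" for i
      using that rI m_r by (auto simp: \<l>'_def)
    have r_T: "\<l>' r (e s) = 0" if "s \<in> T" for s
      using that m_T by (simp add: \<l>'_def)
    have r_r: "\<l>' r (e r) = 1"
      using m_r by (simp add: \<l>'_def)
    have dual': "\<l>' i (e k) = (if i = k then 1 else 0)" if "i \<in> insert r I" "k \<in> insert r I" for i k
      using that I rI by (auto simp: l_T l_r r_T r_r dual subset_iff)
    have span': "e s b = (\<Sum>i\<in>insert r I. \<l>' i (e s) * e i b)" if "s \<in> insert r T" "b \<in> B" for s b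
    proof (cases "s = r")
      case True
      then show ?thesis
        using fI rI by (simp add: l_r r_r)
    next
      case False
      then have "s \<in> T"
        using that by simp
      then show ?thesis
        using fI rI span[of s b] that(2) by (simp add: l_T r_T)
    qed
    show ?thesis
      by (intro exI[of _ "insert r I"] exI[of _ \<l>'] conjI ballI comb' dual' span' insert_mono I)
  qed
qed

text \<open>The map \<open>x \<mapsto> \<Sum> c * \<mu> x\<close> is a \<open>K\<close>-linear
  projection of finite rank that fixes \<open>C\<close>. The clause that it fixes the vectors
  \<open>c\<close> as well makes it idempotent, which the induction needs.\<close>

lemma finite_rank_projection:
  assumes K: "ksubfield K" and "finite C"
  shows "\<exists>xs. (\<forall>(c, \<mu>)\<in>set xs. klinear K \<mu> \<and> range \<mu> \<subseteq> K) \<and>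
    (\<forall>x \<in> C \<union> fst ` set xs. (\<Sum>(c, \<mu>)\<leftarrow>xs. c * \<mu> x) = x)"
  using assms(2)
proof induction
  case empty
  then show ?case
    by (intro exI[of _ "[]"]) simp
next
  case (insert y C)
  from insert.IH obtain xs where H: "\<forall>(c, \<mu>)\<in>set xs. klinear K \<mu> \<and> range \<mu> \<subseteq> K"
    "\<forall>x \<in> C \<union> fst ` set xs. (\<Sum>(c, \<mu>)\<leftarrow>xs. c * \<mu> x) = x"
    by (elim exE conjE)
  note fixed = H(2)[rule_format]
  have xs: "klinear K \<mu> \<and> range \<mu> \<subseteq> K" if "(c, \<mu>) \<in> set xs" for c \<mu>
    using bspec[OF H(1) that] by simp
  define P where "P = (\<lambda>x. \<Sum>(c, \<mu>)\<leftarrow>xs. c * \<mu> x)"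
  have P: "klinear K P"
    unfolding P_def using xs
  proof (induction xs)
    case (Cons p xs)
    obtain c \<mu> where p: "p = (c, \<mu>)"
      by (cases p)
    then have "klinear K \<mu>" "klinear K (\<lambda>x. \<Sum>(c, \<mu>)\<leftarrow>xs. c * \<mu> x)"
      using Cons by auto
    then show ?case
      by (auto simp: p klinear_def algebra_simps)
  qed (simp add: klinear_def)
  have PP: "P (P x) = P x" for x
  proof -
    have "P (\<Sum>(c, \<mu>)\<leftarrow>ys. c * \<mu> x) = (\<Sum>(c, \<mu>)\<leftarrow>ys. c * \<mu> x)" if "set ys \<subseteq> set xs" for ys
      using that
    proof (induction ys)
      case (Cons p ys)
      obtain c \<mu> where p: "p = (c, \<mu>)"
        by (cases p)
      have cx: "(c, \<mu>) \<in> set xs"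
        using Cons.prems p by auto
      then have "P c = c"
        using fixed[of c] by (force simp: P_def)
      moreover have "\<mu> x \<in> K"
        using xs[OF cx] by auto
      ultimately have "P (c * \<mu> x) = c * \<mu> x"
        using klinear_scale[OF P, of "\<mu> x" c] by (simp add: mult.commute)
      then show ?case
        using Cons by (simp add: p klinear_add[OF P])
    qed (simp add: klinear_zero[OF P])
    then show ?thesis
      unfolding P_def[THEN fun_cong, of x] by blast
  qed
  show ?case
  proof (cases "P y = y")
    case True
    then show ?thesis
      using H by (intro exI[of _ xs]) (simp add: P_def)
  next
    case False
    \<comment> \<open>The part of \<open>y\<close> missed by the projection \<open>P\<close>: it is
      killed by \<open>P\<close> and lies outside the fixed space, so a functional
      \<open>\<nu>\<close> vanishing there can be 1 at \<open>r\<close>, and the pair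
      \<open>(r, \<nu>)\<close> extends \<open>P\<close>.\<close>
    define r where "r = y - P y"
    define W where "W = {w. P w = w}"
    have "ksubspace K W"
      by (simp add: ksubspace_def W_def klinear_zero[OF P] klinear_add[OF P] klinear_scale[OF P])
    moreover have "P r = 0"
      by (simp add: r_def klinear_diff[OF P] PP)
    then have "r \<notin> W"
      using False by (simp add: W_def r_def)
    ultimately obtain \<nu> where \<nu>: "klinear K \<nu>" "range \<nu> \<subseteq> K" "\<And>w. w \<in> W \<Longrightarrow> \<nu> w = 0" "\<nu> r = 1"
      using functional_exists[OF K] by metis
    have \<nu>P: "\<nu> (P x) = 0" for x
      using \<nu>(3) PP by (simp add: W_def)
    have "\<nu> y = 1"
      using \<nu>(4) \<nu>P[of y] by (simp add: r_def klinear_diff[OF \<nu>(1)])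
    then have y: "r * \<nu> y + P y = y"
      by (simp add: r_def)
    have old: "r * \<nu> x + P x = x" if "x \<in> C \<union> fst ` set xs" for x
      using fixed[OF that] \<nu>(3)[of x] by (simp add: W_def P_def)
    have new: "r * \<nu> r + P r = r"
      using \<nu>(4) \<open>P r = 0\<close> by simp
    have "r * \<nu> x + P x = x" if "x \<in> insert y C \<union> fst ` set ((r, \<nu>) # xs)" for x
      using that y old new by auto
    moreover have "(\<Sum>(c, \<mu>)\<leftarrow>(r, \<nu>) # xs. c * \<mu> x) = r * \<nu> x + P x" for x
      by (simp add: P_def)
    ultimately show ?thesis
      using H(1) \<nu>(1,2) by (intro exI[of _ "(r, \<nu>) # xs"] conjI) simp_all
  qed
qed

text \<open>A finite rank projection fixing all \<open>c r\<close> rewrites the sum as a combination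
  of the sums with \<open>\<mu> (c r)\<close> in place of \<open>c r\<close>, so these cannot all
  vanish.\<close>

lemma functional_detects:
  assumes K: "ksubfield K" and T: "finite T" and ne: "(\<Sum>r\<in>T. c r * z r) \<noteq> 0"
  obtains \<mu> where "klinear K \<mu>" "range \<mu> \<subseteq> K" "(\<Sum>r\<in>T. \<mu> (c r) * z r) \<noteq> 0"
proof -
  note witness = that
  from finite_rank_projection[OF K finite_imageI[OF T, of c]]
  obtain xs where xs: "\<forall>(c, \<mu>)\<in>set xs. klinear K \<mu> \<and> range \<mu> \<subseteq> K"
    and H: "\<forall>x \<in> c ` T \<union> fst ` set xs. (\<Sum>(d, \<mu>)\<leftarrow>xs. d * \<mu> x) = x"
    by (elim exE conjE)
  have fixed: "(\<Sum>(d, \<mu>)\<leftarrow>xs. d * \<mu> (c r)) = c r" if "r \<in> T" for r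
    using that by (intro H[rule_format]) simp
  have "(\<Sum>(d, \<mu>)\<leftarrow>xs. d * (\<Sum>r\<in>T. \<mu> (c r) * z r)) = (\<Sum>r\<in>T. (\<Sum>(d, \<mu>)\<leftarrow>xs. d * \<mu> (c r)) * z r)"
    by (induction xs) (auto simp: sum.distrib sum_distrib_left algebra_simps)
  also have "\<dots> = (\<Sum>r\<in>T. c r * z r)"
    by (intro sum.cong refl) (simp only: fixed)
  finally have ne': "(\<Sum>(d, \<mu>)\<leftarrow>xs. d * (\<Sum>r\<in>T. \<mu> (c r) * z r)) \<noteq> 0"
    using ne by simp
  show thesis
  proof (rule ccontr)
    assume neg: "\<not> thesis"
    have "(\<Sum>r\<in>T. \<mu> (c r) * z r) = 0" if "(d, \<mu>) \<in> set xs" for d \<mu>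
      using neg witness[of \<mu>] bspec[OF xs that] by auto
    then have "map (\<lambda>(d, \<mu>). d * (\<Sum>r\<in>T. \<mu> (c r) * z r)) xs = map (\<lambda>_. 0) xs"
      by (intro map_cong) auto
    from arg_cong[OF this, of sum_list] show False
      using ne' by (simp only: sum_list_0)
  qed
qed

section \<open>Descent of linear relations to the subfield\<close>

context universal_subfield
begin

text \<open>Zero sets of equations over \<open>K\<close> have this property, and so do arbitrary
  unions of them, such as those coming from the choice of a nonzero coordinate.\<close>

definition specialization_closed :: "nat \<Rightarrow> (nat \<Rightarrow> 'a) set \<Rightarrow> bool" where
  "specialization_closed N B \<longleftrightarrow>
     (\<forall>b\<in>B. \<forall>b'. (\<forall>F. term_fun {..<N} F \<longrightarrow> F b = 0 \<longrightarrow> F b' = 0) \<longrightarrow> b' \<in> B)"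

text \<open>The coefficient \<open>G r i\<close> is a combination of values of \<open>e r\<close> at points of \<open>B\<close>, with weights determined
  by duality. Every specialization of these points and weights yields the same value, which
  therefore cannot be moved and lies in \<open>K\<close>.\<close>

lemma descent:
  fixes e :: "'i \<Rightarrow> (nat \<Rightarrow> 'a) \<Rightarrow> 'a"
  assumes T: "finite T" and e: "\<forall>r\<in>T. term_fun {..<N} (e r)" and B: "specialization_closed N B"
  shows "\<exists>I G. I \<subseteq> T \<and> (\<forall>r\<in>T. \<forall>i\<in>I. G r i \<in> K) \<and> (\<forall>r\<in>T. \<forall>b\<in>B. e r b = (\<Sum>i\<in>I. G r i * e i b)) \<and>
    (\<forall>c. (\<forall>b\<in>B. (\<Sum>i\<in>I. c i * e i b) = 0) \<longrightarrow> (\<forall>i\<in>I. c i = 0))"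
proof -
  from dual_evaluations[OF T, of B e] obtain I \<l> where H: "I \<subseteq> T" "\<forall>i\<in>I. \<l> i \<in> eval_combs B"
    "\<forall>i\<in>I. \<forall>k\<in>I. \<l> i (e k) = (if i = k then 1 else 0)"
    "\<forall>r\<in>T. \<forall>b\<in>B. e r b = (\<Sum>i\<in>I. \<l> i (e r) * e i b)"
    by (elim exE conjE)
  note I = H(1) and comb = H(2)[rule_format] and dual = H(3)[rule_format] and span = H(4)[rule_format]
  have fI: "finite I"
    using I T by (rule finite_subset)
  have in_K: "\<l> i (e r) \<in> K" if i: "i \<in> I" and r: "r \<in> T" for i r
  proof (rule ccontr)
    assume notK: "\<l> i (e r) \<notin> K"
    obtain xs where xs: "snd ` set xs \<subseteq> B" "\<l> i = (\<lambda>h. \<Sum>(c, b)\<leftarrow>xs. c * h b)"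
      using comb[OF i] unfolding eval_combs_def by blast
    let ?s = "length xs"
    have li: "\<l> i h = (\<Sum>j<?s. fst (xs ! j) * h (snd (xs ! j)))" for h
      unfolding xs(2) by (simp add: sum_list_sum_nth case_prod_beta atLeast0LessThan)
    \<comment> \<open>Layout of the tuple to be specialized: slot 0 holds the suspected coefficient,
      \<open>pos j 0\<close> the weight and \<open>pos j (Suc l)\<close> the coordinate
      \<open>l\<close> of the point number \<open>j\<close>. The outer \<open>Suc\<close> keeps slot
      0 free.\<close>
    define pos where "pos = (\<lambda>j i. Suc (prod_encode (j, i)))"
    obtain N' where N': "\<And>j i. j < ?s \<Longrightarrow> i \<le> N \<Longrightarrow> pos j i < N'"
    proof -
      have "finite ((\<lambda>(j, i). pos j i) ` ({..<?s} \<times> {..N}))"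
        by simp
      then obtain m where "\<forall>n\<in>(\<lambda>(j, i). pos j i) ` ({..<?s} \<times> {..N}). n < m"
        unfolding finite_nat_set_iff_bounded by blast
      then show thesis
        by (intro that[of m]) auto
    qed
    define u where "u = (\<lambda>n. case n of 0 \<Rightarrow> \<l> i (e r) | Suc m \<Rightarrow>
        (case prod_decode m of (j, k) \<Rightarrow> (case k of 0 \<Rightarrow> fst (xs ! j) | Suc l \<Rightarrow> snd (xs ! j) l)))"
    have u0: "u 0 = \<l> i (e r)" and uc: "\<And>j. u (pos j 0) = fst (xs ! j)" and ub: "\<And>j l. u (pos j (Suc l)) = snd (xs ! j) l"
      by (simp_all add: u_def pos_def)
    define pt where "pt = (\<lambda>\<rho> :: nat \<Rightarrow> 'a. \<lambda>j l. \<rho> (pos j (Suc l)))"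
    have pt_u: "pt u j = snd (xs ! j)" for j
      by (rule ext) (simp add: pt_def ub)
    obtain u' where u': "u' 0 \<noteq> u 0" "\<And>F. term_fun {..<Suc N'} F \<Longrightarrow> F u = 0 \<Longrightarrow> F u' = 0"
      using specialization_moving[of u "Suc N'"] notK u0 by auto
    have pt_term_fun: "term_fun {..<Suc N'} (\<lambda>\<rho>. F (pt \<rho> j))" if "term_fun {..<N} F" "j < ?s" for F j
      unfolding pt_def by (rule term_fun_rename[OF that(1)]) (use N'[OF that(2)] in \<open>simp add: less_Suc_eq\<close>)
    have c_term_fun: "term_fun {..<Suc N'} (\<lambda>\<rho>. \<rho> (pos j 0))" if "j < ?s" for j
      using N'[OF that, of 0] by (intro term_fun_var) simp
    have ptB: "pt u' j \<in> B" if j: "j < ?s" for j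
    proof -
      have "pt u j \<in> B"
        unfolding pt_u using xs(1) j by auto
      moreover have "F (pt u' j) = 0" if "term_fun {..<N} F" "F (pt u j) = 0" for F
        using u'(2)[OF pt_term_fun[OF that(1) j]] that(2) by simp
      ultimately show ?thesis
        using B unfolding specialization_closed_def by blast
    qed
    have sum_term_fun: "term_fun {..<Suc N'} (\<lambda>\<rho>. \<Sum>j<?s. \<rho> (pos j 0) * e k (pt \<rho> j))" if "k \<in> T" for k
      by (intro term_fun_sum term_fun_mult c_term_fun pt_term_fun e[rule_format] that) simp_all
    have dual': "(\<Sum>j<?s. u' (pos j 0) * e k (pt u' j)) = (if i = k then 1 else 0)" if k: "k \<in> I" for k
    proof -
      have kT: "k \<in> T"
        using k I by blast
      have "term_fun {..<Suc N'} (\<lambda>\<rho>. (\<Sum>j<?s. \<rho> (pos j 0) * e k (pt \<rho> j)) - (if i = k then 1 else 0))"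
        by (intro term_fun_diff sum_term_fun term_fun_const kT) (simp add: ksubfield_zero[OF ksubfield] ksubfield_one[OF ksubfield])
      from u'(2)[OF this] show ?thesis
        using dual[OF i k] by (simp add: uc pt_u li)
    qed
    have "term_fun {..<Suc N'} (\<lambda>\<rho>. \<rho> 0 - (\<Sum>j<?s. \<rho> (pos j 0) * e r (pt \<rho> j)))"
      by (intro term_fun_diff sum_term_fun term_fun_var r) simp
    from u'(2)[OF this] have "u' 0 = (\<Sum>j<?s. u' (pos j 0) * e r (pt u' j))"
      by (simp add: uc pt_u u0 li)
    \<comment> \<open>The specialized points are still in \<open>B\<close>, so the expansion with
      the original coefficients holds there, and the specialized duality relations pick out
      \<open>\<l> i (e r)\<close>. Slot 0 has not moved after all.\<close>
    also have "\<dots> = (\<Sum>j<?s. u' (pos j 0) * (\<Sum>k\<in>I. \<l> k (e r) * e k (pt u' j)))"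
      using span[OF r ptB] by (intro sum.cong refl) simp
    also have "\<dots> = (\<Sum>k\<in>I. \<l> k (e r) * (\<Sum>j<?s. u' (pos j 0) * e k (pt u' j)))"
      unfolding sum_distrib_left by (subst sum.swap) (simp add: algebra_simps)
    also have "\<dots> = (\<Sum>k\<in>I. if i = k then \<l> k (e r) else 0)"
      using dual' by (intro sum.cong refl) simp
    also have "\<dots> = \<l> i (e r)"
      using i fI by simp
    finally show False
      using u'(1) u0 by simp
  qed
  have indep: "c i = 0" if i: "i \<in> I" and z: "\<forall>b\<in>B. (\<Sum>k\<in>I. c k * e k b) = 0" for c i
  proof -
    have "\<l> i (\<lambda>b. \<Sum>k\<in>I. c k * e k b) = \<l> i (\<lambda>b. \<Sum>k\<in>({}::'i set). c k * e k b)"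
      using z by (intro eval_combs_cong[OF comb[OF i]]) simp
    then have "(\<Sum>k\<in>I. c k * \<l> i (e k)) = 0"
      unfolding eval_combs_linear[OF comb[OF i]] by simp
    moreover have "(\<Sum>k\<in>I. c k * \<l> i (e k)) = (\<Sum>k\<in>I. if i = k then c k else 0)"
      using dual[OF i] by (intro sum.cong refl) simp
    ultimately show ?thesis
      using i fI by simp
  qed
  show ?thesis
  proof (rule exI[of _ I], rule exI[of _ "\<lambda>r i. \<l> i (e r)"], intro conjI)
    show "\<forall>r\<in>T. \<forall>i\<in>I. \<l> i (e r) \<in> K"
      using in_K by blast
    show "\<forall>c. (\<forall>b\<in>B. (\<Sum>i\<in>I. c i * e i b) = 0) \<longrightarrow> (\<forall>i\<in>I. c i = 0)"
      using indep by blast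
  qed (fact I H(4))+
qed

text \<open>All \<open>e r\<close> are combinations over \<open>K\<close> of the independent
  functions indexed by \<open>I\<close>, so a relation amounts to equations in the
  \<open>c r\<close> with coefficients in \<open>K\<close>, and these survive \<open>\<mu>\<close>.
  The first form descends equations of a closed set; the second splits polynomials for
  irreducibility.\<close>

lemma descent_linear:
  fixes e :: "'i \<Rightarrow> (nat \<Rightarrow> 'a) \<Rightarrow> 'a"
  assumes T: "finite T" and e: "\<And>r. r \<in> T \<Longrightarrow> term_fun {..<N} (e r)" and B: "specialization_closed N B"
    and zero: "\<And>b. b \<in> B \<Longrightarrow> (\<Sum>r\<in>T. c r * e r b) = 0" and \<mu>: "klinear K \<mu>" and b: "b \<in> B"
  shows "(\<Sum>r\<in>T. \<mu> (c r) * e r b) = 0" "(\<Sum>r\<in>T. c r * \<mu> (e r b)) = 0"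
proof -
  have "\<forall>r\<in>T. term_fun {..<N} (e r)"
    using e by blast
  from descent[OF T this B] obtain I G where H: "I \<subseteq> T" "\<forall>r\<in>T. \<forall>i\<in>I. G r i \<in> K"
    "\<forall>r\<in>T. \<forall>b\<in>B. e r b = (\<Sum>i\<in>I. G r i * e i b)"
    "\<forall>c. (\<forall>b\<in>B. (\<Sum>i\<in>I. c i * e i b) = 0) \<longrightarrow> (\<forall>i\<in>I. c i = 0)"
    by (elim exE conjE)
  note G = H(2)[rule_format] and span = H(3)[rule_format]
  have expand: "(\<Sum>r\<in>T. d r * e r b) = (\<Sum>i\<in>I. (\<Sum>r\<in>T. d r * G r i) * e i b)" if "b \<in> B" for d b
  proof -
    have "(\<Sum>r\<in>T. d r * e r b) = (\<Sum>r\<in>T. d r * (\<Sum>i\<in>I. G r i * e i b))"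
      using span that by (intro sum.cong refl) simp
    also have "\<dots> = (\<Sum>i\<in>I. (\<Sum>r\<in>T. d r * G r i) * e i b)"
      unfolding sum_distrib_left sum_distrib_right by (subst sum.swap) (simp add: algebra_simps)
    finally show ?thesis .
  qed
  have cG: "(\<Sum>r\<in>T. c r * G r i) = 0" if "i \<in> I" for i
  proof -
    have "\<forall>b\<in>B. (\<Sum>k\<in>I. (\<Sum>r\<in>T. c r * G r k) * e k b) = 0"
    proof
      fix b assume "b \<in> B"
      then show "(\<Sum>k\<in>I. (\<Sum>r\<in>T. c r * G r k) * e k b) = 0"
        using zero[of b] expand[of b c] by simp
    qed
    from mp[OF spec[OF H(4)] this] that show ?thesis
      by (rule bspec)
  qed
  have \<mu>G: "(\<Sum>r\<in>T. \<mu> (c r) * G r i) = 0" if i: "i \<in> I" for i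
  proof -
    have "(\<Sum>r\<in>T. \<mu> (c r) * G r i) = (\<Sum>r\<in>T. \<mu> (c r * G r i))"
      using klinear_scale[OF \<mu> G[OF _ i]] by (intro sum.cong refl) (simp add: mult.commute)
    then show ?thesis
      using cG[OF i] by (simp add: klinear_zero[OF \<mu>] flip: klinear_sum[OF \<mu>])
  qed
  show "(\<Sum>r\<in>T. \<mu> (c r) * e r b) = 0"
    unfolding expand[OF b] using \<mu>G by simp
  have "(\<Sum>r\<in>T. c r * \<mu> (e r b)) = (\<Sum>r\<in>T. c r * (\<Sum>i\<in>I. G r i * \<mu> (e i b)))"
  proof (intro sum.cong refl)
    fix r assume r: "r \<in> T"
    show "c r * \<mu> (e r b) = c r * (\<Sum>i\<in>I. G r i * \<mu> (e i b))"
      using G[OF r] by (simp add: span[OF r b] klinear_sum[OF \<mu>] klinear_scale[OF \<mu>])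
  qed
  also have "\<dots> = (\<Sum>i\<in>I. (\<Sum>r\<in>T. c r * G r i) * \<mu> (e i b))"
    unfolding sum_distrib_left sum_distrib_right by (subst sum.swap) (simp add: algebra_simps)
  also have "\<dots> = 0"
    using cG by simp
  finally show "(\<Sum>r\<in>T. c r * \<mu> (e r b)) = 0" .
qed

end

section \<open>Points of projective space and homogeneous polynomials\<close>

definition proj_point :: "(nat \<Rightarrow> 'a::field) \<Rightarrow> (nat \<Rightarrow> 'a) set" where
  "proj_point a = {\<lambda>i. c * a i |c. c \<noteq> 0}"

lemma proj_point_self: "a \<in> proj_point a"
  unfolding proj_point_def by (intro CollectI exI[of _ 1]) simp

lemma proj_space_eq: "proj_space n = proj_point ` (affine_space n - {\<lambda>_. 0})"
proof -
  have "proj_rel n `` {a} = proj_point a" if a: "a \<in> affine_space n - {\<lambda>_. 0}" for a :: "nat \<Rightarrow> 'a"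
  proof -
    have "(\<lambda>i. c * a i) \<in> affine_space n - {\<lambda>_. 0}" if "c \<noteq> 0" for c
      using a that by (auto simp: affine_space_def fun_eq_iff)
    then show ?thesis
      using a by (auto simp: proj_rel_def proj_point_def)
  qed
  then show ?thesis
    by (auto simp: proj_space_def quotient_def)
qed

lemma proj_point_in_proj_space: "a \<in> affine_space n \<Longrightarrow> a \<noteq> (\<lambda>_. 0) \<Longrightarrow> proj_point a \<in> proj_space n"
  by (simp add: proj_space_eq)

lemma proj_space_cases:
  assumes "p \<in> proj_space n"
  obtains a where "a \<in> affine_space n" "a \<noteq> (\<lambda>_. 0)" "p = proj_point a"
  using assms by (auto simp: proj_space_eq)

lemma proj_point_eq:
  assumes "b \<in> proj_point a"
  shows "proj_point b = proj_point a"
proof -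
  obtain c where c: "c \<noteq> 0" "b = (\<lambda>i. c * a i)"
    using assms by (auto simp: proj_point_def)
  have "\<exists>e. (\<lambda>i. d * (c * a i)) = (\<lambda>i. e * a i) \<and> e \<noteq> 0" if "d \<noteq> 0" for d
    using that c by (intro exI[of _ "d * c"]) (simp add: mult.assoc)
  moreover have "\<exists>e. (\<lambda>i. d * a i) = (\<lambda>i. e * (c * a i)) \<and> e \<noteq> 0" if "d \<noteq> 0" for d
    using that c by (intro exI[of _ "d / c"]) simp
  ultimately show ?thesis
    unfolding proj_point_def c(2) by blast
qed

lemma affine_nonzero_coord:
  assumes "a \<in> affine_space n" "a \<noteq> (\<lambda>_. 0)"
  obtains k where "k \<le> n" "a k \<noteq> 0"
proof -
  obtain k where "a k \<noteq> 0"
    using assms(2) by auto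
  moreover from this have "k \<le> n"
    using assms(1) by (auto simp: affine_space_def intro: ccontr)
  ultimately show thesis
    using that by blast
qed

text \<open>Changing representatives multiplies the bilinear sum by a nonzero factor, so one fixed
  representative of each point decides.\<close>

lemma lin_dependent_ppt:
  assumes V: "V \<subseteq> proj_space n"
  shows "proj_point a \<in> ld n V \<longleftrightarrow> proj_point a \<in> proj_space n \<and>
    (\<exists>v. v \<in> affine_space n \<and> v \<noteq> (\<lambda>_. 0) \<and> proj_point v \<in> V \<and> (\<Sum>i=0..n. v i * a i) = 0)"
proof
  assume "proj_point a \<in> ld n V"
  then obtain b p w where b: "proj_point a \<in> proj_space n" "b \<in> proj_point a" and p: "p \<in> V" "w \<in> p" "(\<Sum>i=0..n. w i * b i) = 0"
    by (auto simp: ld_def lin_dependent_def)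
  obtain v where v: "v \<in> affine_space n" "v \<noteq> (\<lambda>_. 0)" "p = proj_point v"
    using p(1) V proj_space_cases by blast
  obtain c d where c: "c \<noteq> 0" "b = (\<lambda>i. c * a i)" "d \<noteq> 0" "w = (\<lambda>i. d * v i)"
    using b(2) p(2) v(3) by (auto simp: proj_point_def)
  have "(\<Sum>i=0..n. w i * b i) = d * c * (\<Sum>i=0..n. v i * a i)"
    unfolding c sum_distrib_left by (simp add: algebra_simps)
  then have "(\<Sum>i=0..n. v i * a i) = 0"
    using p(3) c by simp
  then show "proj_point a \<in> proj_space n \<and>
    (\<exists>v. v \<in> affine_space n \<and> v \<noteq> (\<lambda>_. 0) \<and> proj_point v \<in> V \<and> (\<Sum>i=0..n. v i * a i) = 0)"
    using b(1) v p(1) by blast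
next
  assume *: "proj_point a \<in> proj_space n \<and>
    (\<exists>v. v \<in> affine_space n \<and> v \<noteq> (\<lambda>_. 0) \<and> proj_point v \<in> V \<and> (\<Sum>i=0..n. v i * a i) = 0)"
  then obtain v where v: "proj_point v \<in> V" "(\<Sum>i=0..n. v i * a i) = 0"
    by blast
  have "lin_dependent n V a"
    unfolding lin_dependent_def using v proj_point_self[of v] by blast
  then show "proj_point a \<in> ld n V"
    unfolding ld_def using * proj_point_self[of a] by blast
qed

text \<open>The formal identity is evaluated with \<open>c\<close> in place of the indeterminate
  \<open>t\<close>, that is, of \<open>dvar None\<close>.\<close>

lemma dhomogeneous_in_deval:
  assumes \<delta>: "derivations \<delta>" and f: "dhomogeneous_in \<delta> S d f"
  shows "deval \<delta> (\<lambda>v. if v \<in> S then c * a v else a v) f = c ^ d * deval \<delta> a f"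
proof -
  let ?\<sigma> = "case_option c a"
  note m = ring_morphism_deval[of \<delta> ?\<sigma>]
  have *: "deval \<delta> ?\<sigma> (if v \<in> S then dvar None * dvar (Some v) else dvar (Some v)) = (if v \<in> S then c * a v else a v)" for v
    by (simp add: ring_morphism_mult[OF m])
  have "deval \<delta> ?\<sigma> (dsubst \<delta> (\<lambda>v. if v \<in> S then dvar None * dvar (Some v) else dvar (Some v)) f) =
      deval \<delta> ?\<sigma> (dvar None ^ d * dsubst \<delta> (\<lambda>v. dvar (Some v)) f)"
    using f by (simp add: dhomogeneous_in_def)
  then show ?thesis
    unfolding deval_dsubst[OF \<delta>] ring_morphism_mult[OF m] ring_morphism_power[OF m] * by simp
qed

lemma dhomogeneous_deval:
  assumes "derivations \<delta>" "dhomogeneous \<delta> d f"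
  shows "deval \<delta> (\<lambda>v. c * a v) f = c ^ d * deval \<delta> a f"
  using dhomogeneous_in_deval[OF assms, of c a] by simp

definition hpolys :: "('m::finite \<Rightarrow> 'a::field \<Rightarrow> 'a) \<Rightarrow> 'a set \<Rightarrow> nat \<Rightarrow> (nat, 'm, 'a) dpoly set" where
  "hpolys \<delta> K n = {f \<in> dpolys K {..n}. \<exists>d. dhomogeneous \<delta> d f}"

lemma proj_point_in_proj_zeros:
  assumes \<delta>: "derivations \<delta>" and F: "F \<subseteq> hpolys \<delta> K n"
  shows "proj_point a \<in> proj_zeros \<delta> n F \<longleftrightarrow> proj_point a \<in> proj_space n \<and> (\<forall>f\<in>F. deval \<delta> a f = 0)"
proof -
  have "deval \<delta> b f = 0" if fF: "f \<in> F" and b: "b \<in> proj_point a" and z: "deval \<delta> a f = 0" for f b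
  proof -
    obtain d where d: "dhomogeneous \<delta> d f"
      using F fF by (auto simp: hpolys_def)
    obtain c where "b = (\<lambda>i. c * a i)"
      using b by (auto simp: proj_point_def)
    then show ?thesis
      using dhomogeneous_deval[OF \<delta> d, of c a] z by simp
  qed
  then show ?thesis
    unfolding proj_zeros_def using proj_point_self[of a] by blast
qed

lemma dclosed_over_hpolys: "dclosed_over \<delta> K n C \<longleftrightarrow> (\<exists>F. F \<subseteq> hpolys \<delta> K n \<and> C = proj_zeros \<delta> n F)"
  by (simp add: dclosed_over_def hpolys_def)

lemma proj_set_eqI:
  assumes "A \<subseteq> proj_space n" "B \<subseteq> proj_space n"
    and "\<And>a. a \<in> affine_space n \<Longrightarrow> a \<noteq> (\<lambda>_. 0) \<Longrightarrow> proj_point a \<in> A \<longleftrightarrow> proj_point a \<in> B"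
  shows "A = B"
proof -
  have "p \<in> A \<longleftrightarrow> p \<in> B" if "p \<in> proj_space n" for p
    by (rule proj_space_cases[OF that]) (simp add: assms(3))
  then show ?thesis
    using assms(1,2) by blast
qed

lemma proj_zeros_subset: "proj_zeros \<delta> n F \<subseteq> proj_space n"
  by (auto simp: proj_zeros_def)

lemma ld_subset: "ld n V \<subseteq> proj_space n"
  by (auto simp: ld_def)

lemma ld_dclosed:
  fixes \<delta> :: "'m::finite \<Rightarrow> 'a::field_char_0 \<Rightarrow> 'a"
  assumes \<delta>: "derivations \<delta>" and V: "V \<subseteq> proj_space n" and complete: "complete_variety \<delta> n V"
  shows "dclosed \<delta> n (ld n V)"
proof -
  define g :: "(nat + nat, 'm, 'a) dpoly" where "g = (\<Sum>i\<le>n. dvar (Inl i) * dvar (Inr i))"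
  have KU: "ksubfield (UNIV :: 'a set)"
    by (simp add: ksubfield_def)
  have g: "g \<in> dpolys UNIV ({..n} <+> {..n})"
    unfolding g_def by (intro dpolys_sum dpolys_mult dpolys_dvar KU) auto
  have hom: "dhomogeneous_in \<delta> (range Inl) 1 g" "dhomogeneous_in \<delta> (range Inr) 1 g"
    unfolding dhomogeneous_in_def g_def ring_morphism_sum[OF ring_morphism_dsubst] ring_morphism_mult[OF ring_morphism_dsubst]
      sum_distrib_left
    by (intro sum.cong refl, simp add: image_iff ac_simps)+
  have g_eval: "deval \<delta> (case_sum a b) g = (\<Sum>i=0..n. a i * b i)" for a b
    unfolding g_def ring_morphism_sum[OF ring_morphism_deval] ring_morphism_mult[OF ring_morphism_deval]
    by (simp add: atLeast0AtMost)
  define Z where "Z = {(p, q). p \<in> proj_space n \<and> q \<in> proj_space n \<and>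
      (\<forall>f\<in>{g}. \<forall>a\<in>p. \<forall>b\<in>q. deval \<delta> (case_sum a b) f = 0)}"
  have Z: "dclosed_prod \<delta> n n Z"
    unfolding dclosed_prod_def Z_def using g hom by (intro exI[of _ "{g}"]) auto
  \<comment> \<open>The constant 1 is homogeneous of degree 0 and has no zeros; this exhibits the
    whole projective space as a quasiprojective variety, to which completeness can be
    applied.\<close>
  have one: "1 \<in> hpolys \<delta> UNIV n"
    using dpolys_dconst[of 1 UNIV "{..n}"]
    by (auto simp: hpolys_def dhomogeneous_in_def ring_morphism_one[OF ring_morphism_dsubst] intro!: exI[of _ 0])
  have "p \<notin> proj_zeros \<delta> n {1}" for p
  proof
    assume p: "p \<in> proj_zeros \<delta> n {1}"
    then obtain a where "a \<in> p"
      using proj_zeros_subset[of \<delta> n "{1}"] proj_space_cases[of p n] proj_point_self by blast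
    then have "deval \<delta> a 1 = 0"
      using p by (simp add: proj_zeros_def)
    then show False
      by (simp add: ring_morphism_one[OF ring_morphism_deval])
  qed
  then have "proj_zeros \<delta> n {1} = {}"
    by blast
  moreover have "proj_zeros \<delta> n {} = proj_space n"
    by (simp add: proj_zeros_def)
  ultimately have "proj_space n = proj_zeros \<delta> n {} - proj_zeros \<delta> n {1}"
    by (simp only: Diff_empty)
  then have "quasiprojective \<delta> n (proj_space n)"
    unfolding quasiprojective_def dclosed_over_hpolys using one
    by (intro exI[of _ "proj_zeros \<delta> n {}"] exI[of _ "proj_zeros \<delta> n {1}"] conjI)
      (auto intro: exI[of _ "{}"] exI[of _ "{1}"])
  then obtain C where C: "dclosed \<delta> n C" "snd ` (Z \<inter> V \<times> proj_space n) = C \<inter> proj_space n"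
    using complete Z unfolding complete_variety_def by blast
  have CS: "C \<subseteq> proj_space n"
    using C(1) by (auto simp: dclosed_over_def proj_zeros_def)
  have "snd ` (Z \<inter> V \<times> proj_space n) = ld n V"
  proof (rule proj_set_eqI)
    show "snd ` (Z \<inter> V \<times> proj_space n) \<subseteq> proj_space n"
      by auto
    show "ld n V \<subseteq> proj_space n"
      by (rule ld_subset)
    fix a :: "nat \<Rightarrow> 'a" assume a: "a \<in> affine_space n" "a \<noteq> (\<lambda>_. 0)"
    show "proj_point a \<in> snd ` (Z \<inter> V \<times> proj_space n) \<longleftrightarrow> proj_point a \<in> ld n V"
    proof
      assume "proj_point a \<in> snd ` (Z \<inter> V \<times> proj_space n)"
      then obtain p where p: "p \<in> V" "(p, proj_point a) \<in> Z"
        by auto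
      obtain v where v: "v \<in> affine_space n" "v \<noteq> (\<lambda>_. 0)" "p = proj_point v"
        using p(1) V proj_space_cases by blast
      have "(\<Sum>i=0..n. v i * a i) = 0"
        using p(2) proj_point_self[of v] proj_point_self[of a] by (auto simp: Z_def v(3) g_eval)
      then show "proj_point a \<in> ld n V"
        unfolding lin_dependent_ppt[OF V] using v p(1) proj_point_in_proj_space[OF a] by blast
    next
      assume "proj_point a \<in> ld n V"
      then obtain v where v: "v \<in> affine_space n" "v \<noteq> (\<lambda>_. 0)" "proj_point v \<in> V" "(\<Sum>i=0..n. v i * a i) = 0"
        unfolding lin_dependent_ppt[OF V] by blast
      have "(\<Sum>i=0..n. w i * b i) = 0" if "w \<in> proj_point v" "b \<in> proj_point a" for w b
      proof -
        obtain c d where "w = (\<lambda>i. c * v i)" "b = (\<lambda>i. d * a i)"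
          using \<open>w \<in> proj_point v\<close> \<open>b \<in> proj_point a\<close> by (auto simp: proj_point_def)
        then have "(\<Sum>i=0..n. w i * b i) = c * d * (\<Sum>i=0..n. v i * a i)"
          unfolding sum_distrib_left by (simp add: algebra_simps)
        then show ?thesis
          using v(4) by simp
      qed
      then have "(proj_point v, proj_point a) \<in> Z"
        using proj_point_in_proj_space[OF a] proj_point_in_proj_space[OF v(1,2)] by (simp add: Z_def g_eval)
      then show "proj_point a \<in> snd ` (Z \<inter> V \<times> proj_space n)"
        using v(3) proj_point_in_proj_space[OF a] by force
    qed
  qed
  then have "ld n V = C"
    unfolding C(2) Int_absorb2[OF CS] by (rule sym)
  then show ?thesis
    using C(1) by simp
qed


section \<open>Applying linear functionals to coefficients\<close>

lemma lookup_map: "\<mu> 0 = 0 \<Longrightarrow> lookup (Poly_Mapping.map \<mu> f) M = \<mu> (lookup f M)"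
  by (cases "lookup f M = 0") (simp_all add: Poly_Mapping.map.rep_eq)

lemma map_dpolys:
  assumes "\<mu> 0 = 0" "range \<mu> \<subseteq> K" "f \<in> dpolys UNIV S"
  shows "Poly_Mapping.map \<mu> f \<in> dpolys K S"
proof (rule dpolysI)
  fix M assume "lookup (Poly_Mapping.map \<mu> f) M \<noteq> 0"
  then have "lookup f M \<noteq> 0"
    using assms(1) by (auto simp: lookup_map)
  then have "keys M \<subseteq> S \<times> UNIV"
    using assms(3) by (intro dpolys_keys) (simp_all add: in_keys_iff)
  then show "lookup (Poly_Mapping.map \<mu> f) M \<in> K \<and> keys M \<subseteq> S \<times> UNIV"
    using assms by (auto simp: lookup_map)
qed

lemma deval_map:
  assumes "\<mu> 0 = 0"
  shows "deval \<delta> a (Poly_Mapping.map \<mu> f) = (\<Sum>M\<in>keys f. \<mu> (lookup f M) * mono_eval \<delta> a M)"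
proof -
  have "keys (Poly_Mapping.map \<mu> f) \<subseteq> keys f"
    using assms by (auto simp: in_keys_iff lookup_map)
  then show ?thesis
    unfolding deval_def by (subst dinsert_superset[of _ "keys f"]) (simp_all add: lookup_map assms)
qed

lemma map_add:
  assumes "klinear K \<mu>"
  shows "Poly_Mapping.map \<mu> (p + q) = Poly_Mapping.map \<mu> p + Poly_Mapping.map \<mu> q"
  by (rule poly_mapping_eqI) (simp add: lookup_map klinear_zero[OF assms] lookup_add klinear_add[OF assms])

lemma map_single_klinear:
  "klinear K \<mu> \<Longrightarrow> Poly_Mapping.map \<mu> (single M c) = single M (\<mu> c)"
  by (rule poly_mapping_eqI) (simp add: lookup_map klinear_zero lookup_single when_def)

text \<open>Applying \<open>\<mu>\<close> to coefficients is not multiplicative, but it is linear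
  over the polynomials with coefficients in \<open>K\<close>.\<close>

lemma map_mult_dpolys:
  assumes K: "ksubfield K" and \<mu>: "klinear K \<mu>" and q: "q \<in> dpolys K S"
  shows "Poly_Mapping.map \<mu> (q * p) = q * Poly_Mapping.map \<mu> p"
proof (rule poly_mapping_additive_ext[where p = p])
  show "Poly_Mapping.map \<mu> (q * (x + y)) = Poly_Mapping.map \<mu> (q * x) + Poly_Mapping.map \<mu> (q * y)" for x y
    unfolding distrib_left by (rule map_add[OF \<mu>])
  show "q * Poly_Mapping.map \<mu> (x + y) = q * Poly_Mapping.map \<mu> x + q * Poly_Mapping.map \<mu> y" for x y
    unfolding map_add[OF \<mu>] by (rule distrib_left)
  fix N c
  have "Poly_Mapping.map \<mu> (\<Sum>M\<in>A. single M (lookup q M) * single N c) =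
      (\<Sum>M\<in>A. single M (lookup q M) * single N (\<mu> c))" for A
    unfolding additive_sum[of "Poly_Mapping.map \<mu>", OF map_add[OF \<mu>]] mult_single map_single_klinear[OF \<mu>]
      klinear_scale[OF \<mu> dpolys_lookup[OF K q]] by (rule refl)
  from this[of "keys q"]
  show "Poly_Mapping.map \<mu> (q * single N c) = q * Poly_Mapping.map \<mu> (single N c)"
    unfolding map_single_klinear[OF \<mu>] sum_distrib_right[symmetric] poly_mapping_sum_single[symmetric] .
qed

lemma dsubst_dpolys:
  assumes \<delta>: "derivations \<delta>" and K: "ksubfield K" and K\<delta>: "\<And>i a. a \<in> K \<Longrightarrow> \<delta> i a \<in> K"
    and f: "f \<in> dpolys K S" and \<sigma>: "\<And>v. v \<in> S \<Longrightarrow> \<sigma> v \<in> dpolys K S'"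
  shows "dsubst \<delta> \<sigma> f \<in> dpolys K S'" (is "?P f")
proof (rule dpoly_induct[OF f \<delta> ksubfield_zero[OF K] ksubfield_one[OF K]])
  note m = ring_morphism_dsubst[of \<delta> \<sigma>]
  show "?P (f + g)" if "?P f" "?P g" for f g
    using that by (simp add: ring_morphism_add[OF m] dpolys_add[OF K])
  show "?P (f * g)" if "?P f" "?P g" for f g
    using that by (simp add: ring_morphism_mult[OF m] dpolys_mult[OF K])
  show "?P (pder \<delta> i f)" if "?P f" for f i
    using that by (simp add: dsubst_pder[OF \<delta>] dpolys_pder[OF K K\<delta>])
qed (simp_all add: dpolys_dconst \<sigma>)

context universal_subfield
begin

lemma dsubst_map:
  assumes \<mu>: "klinear K \<mu>" and \<sigma>: "\<And>v. \<sigma> v \<in> dpolys K UNIV"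
  shows "dsubst \<delta> \<sigma> (Poly_Mapping.map \<mu> f) = Poly_Mapping.map \<mu> (dsubst \<delta> \<sigma> f)"
proof (rule poly_mapping_additive_ext[where p = f])
  note m = ring_morphism_dsubst[of \<delta> \<sigma>]
  show "dsubst \<delta> \<sigma> (Poly_Mapping.map \<mu> (x + y)) = dsubst \<delta> \<sigma> (Poly_Mapping.map \<mu> x) + dsubst \<delta> \<sigma> (Poly_Mapping.map \<mu> y)" for x y
    unfolding map_add[OF \<mu>] by (rule ring_morphism_add[OF m])
  show "Poly_Mapping.map \<mu> (dsubst \<delta> \<sigma> (x + y)) = Poly_Mapping.map \<mu> (dsubst \<delta> \<sigma> x) + Poly_Mapping.map \<mu> (dsubst \<delta> \<sigma> y)" for x y
    unfolding ring_morphism_add[OF m] by (rule map_add[OF \<mu>])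
  fix M c
  have single: "dsubst \<delta> \<sigma> (single M d) = dsubst \<delta> \<sigma> (single M 1) * dconst d" for d
    by (subst single_eq_dconst_mult) (simp add: ring_morphism_mult[OF m] mult.commute)
  have q: "dsubst \<delta> \<sigma> (single M 1) \<in> dpolys K UNIV"
    by (rule dsubst_dpolys[OF derivations ksubfield K_der, where S = UNIV])
      (simp_all add: dpolys_single ksubfield_one[OF ksubfield] \<sigma>)
  show "dsubst \<delta> \<sigma> (Poly_Mapping.map \<mu> (single M c)) = Poly_Mapping.map \<mu> (dsubst \<delta> \<sigma> (single M c))"
    unfolding map_single_klinear[OF \<mu>] single[of c] single[of "\<mu> c"] map_mult_dpolys[OF ksubfield \<mu> q]
    by (simp add: dconst_def map_single_klinear[OF \<mu>])
qed

text \<open>The two substitutions and the factor \<open>t ^ d\<close> in the definition of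
  homogeneity have coefficients in \<open>K\<close>, so \<open>\<mu>\<close> passes through all of
  them.\<close>

lemma map_homogeneous:
  assumes \<mu>: "klinear K \<mu>" and f: "dhomogeneous \<delta> d f"
  shows "dhomogeneous \<delta> d (Poly_Mapping.map \<mu> f)"
proof -
  have var: "dvar v \<in> dpolys K UNIV" for v :: "'v option"
    by (simp add: dpolys_dvar ksubfield)
  have pow: "dvar None ^ d \<in> dpolys K UNIV" for d
    by (induction d) (simp_all add: dpolys_mult ksubfield var dpolys_dconst[OF ksubfield_one[OF ksubfield], simplified])
  show ?thesis
    using f unfolding dhomogeneous_in_def
    by (simp add: dsubst_map[OF \<mu>] var dpolys_mult ksubfield map_mult_dpolys[OF ksubfield \<mu> pow])
qed

lemma map_hpolys:
  assumes "klinear K \<mu>" "range \<mu> \<subseteq> K" "f \<in> hpolys \<delta> UNIV n"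
  shows "Poly_Mapping.map \<mu> f \<in> hpolys \<delta> K n"
proof -
  obtain d where "f \<in> dpolys UNIV {..n}" "dhomogeneous \<delta> d f"
    using assms(3) by (auto simp: hpolys_def)
  then have "Poly_Mapping.map \<mu> f \<in> dpolys K {..n}" "dhomogeneous \<delta> d (Poly_Mapping.map \<mu> f)"
    by (simp_all add: map_dpolys[OF klinear_zero[OF assms(1)] assms(2)] map_homogeneous[OF assms(1)])
  then show ?thesis
    unfolding hpolys_def by blast
qed

lemma mono_eval_term_fun:
  assumes "keys M \<subseteq> S \<times> UNIV" "S \<subseteq> W"
  shows "term_fun W (\<lambda>\<rho>. mono_eval \<delta> \<rho> M)"
proof -
  have "single M 1 \<in> dpolys K S"
    using assms(1) by (intro dpolys_single ksubfield_one[OF ksubfield])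
  then have "term_fun W (\<lambda>\<rho>. deval \<delta> \<rho> (single M 1))"
    by (rule term_fun_deval) (rule term_fun_var[OF subsetD[OF assms(2)]])
  then show ?thesis
    by (simp add: deval_def dinsert_single)
qed

text \<open>A common zero of all images of \<open>f\<close> under functionals with values in
  \<open>K\<close> is a zero of \<open>f\<close>, so replacing \<open>f\<close> by these images does
  not enlarge the zero set.\<close>

lemma functional_detects_deval:
  assumes "deval \<delta> a f \<noteq> 0"
  obtains \<mu> where "klinear K \<mu>" "range \<mu> \<subseteq> K" "deval \<delta> a (Poly_Mapping.map \<mu> f) \<noteq> 0"
proof -
  have "(\<Sum>M\<in>keys f. lookup f M * mono_eval \<delta> a M) \<noteq> 0"
    using assms by (simp add: deval_def dinsert_eq)
  then obtain \<mu> where "klinear K \<mu>" "range \<mu> \<subseteq> K" "(\<Sum>M\<in>keys f. \<mu> (lookup f M) * mono_eval \<delta> a M) \<noteq> 0"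
    by (rule functional_detects[OF ksubfield finite_keys])
  then show thesis
    using that[of \<mu>] deval_map[of \<mu> \<delta> a f] klinear_zero[of K \<mu>] by simp
qed

end

section \<open>Definability over the subfield\<close>

context universal_subfield
begin

text \<open>Replacing the equations \<open>F\<close> by their images \<open>F'\<close> adds no zeros
  by \<open>functional_detects_deval\<close>, and loses none by \<open>descent_linear\<close>,
  applied to the set \<open>B\<close> of pairs of a point and its witness. Such pairs are described
  by equations over \<open>K\<close>, although \<open>F\<close> is not defined over
  \<open>K\<close>.\<close>

lemma ld_dclosed_over:
  assumes V: "V \<subseteq> proj_space n" and VK: "dclosed_over \<delta> K n V" and closed: "dclosed \<delta> n (ld n V)"
  shows "dclosed_over \<delta> K n (ld n V)"
proof -
  obtain F where F: "F \<subseteq> hpolys \<delta> UNIV n" "ld n V = proj_zeros \<delta> n F"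
    using closed unfolding dclosed_over_hpolys by blast
  obtain FV where FV: "FV \<subseteq> hpolys \<delta> K n" "V = proj_zeros \<delta> n FV"
    using VK unfolding dclosed_over_hpolys by blast
  define F' where "F' = {Poly_Mapping.map \<mu> f |\<mu> f. f \<in> F \<and> klinear K \<mu> \<and> range \<mu> \<subseteq> K}"
  have F': "F' \<subseteq> hpolys \<delta> K n"
    unfolding F'_def using F(1) map_hpolys by blast
  define first_point where "first_point = (\<lambda>(b :: nat \<Rightarrow> 'a) i. if i \<le> n then b i else 0)"
  define second_point where "second_point = (\<lambda>(b :: nat \<Rightarrow> 'a) i. if i \<le> n then b (n + 1 + i) else 0)"
  \<comment> \<open>Two vectors of \<open>n + 1\<close> entries each, and two inverses.\<close>
  define N where "N = 2 * n + 4"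
  \<comment> \<open>A point of \<open>B\<close> lists \<open>a\<close>, then \<open>v\<close>, then the inverse of a nonzero entry of each: nonvanishing becomes an equation.\<close>
  define B where "B = {b. (\<forall>g\<in>FV. deval \<delta> (second_point b) g = 0) \<and> (\<Sum>i=0..n. second_point b i * first_point b i) = 0 \<and>
      (\<exists>k\<le>n. b (2 * n + 2) * second_point b k - 1 = 0) \<and> (\<exists>k\<le>n. b (2 * n + 3) * first_point b k - 1 = 0)}"
  have fst_term_fun: "term_fun {..<N} (\<lambda>b. first_point b i)" for i
    unfolding first_point_def N_def by (cases "i \<le> n") (simp_all add: term_fun_var term_fun_const ksubfield_zero[OF ksubfield])
  have snd_term_fun: "term_fun {..<N} (\<lambda>b. second_point b i)" for i
    unfolding second_point_def N_def by (cases "i \<le> n") (simp_all add: term_fun_var term_fun_const ksubfield_zero[OF ksubfield])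
  have spec: "specialization_closed N B"
    unfolding specialization_closed_def
  proof (intro ballI allI impI)
    fix b b' assume b: "b \<in> B" and sp: "\<forall>F. term_fun {..<N} F \<longrightarrow> F b = 0 \<longrightarrow> F b' = 0"
    have sp': "F b' = 0" if "term_fun {..<N} F" "F b = 0" for F
      using sp that by blast
    have "deval \<delta> (second_point b') g = 0" if g: "g \<in> FV" for g
    proof -
      have "g \<in> dpolys K {..n}"
        using g FV(1) by (auto simp: hpolys_def)
      then have "term_fun {..<N} (\<lambda>b. deval \<delta> (second_point b) g)"
        by (rule term_fun_deval) (rule snd_term_fun)
      from sp'[OF this] show ?thesis
        using b g by (simp add: B_def)
    qed
    moreover have "(\<Sum>i=0..n. second_point b' i * first_point b' i) = 0"
      by (rule sp'[of "\<lambda>b. \<Sum>i=0..n. second_point b i * first_point b i"], intro term_fun_sum term_fun_mult snd_term_fun fst_term_fun)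
        (use b in \<open>simp add: B_def\<close>)
    moreover have "\<exists>k\<le>n. b' (2 * n + 2) * second_point b' k - 1 = 0"
    proof -
      obtain k where k: "k \<le> n" "b (2 * n + 2) * second_point b k - 1 = 0"
        using b by (auto simp: B_def)
      have "b' (2 * n + 2) * second_point b' k - 1 = 0"
        by (rule sp'[of "\<lambda>b. b (2 * n + 2) * second_point b k - 1"],
            intro term_fun_diff term_fun_mult snd_term_fun term_fun_const term_fun_var ksubfield_one[OF ksubfield])
          (use k in \<open>simp_all add: N_def\<close>)
      then show ?thesis
        using k(1) by blast
    qed
    moreover have "\<exists>k\<le>n. b' (2 * n + 3) * first_point b' k - 1 = 0"
    proof -
      obtain k where k: "k \<le> n" "b (2 * n + 3) * first_point b k - 1 = 0"
        using b by (auto simp: B_def)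
      have "b' (2 * n + 3) * first_point b' k - 1 = 0"
        by (rule sp'[of "\<lambda>b. b (2 * n + 3) * first_point b k - 1"],
            intro term_fun_diff term_fun_mult fst_term_fun term_fun_const term_fun_var ksubfield_one[OF ksubfield])
          (use k in \<open>simp_all add: N_def\<close>)
      then show ?thesis
        using k(1) by blast
    qed
    ultimately show "b' \<in> B"
      by (simp add: B_def)
  qed
  have B_ld: "proj_point (first_point b) \<in> ld n V" if b: "b \<in> B" for b
  proof -
    have "first_point b \<in> affine_space n" "second_point b \<in> affine_space n"
      by (auto simp: affine_space_def first_point_def second_point_def)
    moreover have "first_point b \<noteq> (\<lambda>_. 0)" "second_point b \<noteq> (\<lambda>_. 0)"
      using b by (auto simp: B_def)
    moreover have "proj_point (second_point b) \<in> V"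
      using b calculation by (simp add: FV(2) proj_point_in_proj_zeros[OF derivations FV(1)] proj_point_in_proj_space B_def)
    moreover have "(\<Sum>i=0..n. second_point b i * first_point b i) = 0"
      using b by (simp add: B_def)
    ultimately show ?thesis
      unfolding lin_dependent_ppt[OF V] using proj_point_in_proj_space by blast
  qed
  \<comment> \<open>The tuple \<open>b\<close> continues beyond index \<open>n\<close>, where
    \<open>first_point b\<close> vanishes; monomials in the first \<open>n + 1\<close> variables do
    not see the difference.\<close>
  have mono_fst: "mono_eval \<delta> b M = mono_eval \<delta> (first_point b) M" if "keys M \<subseteq> {..n} \<times> UNIV" for b M
  proof -
    have "single M (1::'a) \<in> dpolys UNIV {..n}"
      using that by (intro dpolys_single) auto
    from dinsert_cong[OF this, of b "first_point b" id \<delta>] show ?thesis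
      by (simp add: first_point_def dinsert_single)
  qed
  have "ld n V = proj_zeros \<delta> n F'"
  proof (rule proj_set_eqI[OF ld_subset proj_zeros_subset])
    fix a :: "nat \<Rightarrow> 'a" assume a: "a \<in> affine_space n" "a \<noteq> (\<lambda>_. 0)"
    show "proj_point a \<in> ld n V \<longleftrightarrow> proj_point a \<in> proj_zeros \<delta> n F'"
    proof
      assume "proj_point a \<in> proj_zeros \<delta> n F'"
      then have zero: "deval \<delta> a f = 0" if "f \<in> F'" for f
        using that by (simp add: proj_point_in_proj_zeros[OF derivations F'])
      have "deval \<delta> a f = 0" if f: "f \<in> F" for f
      proof (rule ccontr)
        assume "deval \<delta> a f \<noteq> 0"
        then obtain \<mu> where "klinear K \<mu>" "range \<mu> \<subseteq> K" "deval \<delta> a (Poly_Mapping.map \<mu> f) \<noteq> 0"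
          by (rule functional_detects_deval)
        then show False
          using zero[of "Poly_Mapping.map \<mu> f"] f unfolding F'_def by blast
      qed
      then show "proj_point a \<in> ld n V"
        by (simp add: F(2) proj_point_in_proj_zeros[OF derivations F(1)] proj_point_in_proj_space[OF a])
    next
      assume "proj_point a \<in> ld n V"
      then obtain v where v: "v \<in> affine_space n" "v \<noteq> (\<lambda>_. 0)" "proj_point v \<in> V" "(\<Sum>i=0..n. v i * a i) = 0"
        unfolding lin_dependent_ppt[OF V] by blast
      obtain k where k: "k \<le> n" "v k \<noteq> 0"
        using affine_nonzero_coord[OF v(1,2)] by blast
      obtain l where l: "l \<le> n" "a l \<noteq> 0"
        using affine_nonzero_coord[OF a] by blast
      define b where "b = (\<lambda>i. if i \<le> n then a i else if i \<le> 2 * n + 1 then v (i - (n + 1))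
          else if i = 2 * n + 2 then inverse (v k) else inverse (a l))"
      have fst_b: "first_point b = a" and snd_b: "second_point b = v"
        using a(1) v(1) by (auto simp: first_point_def second_point_def b_def affine_space_def fun_eq_iff not_le)
      have b: "b \<in> B"
        unfolding B_def fst_b snd_b mem_Collect_eq
      proof (intro conjI)
        show "\<forall>g\<in>FV. deval \<delta> v g = 0"
          using v(3) unfolding FV(2) proj_point_in_proj_zeros[OF derivations FV(1)] by blast
        show "\<exists>k\<le>n. b (2 * n + 2) * v k - 1 = 0"
          using k by (intro exI[of _ k]) (simp add: b_def)
        show "\<exists>k\<le>n. b (2 * n + 3) * a k - 1 = 0"
          using l by (intro exI[of _ l]) (simp add: b_def)
      qed (rule v(4))
      have "deval \<delta> a (Poly_Mapping.map \<mu> f) = 0" if f: "f \<in> F" and \<mu>: "klinear K \<mu>" for \<mu> f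
      proof -
        have fn: "f \<in> dpolys UNIV {..n}"
          using f F(1) by (auto simp: hpolys_def)
        have "(\<Sum>M\<in>keys f. \<mu> (lookup f M) * mono_eval \<delta> b M) = 0"
        proof (rule descent_linear(1)[OF finite_keys _ spec _ \<mu> b])
          show "term_fun {..<N} (\<lambda>b. mono_eval \<delta> b M)" if "M \<in> keys f" for M
            by (rule mono_eval_term_fun[OF dpolys_keys[OF fn that]]) (auto simp: N_def)
          fix b assume b: "b \<in> B"
          have "\<forall>f\<in>F. deval \<delta> (first_point b) f = 0"
            using B_ld[OF b] by (simp add: F(2) proj_point_in_proj_zeros[OF derivations F(1)])
          then have "deval \<delta> (first_point b) f = 0"
            using f by (rule bspec)
          also have "deval \<delta> (first_point b) f = (\<Sum>M\<in>keys f. lookup f M * mono_eval \<delta> b M)"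
            unfolding deval_def dinsert_eq id_apply
            by (intro sum.cong refl) (simp only: mono_fst[OF dpolys_keys[OF fn], symmetric])
          finally show "(\<Sum>M\<in>keys f. lookup f M * mono_eval \<delta> b M) = 0" .
        qed
        moreover have "(\<Sum>M\<in>keys f. \<mu> (lookup f M) * mono_eval \<delta> b M) =
            deval \<delta> a (Poly_Mapping.map \<mu> f)"
          unfolding deval_map[of \<mu>, OF klinear_zero[OF \<mu>]]
          using mono_fst[OF dpolys_keys[OF fn], where b = b] by (intro sum.cong refl) (simp only: fst_b)
        ultimately show ?thesis
          by simp
      qed
      then show "proj_point a \<in> proj_zeros \<delta> n F'"
        unfolding proj_point_in_proj_zeros[OF derivations F'] using proj_point_in_proj_space[OF a] by (auto simp: F'_def)
    qed
  qed
  then show ?thesis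
    unfolding dclosed_over_hpolys using F' by blast
qed

end


section \<open>Irreducibility\<close>

text \<open>Natural numbers are constants for all derivations, so each jet is an affine function of
  \<open>m\<close> along the line, and sums and products of polynomials in \<open>m\<close> are
  again such.\<close>

lemma deval_on_line:
  assumes \<delta>: "derivations \<delta>"
  shows "\<exists>q. \<forall>m. deval \<delta> (\<lambda>i. a i + of_nat m * b i) f = poly q (of_nat m)" (is "?P f")
proof (rule dpoly_induct_jets[OF dpolys_UNIV, where f = f])
  note r = ring_morphism_deval[of \<delta>]
  show "?P (dconst c)" for c
    by (intro exI[of _ "[:c:]"]) simp
  show "?P 0"
    by (intro exI[of _ 0]) (simp add: ring_morphism_zero[OF r])
  show "?P 1"
    by (intro exI[of _ 1]) (simp add: ring_morphism_one[OF r])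
  fix v \<alpha>
  have "dpow \<delta> \<alpha> (of_nat m * y) = of_nat m * dpow \<delta> \<alpha> y" for m y
    by (rule dpow_hom[of \<delta> \<delta> "\<lambda>y. of_nat m * y", symmetric])
      (simp_all add: derivations_commute[OF \<delta>] derivations_mult[OF \<delta>] derivations_of_nat[OF \<delta>])
  moreover have "dpow \<delta> \<alpha> (x + y) = dpow \<delta> \<alpha> x + dpow \<delta> \<alpha> y" for x y
    by (rule dpow_add) (rule derivations_commute[OF \<delta>] derivations_add[OF \<delta>])+
  ultimately show "?P (jet v \<alpha>)"
    by (intro exI[of _ "[:dpow \<delta> \<alpha> (a v), dpow \<delta> \<alpha> (b v):]"])
      (simp add: deval_def dinsert_jet ring_morphism_id)
next
  note r = ring_morphism_deval[of \<delta>]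
  fix f g
  assume "?P f"
    "?P g"
  then obtain p q where "\<forall>m. deval \<delta> (\<lambda>i. a i + of_nat m * b i) f = poly p (of_nat m)"
      "\<forall>m. deval \<delta> (\<lambda>i. a i + of_nat m * b i) g = poly q (of_nat m)"
    by blast
  then have "\<forall>m. deval \<delta> (\<lambda>i. a i + of_nat m * b i) (f + g) = poly (p + q) (of_nat m)"
      "\<forall>m. deval \<delta> (\<lambda>i. a i + of_nat m * b i) (f * g) = poly (p * q) (of_nat m)"
    by (simp_all add: ring_morphism_add[OF r] ring_morphism_mult[OF r])
  then show "?P (f + g)"
      "?P (f * g)"
    by blast+
qed

lemma common_nonzero_on_line:
  fixes \<delta> :: "'m::finite \<Rightarrow> 'a::field_char_0 \<Rightarrow> 'a"
  assumes \<delta>: "derivations \<delta>" and f: "deval \<delta> a f \<noteq> 0" and g: "deval \<delta> b g \<noteq> 0"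
  obtains m :: nat where "deval \<delta> (\<lambda>i. a i + of_nat m * (b i - a i)) f \<noteq> 0"
    "deval \<delta> (\<lambda>i. a i + of_nat m * (b i - a i)) g \<noteq> 0"
proof -
  obtain p where p: "\<forall>m. deval \<delta> (\<lambda>i. a i + of_nat m * (b i - a i)) f = poly p (of_nat m)"
    using deval_on_line[OF \<delta>, of a "\<lambda>i. b i - a i" f] by blast
  obtain q where q: "\<forall>m. deval \<delta> (\<lambda>i. a i + of_nat m * (b i - a i)) g = poly q (of_nat m)"
    using deval_on_line[OF \<delta>, of a "\<lambda>i. b i - a i" g] by blast
  \<comment> \<open>The line passes through \<open>a\<close> at \<open>m = 0\<close>, where
    \<open>f\<close> is nonzero, and through \<open>b\<close> at \<open>m = 1\<close>, where
    \<open>g\<close> is nonzero.\<close>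
  have "p \<noteq> 0"
    using spec[OF p, of 0] f by auto
  moreover have "q \<noteq> 0"
    using spec[OF q, of 1] g by auto
  ultimately have "finite {x. poly (p * q) x = 0}"
    by (intro poly_roots_finite) simp
  moreover have "infinite (range (of_nat :: nat \<Rightarrow> 'a))"
    by (intro range_inj_infinite inj_of_nat)
  ultimately have "\<not> range (of_nat :: nat \<Rightarrow> 'a) \<subseteq> {x. poly (p * q) x = 0}"
    using finite_subset by blast
  then obtain m :: nat where "poly (p * q) (of_nat m) \<noteq> 0"
    by blast
  then show thesis
    using p q by (intro that[of m]) simp_all
qed

text \<open>With \<open>c = (A 0, \<dots>, A n)\<close> and \<open>w = (A (n + 1), \<dots>, A (2 n + 1))\<close>, the vector \<open>perp_point n A v\<close> is
  \<open>(w \<cdot> v) c - (c \<cdot> v) w\<close>. It is linear in \<open>v\<close> and sweeps out the hyperplane orthogonal to \<open>v\<close>.\<close>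

definition perp_coeff :: "nat \<Rightarrow> (nat \<Rightarrow> 'a::field) \<Rightarrow> nat \<Rightarrow> nat \<Rightarrow> 'a" where
  "perp_coeff n A k l = (if k \<le> n then A (n + 1 + l) * A k - A l * A (n + 1 + k) else 0)"

definition perp_point :: "nat \<Rightarrow> (nat \<Rightarrow> 'a::field) \<Rightarrow> (nat \<Rightarrow> 'a) \<Rightarrow> nat \<Rightarrow> 'a" where
  "perp_point n A v k = (\<Sum>l\<le>n. perp_coeff n A k l * v l)"

lemma perp_point_affine: "perp_point n A v \<in> affine_space n"
  by (simp add: affine_space_def perp_point_def perp_coeff_def)

text \<open>For indices up to \<open>n\<close> the matrix \<open>perp_coeff n A\<close> is
  antisymmetric: exchanging \<open>k\<close> and \<open>l\<close> swaps the two double sums.\<close>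

lemma perp_point_orthogonal: "(\<Sum>i=0..n. v i * perp_point n A v i) = 0"
proof -
  have "(\<Sum>i=0..n. v i * perp_point n A v i) =
      (\<Sum>k\<le>n. \<Sum>l\<le>n. v k * v l * A (n + 1 + l) * A k) - (\<Sum>k\<le>n. \<Sum>l\<le>n. v k * v l * A l * A (n + 1 + k))"
    by (simp add: perp_point_def perp_coeff_def sum_distrib_left atLeast0AtMost sum_subtractf[symmetric] algebra_simps)
  also have "(\<Sum>k\<le>n. \<Sum>l\<le>n. v k * v l * A l * A (n + 1 + k)) = (\<Sum>k\<le>n. \<Sum>l\<le>n. v k * v l * A (n + 1 + l) * A k)"
    by (subst sum.swap) (simp add: algebra_simps)
  finally show ?thesis
    by simp
qed

lemma perp_point_surj:
  assumes a: "a \<in> affine_space n" and v: "v \<in> affine_space n" "v \<noteq> (\<lambda>_. 0)" and va: "(\<Sum>i=0..n. v i * a i) = 0"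
  obtains A where "perp_point n A v = a"
proof -
  obtain k where k: "k \<le> n" "v k \<noteq> 0"
    using affine_nonzero_coord[OF v] by blast
  \<comment> \<open>Take \<open>c = a\<close> and let \<open>w\<close> have the single nonzero entry
    \<open>inverse (v k)\<close>. Then \<open>w\<close> pairs with \<open>v\<close> to 1 and
    \<open>c\<close> pairs with \<open>v\<close> to 0, so \<open>perp_point\<close> returns
    \<open>a\<close>.\<close>
  define A where "A = (\<lambda>i. if i \<le> n then a i else if i = n + 1 + k then inverse (v k) else 0)"
  have 1: "(\<Sum>l\<le>n. A (n + 1 + l) * v l) = 1"
  proof -
    have "(\<Sum>l\<le>n. A (n + 1 + l) * v l) = (\<Sum>l\<le>n. if l = k then inverse (v k) * v k else 0)"
      by (intro sum.cong refl) (auto simp: A_def)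
    then show ?thesis
      using k by simp
  qed
  have 2: "(\<Sum>l\<le>n. A l * v l) = 0"
    using va by (simp add: A_def atLeast0AtMost mult.commute)
  have "perp_point n A v i = a i" for i
  proof (cases "i \<le> n")
    case True
    then have "perp_point n A v i = (\<Sum>l\<le>n. (A (n + 1 + l) * v l) * A i - (A l * v l) * A (n + 1 + i))"
      unfolding perp_point_def by (intro sum.cong refl) (simp add: perp_coeff_def algebra_simps)
    then have "perp_point n A v i = (\<Sum>l\<le>n. A (n + 1 + l) * v l) * A i - (\<Sum>l\<le>n. A l * v l) * A (n + 1 + i)"
      by (simp only: sum_distrib_right sum_subtractf)
    then show ?thesis
      using True unfolding 1 2 by (simp add: A_def)
  next
    case False
    then show ?thesis
      using a by (simp add: perp_point_def perp_coeff_def affine_space_def)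
  qed
  then show thesis
    by (intro that[of A]) auto
qed

text \<open>The value of \<open>f\<close> at \<open>perp_point n A v\<close>, as a differential
  polynomial in the coordinates of \<open>v\<close> with the entries of \<open>A\<close> as
  constants. Linearity in \<open>v\<close> preserves the degree of homogeneity.\<close>

definition perp_subst :: "('m::finite \<Rightarrow> 'a::field_char_0 \<Rightarrow> 'a) \<Rightarrow> nat \<Rightarrow> (nat \<Rightarrow> 'a) \<Rightarrow> (nat, 'm, 'a) dpoly \<Rightarrow> (nat, 'm, 'a) dpoly" where
  "perp_subst \<delta> n A = dsubst \<delta> (\<lambda>k. \<Sum>l\<le>n. dconst (perp_coeff n A k l) * dvar l)"

lemma deval_perp_subst:
  assumes "derivations \<delta>"
  shows "deval \<delta> v (perp_subst \<delta> n A f) = deval \<delta> (perp_point n A v) f"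
proof -
  have "perp_point n A v = (\<lambda>k. \<Sum>l\<le>n. perp_coeff n A k l * v l)"
    by (rule ext) (rule perp_point_def)
  then show ?thesis
    unfolding perp_subst_def deval_dsubst[OF assms] ring_morphism_sum[OF ring_morphism_deval]
      ring_morphism_mult[OF ring_morphism_deval] deval_dconst deval_dvar by (simp only:)
qed

lemma perp_subst_hpolys:
  fixes \<delta> :: "'m::finite \<Rightarrow> 'a::field_char_0 \<Rightarrow> 'a"
  assumes \<delta>: "derivations \<delta>" and f: "f \<in> hpolys \<delta> K n"
  shows "perp_subst \<delta> n A f \<in> hpolys \<delta> UNIV n"
proof -
  have KU: "ksubfield (UNIV :: 'a set)"
    by (simp add: ksubfield_def)
  obtain d where d: "dhomogeneous \<delta> d f"
    using f by (auto simp: hpolys_def)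
  have "perp_subst \<delta> n A f \<in> dpolys UNIV {..n}"
    unfolding perp_subst_def
    by (rule dsubst_dpolys[OF \<delta> KU, where S = UNIV])
      (auto intro!: dpolys_sum dpolys_mult dpolys_dconst dpolys_dvar KU)
  moreover have "dhomogeneous \<delta> d (perp_subst \<delta> n A f)"
  proof -
    define \<tau> :: "nat \<Rightarrow> (nat option, 'm, 'a) dpoly" where
      "\<tau> = (\<lambda>k. \<Sum>l\<le>n. dconst (perp_coeff n A k l) * dvar (Some l))"
    note m = ring_morphism_dsubst
    have 1: "dsubst \<delta> (\<lambda>v. dvar (Some v)) (perp_subst \<delta> n A f) = dsubst \<delta> \<tau> f"
      unfolding perp_subst_def dsubst_dsubst[OF \<delta>] ring_morphism_sum[OF m] ring_morphism_mult[OF m] dsubst_dconst dsubst_dvar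
      by (simp only: \<tau>_def)
    have 2: "dsubst \<delta> (\<lambda>v. dvar None * dvar (Some v)) (perp_subst \<delta> n A f) = dsubst \<delta> (\<lambda>k. dvar None * \<tau> k) f"
      unfolding perp_subst_def dsubst_dsubst[OF \<delta>] ring_morphism_sum[OF m] ring_morphism_mult[OF m] dsubst_dconst dsubst_dvar
      by (simp only: \<tau>_def sum_distrib_left mult.left_commute)
    \<comment> \<open>The homogeneity identity of \<open>f\<close> is specialized by keeping
      \<open>t\<close> and sending each variable to the linear form \<open>\<tau> k\<close>.\<close>
    have "dsubst \<delta> (case_option (dvar None) \<tau>) (dsubst \<delta> (\<lambda>v. dvar None * dvar (Some v)) f) =
        dsubst \<delta> (case_option (dvar None) \<tau>) (dvar None ^ d * dsubst \<delta> (\<lambda>v. dvar (Some v)) f)"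
      using d by (simp add: dhomogeneous_in_def)
    then have "dsubst \<delta> (\<lambda>k. dvar None * \<tau> k) f = dvar None ^ d * dsubst \<delta> \<tau> f"
      unfolding dsubst_dsubst[OF \<delta>] ring_morphism_mult[OF m] ring_morphism_power[OF m] dsubst_dvar option.case .
    then show ?thesis
      unfolding dhomogeneous_in_def using 1 2 by simp
  qed
  ultimately show ?thesis
    unfolding hpolys_def by blast
qed

section \<open>Separating the hyperplane parameters from the point\<close>

context universal_subfield
begin

text \<open>Separation of variables: finitely many polynomials \<open>p\<close> over
  \<open>K\<close>, the same for all \<open>A\<close>, whose coefficients are differential
  polynomial functions of \<open>A\<close> over \<open>K\<close>. The latter are the functions to
  which descent is applied.\<close>

definition separable_family :: "((nat \<Rightarrow> 'a) \<Rightarrow> (nat, 'm, 'a) dpoly) \<Rightarrow> nat set \<Rightarrow> bool" where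
  "separable_family \<Phi> W \<longleftrightarrow> (\<exists>xs. (\<forall>(p, q)\<in>set xs. p \<in> dpolys K UNIV \<and> term_fun W q) \<and>
     (\<forall>A. \<Phi> A = (\<Sum>(p, q)\<leftarrow>xs. p * dconst (q A))))"

lemma separable_single:
  assumes "p \<in> dpolys K UNIV" "term_fun W q"
  shows "separable_family (\<lambda>A. p * dconst (q A)) W"
  unfolding separable_family_def using assms by (intro exI[of _ "[(p, q)]"]) simp

lemma separable_add:
  assumes "separable_family \<Phi> W" "separable_family \<Psi> W"
  shows "separable_family (\<lambda>A. \<Phi> A + \<Psi> A) W"
proof -
  from assms obtain xs ys where "\<forall>(p, q)\<in>set xs. p \<in> dpolys K UNIV \<and> term_fun W q" "\<forall>A. \<Phi> A = (\<Sum>(p, q)\<leftarrow>xs. p * dconst (q A))"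
      "\<forall>(p, q)\<in>set ys. p \<in> dpolys K UNIV \<and> term_fun W q" "\<forall>A. \<Psi> A = (\<Sum>(p, q)\<leftarrow>ys. p * dconst (q A))"
    unfolding separable_family_def by (elim exE conjE)
  then show ?thesis
    unfolding separable_family_def by (intro exI[of _ "xs @ ys"]) auto
qed

lemma separable_zero: "separable_family (\<lambda>A. 0) W"
  unfolding separable_family_def by (intro exI[of _ "[]"]) simp

lemma separable_sum: "(\<And>i. i \<in> I \<Longrightarrow> separable_family (\<Phi> i) W) \<Longrightarrow> separable_family (\<lambda>A. \<Sum>i\<in>I. \<Phi> i A) W"
  by (induction I rule: infinite_finite_induct) (simp_all add: separable_zero separable_add)

lemma separable_sum_list:
  "(\<And>x. x \<in> set xs \<Longrightarrow> separable_family (\<Phi> x) W) \<Longrightarrow> separable_family (\<lambda>A. \<Sum>x\<leftarrow>xs. \<Phi> x A) W"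
  by (induction xs) (simp_all add: separable_zero separable_add)

lemma separable_mult:
  assumes "separable_family \<Phi> W" "separable_family \<Psi> W"
  shows "separable_family (\<lambda>A. \<Phi> A * \<Psi> A) W"
proof -
  from assms obtain xs ys where xs: "\<forall>(p, q)\<in>set xs. p \<in> dpolys K UNIV \<and> term_fun W q" "\<forall>A. \<Phi> A = (\<Sum>(p, q)\<leftarrow>xs. p * dconst (q A))"
      and ys: "\<forall>(p, q)\<in>set ys. p \<in> dpolys K UNIV \<and> term_fun W q" "\<forall>A. \<Psi> A = (\<Sum>(p, q)\<leftarrow>ys. p * dconst (q A))"
    unfolding separable_family_def by (elim exE conjE)
  have "(\<Sum>(p, q)\<leftarrow>us. p * dconst (q A)) * (\<Sum>(p, q)\<leftarrow>vs. p * dconst (q A)) =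
      (\<Sum>x\<leftarrow>us. \<Sum>y\<leftarrow>vs. (fst x * fst y) * dconst (snd x A * snd y A))"
    for us vs :: "((nat, 'm, 'a) dpoly \<times> ((nat \<Rightarrow> 'a) \<Rightarrow> 'a)) list" and A
  proof -
    have "p * dconst (q A) * (\<Sum>(p, q)\<leftarrow>vs. p * dconst (q A)) =
        (\<Sum>y\<leftarrow>vs. (p * fst y) * dconst (q A * snd y A))" for p :: "(nat, 'm, 'a) dpoly" and q
      by (induction vs) (auto simp: algebra_simps dconst_mult)
    then show ?thesis
      by (induction us) (auto simp: distrib_right)
  qed
  then have "\<Phi> A * \<Psi> A = (\<Sum>x\<leftarrow>xs. \<Sum>y\<leftarrow>ys. (fst x * fst y) * dconst (snd x A * snd y A))" for A
    by (simp only: xs(2) ys(2))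
  moreover have "separable_family (\<lambda>A. \<Sum>x\<leftarrow>xs. \<Sum>y\<leftarrow>ys. (fst x * fst y) * dconst (snd x A * snd y A)) W"
  proof (intro separable_sum_list separable_single[where q = "\<lambda>A. snd _ A * snd _ A"] term_fun_mult dpolys_mult ksubfield)
    show "fst x \<in> dpolys K UNIV" "term_fun W (snd x)" if "x \<in> set xs" for x
      using bspec[OF xs(1) that] by (simp_all add: case_prod_beta)
    show "fst y \<in> dpolys K UNIV" "term_fun W (snd y)" if "y \<in> set ys" for y
      using bspec[OF ys(1) that] by (simp_all add: case_prod_beta)
  qed
  ultimately show ?thesis
    by simp
qed

lemma separable_pder:
  assumes "separable_family \<Phi> W"
  shows "separable_family (\<lambda>A. pder \<delta> i (\<Phi> A)) W"
proof -
  from assms obtain xs where xs: "\<forall>(p, q)\<in>set xs. p \<in> dpolys K UNIV \<and> term_fun W q" "\<forall>A. \<Phi> A = (\<Sum>(p, q)\<leftarrow>xs. p * dconst (q A))"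
    unfolding separable_family_def by (elim exE conjE)
  have "pder \<delta> i (\<Sum>(p, q)\<leftarrow>zs. p * dconst (q A)) =
      (\<Sum>x\<leftarrow>zs. pder \<delta> i (fst x) * dconst (snd x A) + fst x * dconst (\<delta> i (snd x A)))" for A zs
    by (induction zs) (auto simp: pder_add pder_mult pder_dconst derivations)
  then have "pder \<delta> i (\<Phi> A) = (\<Sum>x\<leftarrow>xs. pder \<delta> i (fst x) * dconst (snd x A) + fst x * dconst (\<delta> i (snd x A)))" for A
    by (simp add: xs(2))
  moreover have "separable_family (\<lambda>A. \<Sum>x\<leftarrow>xs. pder \<delta> i (fst x) * dconst (snd x A) + fst x * dconst (\<delta> i (snd x A))) W"
  proof (intro separable_sum_list separable_add)
    fix x assume "x \<in> set xs"
    then have x: "fst x \<in> dpolys K UNIV" "term_fun W (snd x)"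
      using bspec[OF xs(1)] by (auto simp: case_prod_beta)
    show "separable_family (\<lambda>A. pder \<delta> i (fst x) * dconst (snd x A)) W"
      by (intro separable_single x dpolys_pder ksubfield K_der)
    show "separable_family (\<lambda>A. fst x * dconst (\<delta> i (snd x A))) W"
      by (rule separable_single[OF x(1) term_fun_der[OF x(2)]])
  qed
  ultimately show ?thesis
    by simp
qed

text \<open>The entries of \<open>perp_coeff\<close> are polynomials over \<open>K\<close> in the
  \<open>2 * n + 2\<close> entries of \<open>A\<close>, and separability is stable under sums,
  products and derivations.\<close>

lemma separable_perp_subst:
  assumes "f \<in> dpolys K S"
  shows "separable_family (\<lambda>A. perp_subst \<delta> n A f) {..<2 * n + 2}" (is "?P f")
proof (rule dpoly_induct[OF assms derivations ksubfield_zero[OF ksubfield] ksubfield_one[OF ksubfield]])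
  note m = ring_morphism_dsubst
  show "?P (dconst c)" if "c \<in> K" for c
    using separable_single[OF dpolys_dconst[OF that] term_fun_const[OF ksubfield_one[OF ksubfield]]]
    by (simp add: perp_subst_def)
  have coeff: "term_fun {..<2 * n + 2} (\<lambda>A. perp_coeff n A k l)" if "l \<le> n" for k l
    using that unfolding perp_coeff_def
    by (cases "k \<le> n") (auto intro!: term_fun_diff term_fun_mult term_fun_var term_fun_const ksubfield_zero ksubfield)
  have "separable_family (\<lambda>A. \<Sum>l\<le>n. dvar l * dconst (perp_coeff n A k l)) {..<2 * n + 2}" for k
    by (intro separable_sum separable_single coeff dpolys_dvar ksubfield) simp_all
  then show "?P (dvar k)" for k
    by (simp add: perp_subst_def mult.commute)
  show "?P (pder \<delta> i f)"
    if "?P f" for i f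
    using separable_pder[OF that] by (simp add: perp_subst_def dsubst_pder[OF derivations])
  show "?P (f + g)"
    if "?P f" "?P g" for f g
    using separable_add[OF that] by (simp add: perp_subst_def ring_morphism_add[OF m])
  show "?P (f * g)"
    if "?P f" "?P g" for f g
    using separable_mult[OF that] by (simp add: perp_subst_def ring_morphism_mult[OF m])
qed

text \<open>If \<open>f\<close> vanishes on the hyperplane orthogonal to \<open>v\<close>, so do at \<open>v\<close> the polynomials over \<open>K\<close> into which
  \<open>f (perp_point n A v)\<close> splits. This makes the locus of such \<open>v\<close> closed over \<open>K\<close>.\<close>

lemma perp_subst_map_zero:
  assumes f: "f \<in> dpolys K S" and \<mu>: "klinear K \<mu>" and zero: "\<And>A. deval \<delta> (perp_point n A v) f = 0"
  shows "deval \<delta> v (Poly_Mapping.map \<mu> (perp_subst \<delta> n A f)) = 0"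
proof -
  from separable_perp_subst[OF f, of n] obtain xs where
    xs: "\<forall>(p, q)\<in>set xs. p \<in> dpolys K UNIV \<and> term_fun {..<2 * n + 2} q"
      "\<forall>A. perp_subst \<delta> n A f = (\<Sum>(p, q)\<leftarrow>xs. p * dconst (q A))"
    unfolding separable_family_def by (elim exE conjE)
  let ?p = "\<lambda>r. fst (xs ! r)" and ?q = "\<lambda>r. snd (xs ! r)"
  have p: "?p r \<in> dpolys K UNIV" and q: "term_fun {..<2 * n + 2} (?q r)" if "r \<in> {..<length xs}" for r
    using bspec[OF xs(1), of "xs ! r"] that by (simp_all add: case_prod_beta)
  have eq: "perp_subst \<delta> n A f = (\<Sum>r<length xs. ?p r * dconst (?q r A))" for A
    by (simp add: xs(2) sum_list_sum_nth case_prod_beta atLeast0LessThan)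
  have zero': "(\<Sum>r<length xs. deval \<delta> v (?p r) * ?q r A) = 0" for A
    using zero[of A] unfolding deval_perp_subst[OF derivations, symmetric] eq
      ring_morphism_sum[OF ring_morphism_deval] ring_morphism_mult[OF ring_morphism_deval] deval_dconst .
  have spec: "specialization_closed (2 * n + 2) UNIV"
    by (simp add: specialization_closed_def)
  \<comment> \<open>The relation is read with coefficients \<open>deval \<delta> v (?p r)\<close>
    and functions \<open>?q r\<close> of an unrestricted \<open>A\<close>; the second form of
    \<open>descent_linear\<close> moves \<open>\<mu>\<close> onto the values
    \<open>?q r A\<close>.\<close>
  have "(\<Sum>r<length xs. deval \<delta> v (?p r) * \<mu> (?q r A)) = 0"
    using zero' by (intro descent_linear(2)[OF _ q spec _ \<mu>]) simp_all
  moreover have "Poly_Mapping.map \<mu> (perp_subst \<delta> n A f) = (\<Sum>r<length xs. ?p r * dconst (\<mu> (?q r A)))"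
    unfolding eq additive_sum[of "Poly_Mapping.map \<mu>", OF map_add[OF \<mu>]]
    using map_mult_dpolys[OF ksubfield \<mu> p] by (intro sum.cong refl) (simp add: dconst_def map_single_klinear[OF \<mu>])
  ultimately show ?thesis
    by (simp add: ring_morphism_sum[OF ring_morphism_deval] ring_morphism_mult[OF ring_morphism_deval])
qed

end

text \<open>For \<open>n = 0\<close> the projective space is a single point.\<close>

lemma proj_space_proper_subset_dim:
  assumes V: "V \<subset> proj_space n" "V \<noteq> {}"
  shows "n \<noteq> 0"
proof
  assume n: "n = 0"
  obtain p q where pq: "p \<in> V" "p \<in> proj_space n" "q \<in> proj_space n" "q \<notin> V"
    using V by blast
  obtain a where a: "a \<in> affine_space n" "a \<noteq> (\<lambda>_. 0)" "p = proj_point a"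
    using pq(2) by (rule proj_space_cases)
  obtain b where b: "b \<in> affine_space n" "b \<noteq> (\<lambda>_. 0)" "q = proj_point b"
    using pq(3) by (rule proj_space_cases)
  have a0: "a 0 \<noteq> 0" and b0: "b 0 \<noteq> 0"
    using affine_nonzero_coord[OF a(1,2)] affine_nonzero_coord[OF b(1,2)] n by auto
  have "b i = b 0 / a 0 * a i" for i
    using a(1) b(1) a0 n by (cases "i = 0") (auto simp: affine_space_def)
  then have "b = (\<lambda>i. b 0 / a 0 * a i)"
    by (rule ext)
  then have "b \<in> proj_point a"
    using a0 b0 unfolding proj_point_def by (intro CollectI exI[of _ "b 0 / a 0"]) simp
  then have "q = p"
    using proj_point_eq a(3) b(3) by simp
  then show False
    using pq by blast
qed

lemma orthogonal_nonzero:
  fixes v :: "nat \<Rightarrow> 'a::field"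
  assumes n: "n \<noteq> 0" and v: "v \<in> affine_space n" "v \<noteq> (\<lambda>_. 0)"
  obtains x j where "x \<in> affine_space n" "j \<le> n" "x j \<noteq> 0" "(\<Sum>i=0..n. v i * x i) = 0"
proof -
  obtain k where k: "k \<le> n" "v k \<noteq> 0"
    using affine_nonzero_coord[OF v] by blast
  obtain j where j: "j \<le> n" "j \<noteq> k"
    using n k(1) by (cases "k = 0") auto
  \<comment> \<open>Two coordinates of \<open>v\<close> are exchanged with a sign. The entry at
    \<open>j\<close> is \<open>v k\<close>, so the vector is nonzero.\<close>
  define x where "x = (\<lambda>i. if i = j then v k else if i = k then - v j else 0)"
  have "(\<Sum>i=0..n. v i * x i) = (\<Sum>i=0..n. (if i = j then v j * v k else 0) + (if i = k then - (v j * v k) else 0))"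
    using j(2) by (intro sum.cong refl) (auto simp: x_def)
  also have "\<dots> = 0"
    using j(1) k(1) by (simp add: sum.distrib)
  finally show thesis
    using j k by (intro that[of x j]) (auto simp: x_def affine_space_def)
qed

section \<open>Irreducibility of the union of the hyperplanes\<close>

context universal_subfield
begin

text \<open>Irreducibility restated for open sets: two nonempty relatively open subsets of
  \<open>V\<close> given by polynomials over \<open>K\<close> meet.\<close>

lemma irreducible_common_nonzero:
  assumes V: "V \<subseteq> proj_space n" and VK: "dclosed_over \<delta> K n V" and irr: "irreducible_over \<delta> K n V"
    and h1: "h1 \<in> hpolys \<delta> K n" and v1: "proj_point v1 \<in> V" "deval \<delta> v1 h1 \<noteq> 0"
    and h2: "h2 \<in> hpolys \<delta> K n" and v2: "proj_point v2 \<in> V" "deval \<delta> v2 h2 \<noteq> 0"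
  obtains v where "v \<in> affine_space n" "v \<noteq> (\<lambda>_. 0)" "proj_point v \<in> V" "deval \<delta> v h1 \<noteq> 0" "deval \<delta> v h2 \<noteq> 0"
proof -
  obtain FV where FV: "FV \<subseteq> hpolys \<delta> K n" "V = proj_zeros \<delta> n FV"
    using VK unfolding dclosed_over_hpolys by blast
  define C where "C = (\<lambda>h. proj_zeros \<delta> n (insert h FV))"
  have sub: "insert h FV \<subseteq> hpolys \<delta> K n" if "h \<in> hpolys \<delta> K n" for h
    using FV(1) that by blast
  have C_iff: "proj_point v \<in> C h \<longleftrightarrow> proj_point v \<in> V \<and> deval \<delta> v h = 0" if "h \<in> hpolys \<delta> K n" for v h
    unfolding C_def FV(2) proj_point_in_proj_zeros[OF derivations sub[OF that]] proj_point_in_proj_zeros[OF derivations FV(1)] by blast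
  have C_closed: "dclosed_over \<delta> K n (C h)" if "h \<in> hpolys \<delta> K n" for h
    unfolding dclosed_over_hpolys C_def using sub[OF that] by blast
  have C_sub: "C h \<subseteq> V" for h
    unfolding C_def FV(2) by (auto simp: proj_zeros_def)
  have "C h1 \<subset> V" "C h2 \<subset> V"
    using C_sub C_iff[OF h1, of v1] C_iff[OF h2, of v2] v1 v2 by blast+
  then have "V \<noteq> C h1 \<union> C h2"
    using irr C_closed[OF h1] C_closed[OF h2] unfolding irreducible_over_def by blast
  then obtain p where p: "p \<in> V" "p \<notin> C h1" "p \<notin> C h2"
    using C_sub by blast
  obtain v where v: "v \<in> affine_space n" "v \<noteq> (\<lambda>_. 0)" "p = proj_point v"
    using p(1) V proj_space_cases by blast
  show thesis
    using that[OF v(1,2)] p C_iff[OF h1] C_iff[OF h2] unfolding v(3) by blast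
qed

text \<open>If two proper closed subsets covered \<open>ld n V\<close>, some \<open>v\<close> in
  \<open>V\<close> would have its hyperplane contained in neither of them. Two polynomials, one from
  each subset, would then be nonzero somewhere on this hyperplane, hence simultaneously nonzero at a
  point of it, which neither subset contains.\<close>

lemma ld_irreducible_over:
  assumes V: "V \<subset> proj_space n" and VK: "dclosed_over \<delta> K n V" and irr: "irreducible_over \<delta> K n V"
  shows "irreducible_over \<delta> K n (ld n V)"
proof -
  have VS: "V \<subseteq> proj_space n"
    using V by blast
  have "V \<noteq> {}"
    using irr by (simp add: irreducible_over_def)
  then have n: "n \<noteq> 0"
    using proj_space_proper_subset_dim V by blast
  have ldI: "proj_point x \<in> ld n V"
    if "v \<in> affine_space n" "v \<noteq> (\<lambda>_. 0)" "proj_point v \<in> V" "x \<in> affine_space n" "x \<noteq> (\<lambda>_. 0)" "(\<Sum>i=0..n. v i * x i) = 0" for v x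
    unfolding lin_dependent_ppt[OF VS] using that proj_point_in_proj_space by blast
  have nonempty: "ld n V \<noteq> {}"
  proof -
    obtain p where "p \<in> V"
      using \<open>V \<noteq> {}\<close> by blast
    then obtain v where v: "v \<in> affine_space n" "v \<noteq> (\<lambda>_. 0)" "proj_point v \<in> V"
      using VS proj_space_cases by blast
    obtain x j where x: "x \<in> affine_space n" "j \<le> n" "x j \<noteq> 0" "(\<Sum>i=0..n. v i * x i) = 0"
      using orthogonal_nonzero[OF n v(1,2)] by blast
    then have "x \<noteq> (\<lambda>_. 0)"
      by auto
    then show ?thesis
      using ldI[OF v x(1) _ x(4)] by blast
  qed
  have "False" if C1: "dclosed_over \<delta> K n C1" "C1 \<subset> ld n V" and C2: "dclosed_over \<delta> K n C2" "C2 \<subset> ld n V"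
    and un: "ld n V = C1 \<union> C2" for C1 C2
  proof -
    \<comment> \<open>The polynomial \<open>h\<close> certifies escape from \<open>C\<close>: it has
      coefficients in \<open>K\<close>, is nonzero somewhere on \<open>V\<close>, and wherever it is
      nonzero the equation \<open>f\<close> of \<open>C\<close> fails somewhere on the corresponding
      hyperplane.\<close>
    have witness: "\<exists>F f h v. F \<subseteq> hpolys \<delta> K n \<and> C = proj_zeros \<delta> n F \<and> f \<in> F \<and> h \<in> hpolys \<delta> K n \<and> proj_point v \<in> V \<and>
        deval \<delta> v h \<noteq> 0 \<and> (\<forall>w. deval \<delta> w h \<noteq> 0 \<longrightarrow> (\<exists>A. deval \<delta> (perp_point n A w) f \<noteq> 0))"
      if C: "dclosed_over \<delta> K n C" "C \<subset> ld n V" for C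
    proof -
      obtain F where F: "F \<subseteq> hpolys \<delta> K n" "C = proj_zeros \<delta> n F"
        using C(1) unfolding dclosed_over_hpolys by blast
      obtain p where p: "p \<in> ld n V" "p \<notin> C"
        using C(2) by blast
      obtain a where a: "a \<in> affine_space n" "a \<noteq> (\<lambda>_. 0)" "p = proj_point a"
        using p(1) ld_subset proj_space_cases by blast
      obtain f where f: "f \<in> F" "deval \<delta> a f \<noteq> 0"
        using p(2) proj_point_in_proj_space[OF a(1,2)] unfolding a(3) F(2) proj_point_in_proj_zeros[OF derivations F(1)] by blast
      obtain v where v: "v \<in> affine_space n" "v \<noteq> (\<lambda>_. 0)" "proj_point v \<in> V" "(\<Sum>i=0..n. v i * a i) = 0"
        using p(1) unfolding a(3) lin_dependent_ppt[OF VS] by blast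
      obtain A where A: "perp_point n A v = a"
        using perp_point_surj[OF a(1) v(1,2,4)] by blast
      have fh: "f \<in> hpolys \<delta> K n"
        using f(1) F(1) by blast
      then have fK: "f \<in> dpolys K {..n}"
        by (simp add: hpolys_def)
      have "deval \<delta> v (perp_subst \<delta> n A f) \<noteq> 0"
        using f(2) by (simp add: deval_perp_subst[OF derivations] A)
      \<comment> \<open>\<open>perp_subst \<delta> n A f\<close> has the right value at
        \<open>v\<close> but coefficients involving \<open>A\<close>; a functional brings them into
        \<open>K\<close> without losing the nonzero value.\<close>
      then obtain \<mu> where \<mu>: "klinear K \<mu>" "range \<mu> \<subseteq> K" "deval \<delta> v (Poly_Mapping.map \<mu> (perp_subst \<delta> n A f)) \<noteq> 0"
        by (rule functional_detects_deval)
      let ?h = "Poly_Mapping.map \<mu> (perp_subst \<delta> n A f)"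
      have "?h \<in> hpolys \<delta> K n"
        by (rule map_hpolys[OF \<mu>(1,2) perp_subst_hpolys[OF derivations fh]])
      moreover have "\<exists>A. deval \<delta> (perp_point n A w) f \<noteq> 0" if "deval \<delta> w ?h \<noteq> 0" for w
        using that perp_subst_map_zero[OF fK \<mu>(1), where v = w and n = n and A = A] by blast
      ultimately show ?thesis
        using F f(1) v(3) \<mu>(3) by blast
    qed
    from witness[OF C1] obtain F1 f1 h1 v1 where
      1: "F1 \<subseteq> hpolys \<delta> K n" "C1 = proj_zeros \<delta> n F1" "f1 \<in> F1" "h1 \<in> hpolys \<delta> K n" "proj_point v1 \<in> V" "deval \<delta> v1 h1 \<noteq> 0"
        "\<forall>w. deval \<delta> w h1 \<noteq> 0 \<longrightarrow> (\<exists>A. deval \<delta> (perp_point n A w) f1 \<noteq> 0)"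
      by (elim exE conjE)
    from witness[OF C2] obtain F2 f2 h2 v2 where
      2: "F2 \<subseteq> hpolys \<delta> K n" "C2 = proj_zeros \<delta> n F2" "f2 \<in> F2" "h2 \<in> hpolys \<delta> K n" "proj_point v2 \<in> V" "deval \<delta> v2 h2 \<noteq> 0"
        "\<forall>w. deval \<delta> w h2 \<noteq> 0 \<longrightarrow> (\<exists>A. deval \<delta> (perp_point n A w) f2 \<noteq> 0)"
      by (elim exE conjE)
    obtain v where v: "v \<in> affine_space n" "v \<noteq> (\<lambda>_. 0)" "proj_point v \<in> V" and vh: "deval \<delta> v h1 \<noteq> 0" "deval \<delta> v h2 \<noteq> 0"
      by (rule irreducible_common_nonzero[OF VS VK irr 1(4-6) 2(4-6)])
    define H where "H = {x. x \<in> affine_space n \<and> (\<Sum>i=0..n. v i * x i) = 0}"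
    have line: "(\<lambda>i. x i + of_nat m * (y i - x i)) \<in> H" if xy: "x \<in> H" "y \<in> H" for x y :: "nat \<Rightarrow> 'a" and m
    proof -
      have "(\<Sum>i=0..n. v i * (x i + of_nat m * (y i - x i))) =
          (\<Sum>i=0..n. v i * x i) + of_nat m * ((\<Sum>i=0..n. v i * y i) - (\<Sum>i=0..n. v i * x i))"
        by (simp add: sum.distrib sum_subtractf sum_distrib_left algebra_simps)
      then show ?thesis
        using xy by (auto simp: H_def affine_space_def)
    qed
    have common: "\<exists>z\<in>H. deval \<delta> z f \<noteq> 0 \<and> deval \<delta> z g \<noteq> 0"
      if "x \<in> H" "deval \<delta> x f \<noteq> 0" "y \<in> H" "deval \<delta> y g \<noteq> 0" for x y and f g :: "(nat, 'm, 'a) dpoly"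
      using common_nonzero_on_line[OF derivations that(2,4)] line[OF that(1,3)] by metis
    have perp_H: "perp_point n A v \<in> H" for A
      by (simp add: H_def perp_point_affine perp_point_orthogonal)
    obtain A1 A2 where "deval \<delta> (perp_point n A1 v) f1 \<noteq> 0" "deval \<delta> (perp_point n A2 v) f2 \<noteq> 0"
      using 1(7) 2(7) vh by blast
    then obtain y where "y \<in> H" "deval \<delta> y f1 \<noteq> 0" "deval \<delta> y f2 \<noteq> 0"
      using common[OF perp_H _ perp_H] by blast
    \<comment> \<open>\<open>H\<close> also contains the zero vector, which is no projective point.
      The coordinate \<open>j\<close> is therefore kept nonzero together with the product of
      \<open>f1\<close> and \<open>f2\<close>, by a second use of the line argument.\<close>
    then have y: "y \<in> H" "deval \<delta> y (f1 * f2) \<noteq> 0"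
      by (simp_all add: ring_morphism_mult[OF ring_morphism_deval])
    obtain x j where x: "x \<in> affine_space n" "j \<le> n" "x j \<noteq> 0" "(\<Sum>i=0..n. v i * x i) = 0"
      using orthogonal_nonzero[OF n v(1,2)] by blast
    have "x \<in> H" "deval \<delta> x (dvar j) \<noteq> 0"
      using x by (simp_all add: H_def)
    then obtain z where z: "z \<in> H" "deval \<delta> z (f1 * f2) \<noteq> 0" "deval \<delta> z (dvar j) \<noteq> 0"
      using common[OF y] by blast
    have "z \<noteq> (\<lambda>_. 0)"
      using z(3) by auto
    then have "proj_point z \<in> ld n V"
      using ldI[OF v] z(1) by (simp add: H_def)
    then have "deval \<delta> z f1 = 0 \<or> deval \<delta> z f2 = 0"
      unfolding un 1(2) 2(2) Un_iff proj_point_in_proj_zeros[OF derivations 1(1)] proj_point_in_proj_zeros[OF derivations 2(1)]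
      using 1(3) 2(3) by blast
    then show False
      using z(2) by (auto simp: ring_morphism_mult[OF ring_morphism_deval])
  qed
  then show ?thesis
    unfolding irreducible_over_def using nonempty by blast
qed

end

theorem theorem4p3:
  fixes \<delta> :: "'m::finite \<Rightarrow> 'a::field_char_0 \<Rightarrow> 'a"
    and K :: "'a set"
    and n :: nat
    and V :: "(nat \<Rightarrow> 'a) set set"
  assumes "universal_domain \<delta>"
    and "differential_subfield \<delta> K"
    and "small K"
    and "V \<subset> proj_space n"
    and "dclosed_over \<delta> K n V"
    and "irreducible_over \<delta> K n V"
    and "complete_variety \<delta> n V"
  shows "dclosed_over \<delta> K n (ld n V) \<and> irreducible_over \<delta> K n (ld n V)"
proof -
  interpret universal_subfield \<delta> K
    by unfold_locales (fact assms)+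
  have V: "V \<subseteq> proj_space n"
    using assms(4) by blast
  show ?thesis
    using ld_dclosed_over[OF V assms(5) ld_dclosed[OF derivations V assms(7)]]
      ld_irreducible_over[OF assms(4-6)] by (rule conjI)
qed

end
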